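(* Let $1<q<\infty$ and $s>n/q'$. Let $f\in\mathcal{F}L^q_s(\mathbb{R}^n)$ be real-valued, and let $F$ be a function analytic on an open neighborhood in $\mathbb{C}$ of $f(\mathbb{R}^n)\cup\{0\}$ with $F(0)=0$. Then there exists $g\in\mathcal{F}L^q_s(\mathbb{R}^n)$ such that $g(x)=F(f(x))$ for all $x\in\mathbb{R}^n$.
   Context: $q'$ is the conjugate exponent, $1/q+1/q'=1$; $\langle\xi\rangle=(1+|\xi|^2)^{1/2}$; $\hat f(\xi)=\int f(x)e^{-ix\cdot\xi}dx$. $\mathcal{F}L^q_s(\mathbb{R}^n)$ is the space of tempered distributions $f$ with $\|f\|_{\mathcal{F}L^q_s}=\big(\int(\langle\xi\rangle^s|\hat f(\xi)|)^q d\xi\big)^{1/q}<\infty$; for $s>n/q'$ its elements are continuous functions vanishing at infinity (so $f(\mathbb{R}^n)\cup\{0\}$ is a compact subset of $\mathbb{R}$) and it is an algebra under pointwise multiplication. *)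

theory Defs
  imports "HOL-Analysis.Analysis"
begin

definition jbr :: "'a::euclidean_space \<Rightarrow> real" where
  "jbr \<xi> = sqrt (1 + (norm \<xi>)\<^sup>2)"

text \<open>Inverse Fourier transform (convention \<open>\<hat>f(\<xi>) = \<integral> f(x) e^{-i x\<cdot>\<xi>} dx\<close>):
  f(x) = (2\<pi>)^{-n} \<integral> h(\<xi>) e^{i x\<cdot>\<xi>} d\<xi>.\<close>
definition inv_fourier :: "('a::euclidean_space \<Rightarrow> complex) \<Rightarrow> 'a \<Rightarrow> complex" where
  "inv_fourier h x = complex_of_real ((2 * pi) powr (- real DIM('a))) *
     (LINT \<xi>|lborel. h \<xi> * exp (\<i> * complex_of_real (x \<bullet> \<xi>)))"

text \<open>Fourier-Lebesgue space FL^q_s(R^n), for the regime s > n/q' where its elements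
  are continuous functions: f belongs to it iff its Fourier transform h satisfies
  \<integral> (\<langle>\<xi>\<rangle>^s |h \<xi>|)^q d\<xi> < \<infinity> (h is then integrable by Hoelder) and f is
  the inverse Fourier transform of h.\<close>
definition FL :: "real \<Rightarrow> real \<Rightarrow> ('a::euclidean_space \<Rightarrow> complex) set" where
  "FL q s = {f. \<exists>h. h \<in> borel_measurable lborel \<and> integrable lborel h \<and>
       integrable lborel (\<lambda>\<xi>. (jbr \<xi> powr s * norm (h \<xi>)) powr q) \<and>
       (\<forall>x. f x = inv_fourier h x)}"

definition conj_exp :: "real \<Rightarrow> real" where
  "conj_exp q = q / (q - 1)"

end

theory Submission
  imports Defs "HOL-Complex_Analysis.Complex_Analysis" "HOL-Probability.Characteristic_Functions"
begin

text \<open>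
  Polynomials in \<open>f\<close> replace a functional calculus. If \<open>g\<close> is band-limited, a polynomial
  of degree \<open>d\<close> in \<open>g\<close> has its spectrum in a ball of radius \<open>O(d)\<close>, so its
  Fourier--Lebesgue norm is at most a power of \<open>d\<close> times its \<open>L\<^sup>1\<close> norm, which in turn is
  controlled by the supremum of the polynomial near the range of \<open>g\<close> once the constant and linear
  terms are split off and \<open>g \<in> L\<^sup>2\<close> is used. A Taylor expansion around a band-limited
  approximation extends this estimate to every \<open>f\<close> in the algebra. As \<open>f\<close> is real, continuous and vanishes
  at infinity, its range together with \<open>0\<close> lies in a compact interval inside \<open>U\<close>, near which \<open>F\<close> is
  a sum of polynomials of linearly growing degree whose suprema decay geometrically. This beats the
  polynomial loss, so the series converges in the algebra with a unit adjoined; the constant part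
  vanishes because \<open>F (f x) \<rightarrow> F 0 = 0\<close> at infinity.
\<close>

section \<open>Convolution and the inverse Fourier transform\<close>

text \<open>A power series of \<open>F\<close> at 0 does not suffice: submultiplicativity alone
  bounds powers of \<open>f\<close> only by powers of its algebra norm, which can far exceed the
  supremum, and \<open>U\<close> need not contain a disc around the range. What is needed is an
  estimate whose geometric part sees only values of polynomials near the range, with constants that
  depend on \<open>f\<close> but not on the polynomial. The constant and linear terms are set apart
  because a band-limited function is square integrable but in general not integrable, so only the
  part of a polynomial divisible by z^2 is sure to give an L^1 function. Bounds near the range, not
  just on it, are required because the Taylor coefficients are controlled by Cauchy's inequality.
  The polynomials arise from expanding the Cauchy kernel in powers of a rescaled Chebyshev
  polynomial \<open>T\<close> with |T| at most 2 on the interval and above 3 on the contour. The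
  threshold 5/2 near the interval gives the ratio 5/6, and each term has one more factor
  \<open>T\<close> than the one before, which makes the degrees grow linearly.\<close>

lemma lborel_reflect_translate:
  fixes t :: "'a::euclidean_space"
  shows "distr lborel borel (\<lambda>x. t - x) = lborel"
  using lborel_affine[of "-1" t] by (simp add: density_1)

lemma nn_integral_reflect_translate:
  fixes t :: "'a::euclidean_space"
  assumes [measurable]: "f \<in> borel_measurable borel"
  shows "(\<integral>\<^sup>+x. f (t - x) \<partial>lborel) = (\<integral>\<^sup>+x. f x \<partial>lborel)"
  by (subst (2) lborel_reflect_translate[symmetric, of t]) (simp add: nn_integral_distr)

lemma nn_integral_translate:
  fixes t :: "'a::euclidean_space"
  assumes [measurable]: "f \<in> borel_measurable borel"
  shows "(\<integral>\<^sup>+x. f (x - t) \<partial>lborel) = (\<integral>\<^sup>+x. f x \<partial>lborel)"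
  by (subst (2) lborel_distr_plus[symmetric, of "- t"]) (simp add: nn_integral_distr)

lemma lborel_integral_translate:
  fixes t :: "'a::euclidean_space" and f :: "'a \<Rightarrow> 'b::{banach, second_countable_topology}"
  assumes [measurable]: "f \<in> borel_measurable borel"
  shows "(LINT x|lborel. f (x - t)) = (LINT x|lborel. f x)"
  by (subst (2) lborel_distr_plus[symmetric, of "- t"]) (simp add: integral_distr)

text \<open>Young's inequality for u/U' and v/V', integrated, with U' > U and V' > V. The enlarged
  bounds are positive, so the division is legitimate even if U or V is 0; letting them decrease to U
  and V finishes the proof.\<close>

lemma Holder_nn_integral:
  fixes u v :: "'a \<Rightarrow> real"
  assumes q: "1 < q" "1 < q'" "1 / q + 1 / q' = 1"
    and [measurable]: "u \<in> borel_measurable M" "v \<in> borel_measurable M"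
    and nonneg: "\<And>x. 0 \<le> u x" "\<And>x. 0 \<le> v x" "0 \<le> U" "0 \<le> V"
    and le: "(\<integral>\<^sup>+x. ennreal (u x powr q) \<partial>M) \<le> ennreal (U powr q)"
      "(\<integral>\<^sup>+x. ennreal (v x powr q') \<partial>M) \<le> ennreal (V powr q')"
  shows "(\<integral>\<^sup>+x. ennreal (u x * v x) \<partial>M) \<le> ennreal (U * V)"
proof -
  have *: "(\<integral>\<^sup>+x. ennreal (u x * v x) \<partial>M) \<le> ennreal (U' * V')" if "U < U'" "V < V'" for U' V'
  proof -
    have pos: "0 < U'" "0 < V'" using nonneg that by linarith+
    have "ennreal (u x * v x) \<le> ennreal (U' * V') *
        (ennreal (1 / (q * U' powr q)) * ennreal (u x powr q) + ennreal (1 / (q' * V' powr q')) * ennreal (v x powr q'))" for x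
    proof -
      have "u x / U' * (v x / V') \<le> (u x / U') powr q / q + (v x / V') powr q' / q'"
        using nonneg pos by (intro Youngs_inequality q) auto
      then have "u x * v x \<le> U' * V' * ((u x / U') powr q / q + (v x / V') powr q' / q')"
        using pos by (simp add: field_simps)
      also have "\<dots> = U' * V' * (1 / (q * U' powr q) * u x powr q + 1 / (q' * V' powr q') * v x powr q')"
        using pos nonneg by (simp add: powr_divide mult.commute)
      finally show ?thesis
        using pos q nonneg by (subst ennreal_mult[symmetric] ennreal_plus[symmetric] | simp)+
    qed
    then have "(\<integral>\<^sup>+x. ennreal (u x * v x) \<partial>M) \<le> (\<integral>\<^sup>+x. ennreal (U' * V') *
        (ennreal (1 / (q * U' powr q)) * ennreal (u x powr q) + ennreal (1 / (q' * V' powr q')) * ennreal (v x powr q')) \<partial>M)"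
      by (intro nn_integral_mono)
    also have "\<dots> = ennreal (U' * V') *
        (ennreal (1 / (q * U' powr q)) * (\<integral>\<^sup>+x. ennreal (u x powr q) \<partial>M) + ennreal (1 / (q' * V' powr q')) * (\<integral>\<^sup>+x. ennreal (v x powr q') \<partial>M))"
      by (simp add: nn_integral_cmult nn_integral_add)
    also have "\<dots> \<le> ennreal (U' * V') * (ennreal (1 / (q * U' powr q)) * ennreal (U' powr q) + ennreal (1 / (q' * V' powr q')) * ennreal (V' powr q'))"
    proof -
      have "U powr q \<le> U' powr q" "V powr q' \<le> V' powr q'" using that nonneg q by (auto intro!: powr_mono2)
      then show ?thesis
        by (intro mult_left_mono add_mono order_trans[OF le(1)] order_trans[OF le(2)] ennreal_leI) auto
    qed
    also have "\<dots> = ennreal (U' * V' * (1 / (q * U' powr q) * U' powr q + 1 / (q' * V' powr q') * V' powr q'))"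
      using pos q by (subst ennreal_mult[symmetric] ennreal_plus[symmetric] | simp)+
    also have "1 / (q * U' powr q) * U' powr q + 1 / (q' * V' powr q') * V' powr q' = 1"
      using pos q by simp
    finally show ?thesis by simp
  qed
  have "(\<lambda>n. ennreal ((U + 1 / Suc n) * (V + 1 / Suc n))) \<longlonglongrightarrow> ennreal ((U + 0) * (V + 0))"
    by (intro tendsto_ennrealI tendsto_intros LIMSEQ_Suc[OF lim_1_over_n[where 'a=real]])
  then have "(\<lambda>n. ennreal ((U + 1 / Suc n) * (V + 1 / Suc n))) \<longlonglongrightarrow> ennreal (U * V)" by simp
  then show ?thesis
    by (rule LIMSEQ_le_const) (auto intro!: *)
qed

definition conv :: "('a::euclidean_space \<Rightarrow> complex) \<Rightarrow> ('a \<Rightarrow> complex) \<Rightarrow> 'a \<Rightarrow> complex" where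
  "conv h k \<xi> = (LINT \<eta>|lborel. h (\<xi> - \<eta>) * k \<eta>)"

lemma conv_measurable [measurable]:
  fixes h k :: "'a::euclidean_space \<Rightarrow> complex"
  assumes [measurable]: "h \<in> borel_measurable borel" "k \<in> borel_measurable borel"
  shows "conv h k \<in> borel_measurable borel"
proof -
  have "(\<lambda>\<xi>. LINT \<eta>|lborel. h (\<xi> - \<eta>) * k \<eta>) \<in> borel_measurable lborel"
    by (rule lborel.borel_measurable_lebesgue_integral) measurable
  then show ?thesis by (simp add: conv_def[abs_def])
qed

text \<open>A convolution integral that does not converge absolutely has the default value 0, so the
  estimate is available at every \<xi> before convergence is known.\<close>

lemma norm_conv_le:
  fixes h k :: "'a::euclidean_space \<Rightarrow> complex"
  shows "ennreal (norm (conv h k \<xi>)) \<le> (\<integral>\<^sup>+\<eta>. ennreal (norm (h (\<xi> - \<eta>)) * norm (k \<eta>)) \<partial>lborel)"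
proof (cases "integrable lborel (\<lambda>\<eta>. h (\<xi> - \<eta>) * k \<eta>)")
  case True
  then show ?thesis
    unfolding conv_def norm_mult[symmetric] by (rule integral_norm_bound_ennreal)
next
  case False
  then show ?thesis by (simp add: conv_def not_integrable_integral_eq)
qed

text \<open>Fubini together with the character identity e(\<xi>) = e(\<xi> - \<eta>) e(\<eta>). The
  left side carries the factor (2 pi)^(-n) twice and \<open>inv_fourier\<close> on the right only
  once, hence the explicit factor.\<close>

lemma inv_fourier_mult:
  fixes h k :: "'a::euclidean_space \<Rightarrow> complex"
  assumes [measurable]: "h \<in> borel_measurable borel" "k \<in> borel_measurable borel"
    and h: "integrable lborel h" and k: "integrable lborel k"
  shows "inv_fourier h x * inv_fourier k x =
    inv_fourier (\<lambda>\<xi>. complex_of_real ((2 * pi) powr (- real DIM('a))) * conv h k \<xi>) x"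
proof -
  let ?c = "complex_of_real ((2 * pi) powr (- real DIM('a)))"
  define e where "e \<xi> = exp (\<i> * complex_of_real (x \<bullet> \<xi>))" for \<xi> :: 'a
  have [measurable]: "e \<in> borel_measurable borel" unfolding e_def[abs_def] by measurable
  have norm_e: "norm (e \<xi>) = 1" for \<xi> by (simp add: e_def)
  have e_add: "e (\<xi> - \<eta>) * e \<eta> = e \<xi>" for \<xi> \<eta>
    by (simp add: e_def exp_add[symmetric] inner_diff_right algebra_simps)
  define f where "f \<xi> \<eta> = h (\<xi> - \<eta>) * k \<eta> * e \<xi>" for \<xi> \<eta>
  have [measurable]: "case_prod f \<in> borel_measurable (lborel \<Otimes>\<^sub>M lborel)"
    unfolding f_def[abs_def] by measurable
  have "(\<integral>\<^sup>+p. norm (case_prod f p) \<partial>(lborel \<Otimes>\<^sub>M lborel)) = (\<integral>\<^sup>+\<eta>. (\<integral>\<^sup>+\<xi>. norm (f \<xi> \<eta>) \<partial>lborel) \<partial>lborel)"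
    by (subst lborel_pair.nn_integral_snd[symmetric]) (auto simp: split_beta')
  also have "\<dots> = (\<integral>\<^sup>+\<eta>. ennreal (norm (k \<eta>)) * (\<integral>\<^sup>+\<xi>. norm (h \<xi>) \<partial>lborel) \<partial>lborel)"
  proof (intro nn_integral_cong)
    fix \<eta>
    have "(\<integral>\<^sup>+\<xi>. norm (f \<xi> \<eta>) \<partial>lborel) = (\<integral>\<^sup>+\<xi>. ennreal (norm (k \<eta>)) * norm (h (\<xi> - \<eta>)) \<partial>lborel)"
      by (intro nn_integral_cong) (simp add: f_def norm_mult norm_e ennreal_mult mult.commute)
    also have "\<dots> = ennreal (norm (k \<eta>)) * (\<integral>\<^sup>+\<xi>. norm (h \<xi>) \<partial>lborel)"
      using nn_integral_translate[of "\<lambda>x. ennreal (norm (h x))" \<eta>] by (simp add: nn_integral_cmult)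
    finally show "(\<integral>\<^sup>+\<xi>. norm (f \<xi> \<eta>) \<partial>lborel) = ennreal (norm (k \<eta>)) * (\<integral>\<^sup>+\<xi>. norm (h \<xi>) \<partial>lborel)" .
  qed
  also have "\<dots> = (\<integral>\<^sup>+\<xi>. norm (k \<xi>) \<partial>lborel) * (\<integral>\<^sup>+\<xi>. norm (h \<xi>) \<partial>lborel)"
    by (simp add: nn_integral_multc)
  also have "\<dots> < \<infinity>"
    using h k by (auto simp: integrable_iff_bounded ennreal_mult_less_top)
  finally have int: "integrable (lborel \<Otimes>\<^sub>M lborel) (case_prod f)"
    by (intro integrableI_bounded) auto
  have "(LINT \<xi>|lborel. conv h k \<xi> * e \<xi>) = (LINT \<xi>|lborel. LINT \<eta>|lborel. f \<xi> \<eta>)"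
    by (simp add: conv_def f_def)
  also have "\<dots> = (LINT \<eta>|lborel. LINT \<xi>|lborel. f \<xi> \<eta>)"
    using lborel_pair.Fubini_integral[OF int] ..
  also have "\<dots> = (LINT \<eta>|lborel. (k \<eta> * e \<eta>) * (LINT \<xi>|lborel. h \<xi> * e \<xi>))"
  proof (intro Bochner_Integration.integral_cong refl)
    fix \<eta>
    have "f \<xi> \<eta> = (k \<eta> * e \<eta>) * (h (\<xi> - \<eta>) * e (\<xi> - \<eta>))" for \<xi>
      unfolding f_def e_add[of \<xi> \<eta>, symmetric] by (simp add: mult_ac)
    then have "(LINT \<xi>|lborel. f \<xi> \<eta>) = (LINT \<xi>|lborel. (k \<eta> * e \<eta>) * (h (\<xi> - \<eta>) * e (\<xi> - \<eta>)))"
      by simp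
    also have "\<dots> = (k \<eta> * e \<eta>) * (LINT \<xi>|lborel. h \<xi> * e \<xi>)"
      using lborel_integral_translate[of "\<lambda>\<xi>. h \<xi> * e \<xi>" \<eta>] by simp
    finally show "(LINT \<xi>|lborel. f \<xi> \<eta>) = (k \<eta> * e \<eta>) * (LINT \<xi>|lborel. h \<xi> * e \<xi>)" .
  qed
  finally have "(LINT \<xi>|lborel. conv h k \<xi> * e \<xi>) = (LINT \<xi>|lborel. k \<xi> * e \<xi>) * (LINT \<xi>|lborel. h \<xi> * e \<xi>)"
    by simp
  moreover have "(LINT \<xi>|lborel. ?c * conv h k \<xi> * e \<xi>) = ?c * (LINT \<xi>|lborel. conv h k \<xi> * e \<xi>)"
    by (simp add: mult.assoc)
  ultimately show ?thesis
    unfolding inv_fourier_def e_def[symmetric] by (simp only: mult_ac)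
qed

lemma lborel_integral_affine:
  fixes f :: "'a::euclidean_space \<Rightarrow> complex" and t :: 'a
  assumes "c \<noteq> 0" and [measurable]: "f \<in> borel_measurable borel"
  shows "(LINT x|lborel. f x) = complex_of_real (\<bar>c\<bar> ^ DIM('a)) * (LINT x|lborel. f (t + c *\<^sub>R x))"
proof -
  have "(LINT x|lborel. f x) = (LINT x|density (distr lborel borel (\<lambda>x. t + c *\<^sub>R x)) (\<lambda>_. ennreal (\<bar>c\<bar> ^ DIM('a))). f x)"
    by (subst lborel_affine[OF assms(1), of t]) simp
  also have "\<dots> = (LINT x|distr lborel borel (\<lambda>x. t + c *\<^sub>R x). (\<bar>c\<bar> ^ DIM('a)) *\<^sub>R f x)"
    by (intro integral_density) auto
  also have "\<dots> = (LINT x|lborel. (\<bar>c\<bar> ^ DIM('a)) *\<^sub>R f (t + c *\<^sub>R x))"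
    by (intro integral_distr) auto
  finally show ?thesis by (simp add: scaleR_conv_of_real)
qed

lemma norm_inv_fourier_le:
  fixes h :: "'a::euclidean_space \<Rightarrow> complex"
  shows "norm (inv_fourier h x) \<le> (2 * pi) powr (- real DIM('a)) * (LINT \<xi>|lborel. norm (h \<xi>))"
proof -
  have "norm (LINT \<xi>|lborel. h \<xi> * exp (\<i> * complex_of_real (x \<bullet> \<xi>))) \<le>
     (LINT \<xi>|lborel. norm (h \<xi> * exp (\<i> * complex_of_real (x \<bullet> \<xi>))))"
    by (rule integral_norm_bound)
  then show ?thesis
    by (simp add: inv_fourier_def norm_mult mult_left_mono)
qed

lemma inv_fourier_integrable_exp:
  fixes h :: "'a::euclidean_space \<Rightarrow> complex"
  assumes "integrable lborel h"
  shows "integrable lborel (\<lambda>\<xi>. h \<xi> * exp (\<i> * complex_of_real (x \<bullet> \<xi>)))"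
proof (rule Bochner_Integration.integrable_bound[OF assms])
  have [measurable]: "h \<in> borel_measurable borel" using borel_measurable_integrable[OF assms] by simp
  show "(\<lambda>\<xi>. h \<xi> * exp (\<i> * complex_of_real (x \<bullet> \<xi>))) \<in> borel_measurable lborel" by measurable
qed (auto simp: norm_mult)

lemma inv_fourier_add:
  fixes h k :: "'a::euclidean_space \<Rightarrow> complex"
  assumes "integrable lborel h" "integrable lborel k"
  shows "inv_fourier (\<lambda>\<xi>. h \<xi> + k \<xi>) x = inv_fourier h x + inv_fourier k x"
  using inv_fourier_integrable_exp[OF assms(1), of x] inv_fourier_integrable_exp[OF assms(2), of x]
  by (simp add: inv_fourier_def distrib_right distrib_left)

lemma inv_fourier_cmult:
  fixes h :: "'a::euclidean_space \<Rightarrow> complex"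
  shows "inv_fourier (\<lambda>\<xi>. a * h \<xi>) x = a * inv_fourier h x"
  by (simp add: inv_fourier_def mult.assoc mult.left_commute)

lemma inv_fourier_measurable [measurable]:
  fixes h :: "'a::euclidean_space \<Rightarrow> complex"
  assumes [measurable]: "h \<in> borel_measurable borel"
  shows "inv_fourier h \<in> borel_measurable borel"
proof -
  have "(\<lambda>x. LINT \<xi>|lborel. h \<xi> * exp (\<i> * complex_of_real (x \<bullet> \<xi>))) \<in> borel_measurable (lborel :: 'a measure)"
    by (rule lborel.borel_measurable_lebesgue_integral) measurable
  then show ?thesis by (simp add: inv_fourier_def[abs_def])
qed

text \<open>Reflection of the frequency variable; it serves to write the squared modulus of an
  inverse transform as an inverse transform again.\<close>

lemma inv_fourier_cnj:
  fixes h :: "'a::euclidean_space \<Rightarrow> complex"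
  assumes [measurable]: "h \<in> borel_measurable borel"
  shows "inv_fourier (\<lambda>\<xi>. cnj (h (- \<xi>))) x = cnj (inv_fourier h x)"
proof -
  have "(LINT \<xi>|lborel. h \<xi> * exp (\<i> * complex_of_real (x \<bullet> \<xi>)))
    = (LINT \<xi>|lborel. h (- \<xi>) * exp (- (\<i> * complex_of_real (x \<bullet> \<xi>))))"
    using lborel_integral_affine[of "-1" "\<lambda>\<xi>. h \<xi> * exp (\<i> * complex_of_real (x \<bullet> \<xi>))" 0] by simp
  then have "cnj (LINT \<xi>|lborel. h \<xi> * exp (\<i> * complex_of_real (x \<bullet> \<xi>)))
    = (LINT \<xi>|lborel. cnj (h (- \<xi>) * exp (- (\<i> * complex_of_real (x \<bullet> \<xi>)))))"
    by (simp only: Bochner_Integration.integral_cnj)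
  then show ?thesis by (simp add: inv_fourier_def exp_cnj)
qed

lemma continuous_inv_fourier:
  fixes h :: "'a::euclidean_space \<Rightarrow> complex"
  assumes h: "integrable lborel h"
  shows "continuous_on UNIV (inv_fourier h)"
proof (rule continuous_on_sequentiallyI)
  have [measurable]: "h \<in> borel_measurable borel" using borel_measurable_integrable[OF h] by simp
  fix u and x :: 'a assume u: "u \<longlonglongrightarrow> x"
  have "(\<lambda>n. LINT \<xi>|lborel. h \<xi> * exp (\<i> * complex_of_real (u n \<bullet> \<xi>))) \<longlonglongrightarrow>
    (LINT \<xi>|lborel. h \<xi> * exp (\<i> * complex_of_real (x \<bullet> \<xi>)))"
  proof (rule integral_dominated_convergence[where w="\<lambda>\<xi>. norm (h \<xi>)"])
    show "AE \<xi> in lborel. (\<lambda>n. h \<xi> * exp (\<i> * complex_of_real (u n \<bullet> \<xi>))) \<longlonglongrightarrow> h \<xi> * exp (\<i> * complex_of_real (x \<bullet> \<xi>))"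
      by (intro AE_I2 tendsto_intros u)
    show "AE \<xi> in lborel. norm (h \<xi> * exp (\<i> * complex_of_real (u n \<bullet> \<xi>))) \<le> norm (h \<xi>)" for n
      by (simp add: norm_mult)
  qed (use h in auto)
  then show "(\<lambda>n. inv_fourier h (u n)) \<longlonglongrightarrow> inv_fourier h x"
    unfolding inv_fourier_def by (rule tendsto_mult_left)
qed

section \<open>Weighted algebras\<close>

text \<open>The properties of \<open>jbr x powr s\<close> on which the argument rests.
  \<open>weight_integrable\<close> puts 1/w in L^q', which embeds the weighted L^q space in L^1; it
  is what s > n/q' provides. The maximum in \<open>weight_add_le\<close> suits the kernel estimate
  behind the product bound. \<open>weight_growth\<close> makes the norm of a band-limited function
  cost only a power of its band.\<close>

locale fourier_weight =
  fixes q c :: real and w :: "'a::euclidean_space \<Rightarrow> real"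
  assumes q_gt_1: "1 < q"
    and weight_measurable [measurable]: "w \<in> borel_measurable borel"
    and weight_ge_1: "1 \<le> w x"
    and weight_add_le: "w (x + y) \<le> c * max (w x) (w y)"
    and weight_integrable: "integrable lborel (\<lambda>x. w x powr (- (q / (q - 1))))"
    and weight_growth: "\<exists>N::nat. \<forall>x. w x \<le> (1 + norm x) ^ N"
begin

definition q' :: real where "q' = q / (q - 1)"

lemma q'_gt_1: "1 < q'" and conjugate_exponents: "1 / q + 1 / q' = 1"
  using q_gt_1 by (auto simp: q'_def field_simps)

lemma weight_pos: "0 < w x"
  using weight_ge_1[of x] by linarith

lemma weight_nonneg [simp]: "0 \<le> w x"
  using weight_pos[of x] by simp

lemma c_pos: "0 < c"
  using weight_add_le[of 0 0] weight_pos[of 0] by (simp add: zero_less_mult_iff less_le_trans)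

definition wconst :: real where "wconst = (LINT x|lborel. w x powr (- q'))"

lemma wconst_nonneg: "0 \<le> wconst"
  unfolding wconst_def by (intro integral_nonneg_AE) auto

lemma nn_integral_weight: "(\<integral>\<^sup>+x. ennreal (w x powr (- q')) \<partial>lborel) = ennreal wconst"
  unfolding wconst_def using weight_integrable
  by (intro nn_integral_eq_integral) (auto simp: q'_def)

text \<open>Here and below, norms enter only as predicates stating an upper bound, so that representations
  need not be unique.\<close>
definition wlq_le :: "('a \<Rightarrow> complex) \<Rightarrow> real \<Rightarrow> bool" where
  "wlq_le h B \<longleftrightarrow> h \<in> borel_measurable borel \<and> 0 \<le> B \<and>
    (\<integral>\<^sup>+\<xi>. ennreal ((w \<xi> * norm (h \<xi>)) powr q) \<partial>lborel) \<le> ennreal (B powr q)"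

lemma hbI:
  assumes "h \<in> borel_measurable borel" "0 \<le> B"
    and "(\<integral>\<^sup>+\<xi>. ennreal ((w \<xi> * norm (h \<xi>)) powr q) \<partial>lborel) \<le> ennreal (B powr q)"
  shows "wlq_le h B"
  using assms by (simp add: wlq_le_def)

lemma wlq_le_measurable: "wlq_le h B \<Longrightarrow> h \<in> borel_measurable borel"
  and wlq_le_nonneg: "wlq_le h B \<Longrightarrow> 0 \<le> B"
  and wlq_le_le: "wlq_le h B \<Longrightarrow> (\<integral>\<^sup>+\<xi>. ennreal ((w \<xi> * norm (h \<xi>)) powr q) \<partial>lborel) \<le> ennreal (B powr q)"
  by (auto simp: wlq_le_def)

lemma wlq_le_mono:
  assumes "wlq_le h B" "B \<le> B'"
  shows "wlq_le h B'"
proof (rule hbI)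
  have "B powr q \<le> B' powr q" using assms wlq_le_nonneg[OF assms(1)] q_gt_1 by (intro powr_mono2) auto
  then show "(\<integral>\<^sup>+\<xi>. ennreal ((w \<xi> * norm (h \<xi>)) powr q) \<partial>lborel) \<le> ennreal (B' powr q)"
    using wlq_le_le[OF assms(1)] by (meson ennreal_leI order_trans)
qed (use assms wlq_le_measurable wlq_le_nonneg in force)+

text \<open>Reduces an estimate to strictly larger bounds, which are positive and may be divided by;
  the triangle inequality below relies on this when a bound is 0.\<close>

lemma wlq_le_limit:
  assumes "\<And>B'. B < B' \<Longrightarrow> wlq_le h B'" "0 \<le> B"
  shows "wlq_le h B"
proof (rule hbI)
  have "(\<lambda>n. ennreal ((B + 1 / Suc n) powr q)) \<longlonglongrightarrow> ennreal ((B + 0) powr q)"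
    using q_gt_1 assms(2)
    by (intro tendsto_ennrealI tendsto_powr2 tendsto_intros LIMSEQ_Suc[OF lim_1_over_n[where 'a=real]]) auto
  then have "(\<lambda>n. ennreal ((B + 1 / Suc n) powr q)) \<longlonglongrightarrow> ennreal (B powr q)" by simp
  then show "(\<integral>\<^sup>+\<xi>. ennreal ((w \<xi> * norm (h \<xi>)) powr q) \<partial>lborel) \<le> ennreal (B powr q)"
    by (rule LIMSEQ_le_const) (auto intro!: wlq_le_le assms(1))
  show "h \<in> borel_measurable borel" using assms(1)[of "B + 1"] wlq_le_measurable by auto
qed fact

text \<open>Hoelder for the factorisation |h| = (w |h|) (1/w), where 1/w lies in L^q'.\<close>

lemma wlq_le_L1:
  assumes "wlq_le h B"
  shows "integrable lborel h" "(LINT \<xi>|lborel. norm (h \<xi>)) \<le> wconst powr (1 / q') * B"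
proof -
  note [measurable] = wlq_le_measurable[OF assms]
  have "(\<integral>\<^sup>+x. ennreal ((w x * norm (h x)) * (1 / w x)) \<partial>lborel) \<le> ennreal (B * wconst powr (1 / q'))"
  proof (rule Holder_nn_integral[OF q_gt_1 q'_gt_1 conjugate_exponents])
    show "(\<integral>\<^sup>+x. ennreal ((1 / w x) powr q') \<partial>lborel) \<le> ennreal ((wconst powr (1 / q')) powr q')"
      using nn_integral_weight wconst_nonneg q'_gt_1
      by (simp add: powr_powr powr_divide powr_minus inverse_eq_divide)
  qed (use wlq_le_le[OF assms] wlq_le_nonneg[OF assms] in auto)
  moreover have "(w x * norm (h x)) * (1 / w x) = norm (h x)" for x
    using weight_pos[of x] by simp
  ultimately have le: "(\<integral>\<^sup>+x. ennreal (norm (h x)) \<partial>lborel) \<le> ennreal (B * wconst powr (1 / q'))"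
    by simp
  then show int: "integrable lborel h"
    by (intro integrableI_bounded) (auto intro: le_less_trans)
  have "(\<integral>\<^sup>+x. ennreal (norm (h x)) \<partial>lborel) = ennreal (LINT \<xi>|lborel. norm (h \<xi>))"
    using int by (intro nn_integral_eq_integral) auto
  with le show "(LINT \<xi>|lborel. norm (h \<xi>)) \<le> wconst powr (1 / q') * B"
    using wlq_le_nonneg[OF assms] by (simp add: mult.commute)
qed

lemma wlq_le_cmult:
  assumes "wlq_le h B"
  shows "wlq_le (\<lambda>\<xi>. a * h \<xi>) (norm a * B)"
proof (rule hbI)
  note [measurable] = wlq_le_measurable[OF assms]
  show "(\<lambda>\<xi>. a * h \<xi>) \<in> borel_measurable borel" by measurable
  show "0 \<le> norm a * B" using wlq_le_nonneg[OF assms] by simp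
  have "(\<integral>\<^sup>+\<xi>. ennreal ((w \<xi> * norm (a * h \<xi>)) powr q) \<partial>lborel)
      = (\<integral>\<^sup>+\<xi>. ennreal (norm a powr q) * ennreal ((w \<xi> * norm (h \<xi>)) powr q) \<partial>lborel)"
    by (intro nn_integral_cong) (simp add: norm_mult ennreal_mult[symmetric] powr_mult[symmetric] mult_ac)
  also have "\<dots> \<le> ennreal (norm a powr q) * ennreal (B powr q)"
    using wlq_le_le[OF assms] by (simp add: nn_integral_cmult mult_left_mono)
  also have "\<dots> = ennreal ((norm a * B) powr q)"
    using wlq_le_nonneg[OF assms] by (simp add: ennreal_mult[symmetric] powr_mult)
  finally show "(\<integral>\<^sup>+\<xi>. ennreal ((w \<xi> * norm (a * h \<xi>)) powr q) \<partial>lborel) \<le> ennreal ((norm a * B) powr q)" .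
qed

text \<open>Convexity of t^q at the points x/A and y/B with weights A/(A+B) and B/(A+B), multiplied
  by (A+B)^q. It is derived from the Young inequality \<open>tangent\<close>: averaging that over
  the two points, whose mean is m, gives m^q \<le> average/q + m^q/q', and 1 - 1/q' = 1/q.\<close>

lemma powr_convex_combination:
  assumes "0 < A" "0 < B" "0 \<le> x" "0 \<le> y"
  shows "(x + y) powr q \<le> (A + B) powr q * (A / (A + B) * (x / A) powr q + B / (A + B) * (y / B) powr q)"
proof -
  define m where "m = (x + y) / (A + B)"
  have m: "0 \<le> m" and xy: "A / (A + B) * (x / A) + B / (A + B) * (y / B) = m"
    using assms by (auto simp: m_def add_divide_distrib)
  have tangent: "t * m powr (q - 1) \<le> t powr q / q + m powr q / q'" if "0 \<le> t" for t
    using Youngs_inequality[OF q_gt_1 q'_gt_1 conjugate_exponents that, of "m powr (q - 1)"] q_gt_1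
    by (simp add: powr_powr q'_def)
  have "m * m powr (q - 1) = A / (A + B) * (x / A * m powr (q - 1)) + B / (A + B) * (y / B * m powr (q - 1))"
    by (subst (1) xy[symmetric]) (simp only: distrib_right mult.assoc)
  also have "\<dots> \<le> A / (A + B) * ((x / A) powr q / q + m powr q / q') + B / (A + B) * ((y / B) powr q / q + m powr q / q')"
    using assms by (intro add_mono mult_left_mono tangent) auto
  also have "\<dots> = (A / (A + B) * (x / A) powr q + B / (A + B) * (y / B) powr q) / q + (A / (A + B) + B / (A + B)) * (m powr q / q')"
    by (simp only: distrib_left distrib_right add_divide_distrib times_divide_eq_right add_ac)
  also have "A / (A + B) + B / (A + B) = 1" using assms by (simp add: add_divide_distrib[symmetric])
  also have "m * m powr (q - 1) = m powr q"
    using m by (cases "m = 0") (auto simp: powr_mult_base)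
  finally have "m powr q * (1 - 1 / q') \<le> (A / (A + B) * (x / A) powr q + B / (A + B) * (y / B) powr q) / q"
    by (simp add: right_diff_distrib)
  also have "1 - 1 / q' = 1 / q" using conjugate_exponents by simp
  finally have "m powr q \<le> A / (A + B) * (x / A) powr q + B / (A + B) * (y / B) powr q"
    using q_gt_1 by (simp add: divide_le_cancel)
  then show ?thesis
    using assms by (simp add: m_def powr_divide pos_divide_le_eq mult.commute)
qed

text \<open>Minkowski's inequality by normalisation: once the norms are at most A' and B', the
  convexity estimate integrates to (A'+B')^q times a convex combination of two numbers not exceeding
  1.\<close>

lemma wlq_le_add:
  assumes "wlq_le h A" "wlq_le k B"
  shows "wlq_le (\<lambda>\<xi>. h \<xi> + k \<xi>) (A + B)"
proof (rule wlq_le_limit)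
  note [measurable] = wlq_le_measurable[OF assms(1)] wlq_le_measurable[OF assms(2)]
  show "0 \<le> A + B" using wlq_le_nonneg assms by (auto intro: add_nonneg_nonneg)
  fix D assume "A + B < D"
  \<comment> \<open>The slack D - A - B is shared equally, so that both bounds become positive and
    add up to D.\<close>
  define A' B' where "A' = A + (D - A - B) / 2" and "B' = B + (D - A - B) / 2"
  have D: "D = A' + B'" "A \<le> A'" "B \<le> B'" "0 < A'" "0 < B'"
    using \<open>A + B < D\<close> wlq_le_nonneg[OF assms(1)] wlq_le_nonneg[OF assms(2)] by (auto simp: A'_def B'_def field_simps)
  have h: "wlq_le h A'" and k: "wlq_le k B'" using wlq_le_mono assms D by blast+
  define \<alpha> \<beta> where "\<alpha> = D powr q * (A' / D) / A' powr q" and "\<beta> = D powr q * (B' / D) / B' powr q"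
  have nonneg: "0 \<le> \<alpha>" "0 \<le> \<beta>" using D by (auto simp: \<alpha>_def \<beta>_def)
  have ennreal_comb: "ennreal (\<alpha> * x + \<beta> * y) = ennreal \<alpha> * ennreal x + ennreal \<beta> * ennreal y" if "0 \<le> x" "0 \<le> y" for x y
    using nonneg that by (simp add: ennreal_mult)
  have "(\<integral>\<^sup>+\<xi>. ennreal ((w \<xi> * norm (h \<xi> + k \<xi>)) powr q) \<partial>lborel) \<le>
     (\<integral>\<^sup>+\<xi>. ennreal \<alpha> * ennreal ((w \<xi> * norm (h \<xi>)) powr q) +
        ennreal \<beta> * ennreal ((w \<xi> * norm (k \<xi>)) powr q) \<partial>lborel)"
  proof (intro nn_integral_mono)
    fix \<xi>
    have "(w \<xi> * norm (h \<xi> + k \<xi>)) powr q \<le> (w \<xi> * norm (h \<xi>) + w \<xi> * norm (k \<xi>)) powr q"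
      using q_gt_1 by (intro powr_mono2) (auto simp: distrib_left[symmetric] intro!: mult_left_mono norm_triangle_ineq)
    also have "\<dots> \<le> D powr q * (A' / D * (w \<xi> * norm (h \<xi>) / A') powr q + B' / D * (w \<xi> * norm (k \<xi>) / B') powr q)"
      unfolding D(1) using D by (intro powr_convex_combination) auto
    also have "\<dots> = \<alpha> * (w \<xi> * norm (h \<xi>)) powr q +
        \<beta> * (w \<xi> * norm (k \<xi>)) powr q"
      using D by (simp add: \<alpha>_def \<beta>_def powr_divide distrib_left)
    finally show "ennreal ((w \<xi> * norm (h \<xi> + k \<xi>)) powr q) \<le> ennreal \<alpha> * ennreal ((w \<xi> * norm (h \<xi>)) powr q) +
        ennreal \<beta> * ennreal ((w \<xi> * norm (k \<xi>)) powr q)"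
      by (simp add: ennreal_comb[symmetric] ennreal_leI)
  qed
  also have "\<dots> = ennreal \<alpha> * (\<integral>\<^sup>+\<xi>. ennreal ((w \<xi> * norm (h \<xi>)) powr q) \<partial>lborel) +
        ennreal \<beta> * (\<integral>\<^sup>+\<xi>. ennreal ((w \<xi> * norm (k \<xi>)) powr q) \<partial>lborel)"
    by (simp add: nn_integral_add nn_integral_cmult)
  also have "\<dots> \<le> ennreal \<alpha> * ennreal (A' powr q) +
        ennreal \<beta> * ennreal (B' powr q)"
    using wlq_le_le[OF h] wlq_le_le[OF k] by (intro add_mono mult_left_mono) auto
  also have "\<dots> = ennreal (D powr q * (A' / D) + D powr q * (B' / D))"
    using D by (subst ennreal_comb[symmetric]) (auto simp: \<alpha>_def \<beta>_def)
  also have "D powr q * (A' / D) + D powr q * (B' / D) = D powr q"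
  proof -
    have "D powr q * (A' / D) + D powr q * (B' / D) = D powr q * ((A' + B') / D)"
      by (simp only: distrib_left add_divide_distrib)
    then show ?thesis using D by simp
  qed
  finally show "wlq_le (\<lambda>\<xi>. h \<xi> + k \<xi>) D"
    using D by (intro hbI) auto
qed

lemma wlq_le_0: "wlq_le (\<lambda>_. 0) 0"
  using q_gt_1 by (auto simp: wlq_le_def)

lemma wlq_le_sum:
  assumes "\<And>k::nat. wlq_le (h k) (B k)"
  shows "wlq_le (\<lambda>\<xi>. \<Sum>k<n. h k \<xi>) (\<Sum>k<n. B k)"
proof (induction n)
  case (Suc n)
  show ?case using wlq_le_add[OF Suc assms[of n]] by simp
qed (simp add: wlq_le_0)

lemma wlq_le_Fatou:
  assumes P: "\<And>n. wlq_le (P n) B" and [measurable]: "h \<in> borel_measurable borel"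
    and lim: "AE \<xi> in lborel. (\<lambda>n. P n \<xi>) \<longlonglongrightarrow> h \<xi>"
  shows "wlq_le h B"
proof (rule hbI)
  note [measurable] = wlq_le_measurable[OF P]
  have "(\<integral>\<^sup>+\<xi>. ennreal ((w \<xi> * norm (h \<xi>)) powr q) \<partial>lborel)
      = (\<integral>\<^sup>+\<xi>. liminf (\<lambda>n. ennreal ((w \<xi> * norm (P n \<xi>)) powr q)) \<partial>lborel)"
  proof (intro nn_integral_cong_AE, use lim in eventually_elim)
    fix \<xi> assume "(\<lambda>n. P n \<xi>) \<longlonglongrightarrow> h \<xi>"
    then have "(\<lambda>n. ennreal ((w \<xi> * norm (P n \<xi>)) powr q)) \<longlonglongrightarrow> ennreal ((w \<xi> * norm (h \<xi>)) powr q)"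
      using q_gt_1 by (intro tendsto_ennrealI tendsto_powr2 tendsto_intros) auto
    then show "ennreal ((w \<xi> * norm (h \<xi>)) powr q) = liminf (\<lambda>n. ennreal ((w \<xi> * norm (P n \<xi>)) powr q))"
      by (metis lim_imp_Liminf trivial_limit_sequentially)
  qed
  also have "\<dots> \<le> liminf (\<lambda>n. \<integral>\<^sup>+\<xi>. ennreal ((w \<xi> * norm (P n \<xi>)) powr q) \<partial>lborel)"
    by (intro nn_integral_liminf) measurable
  also have "\<dots> \<le> liminf (\<lambda>n. ennreal (B powr q))"
    using wlq_le_le[OF P] by (intro Liminf_mono always_eventually allI)
  finally show "(\<integral>\<^sup>+\<xi>. ennreal ((w \<xi> * norm (h \<xi>)) powr q) \<partial>lborel) \<le> ennreal (B powr q)"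
    by (simp add: Liminf_const)
qed (use wlq_le_nonneg[OF P] in auto)

text \<open>Completeness of the weighted space. By the L^1 embedding the series converges absolutely
  almost everywhere; Fatou passes the bound to the sum, and summability of the L^1 norms permits
  termwise integration against the exponential. The default value of the sum where the series
  diverges affects only a null set.\<close>

lemma wlq_le_suminf:
  assumes h: "\<And>k. wlq_le (h k) (B k)" and B: "summable B"
  shows "wlq_le (\<lambda>\<xi>. \<Sum>k. h k \<xi>) (\<Sum>k. B k)"
    and "\<And>x::'a. (\<lambda>k. inv_fourier (h k) x) sums inv_fourier (\<lambda>\<xi>. \<Sum>k. h k \<xi>) x"
proof -
  note [measurable] = wlq_le_measurable[OF h]
  let ?C = "wconst powr (1 / q')"
  have B0: "0 \<le> B k" for k using wlq_le_nonneg[OF h] .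
  have "(\<integral>\<^sup>+\<xi>. (\<Sum>k. ennreal (norm (h k \<xi>))) \<partial>lborel) = (\<Sum>k. \<integral>\<^sup>+\<xi>. ennreal (norm (h k \<xi>)) \<partial>lborel)"
    by (intro nn_integral_suminf) measurable
  also have "\<dots> = (\<Sum>k. ennreal (LINT \<xi>|lborel. norm (h k \<xi>)))"
    using wlq_le_L1(1)[OF h] by (subst nn_integral_eq_integral) auto
  also have "\<dots> \<le> (\<Sum>k. ennreal (?C * B k))"
    using wlq_le_L1(2)[OF h] by (intro suminf_le ennreal_leI) auto
  also have "\<dots> = ennreal (\<Sum>k. ?C * B k)"
    using B B0 by (intro suminf_ennreal2 summable_mult) auto
  finally have "(\<integral>\<^sup>+\<xi>. (\<Sum>k. ennreal (norm (h k \<xi>))) \<partial>lborel) \<noteq> \<infinity>"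
    by (auto simp: top_unique)
  then have "AE \<xi> in lborel. (\<Sum>k. ennreal (norm (h k \<xi>))) \<noteq> \<infinity>"
    by (intro nn_integral_noteq_infinite) auto
  then have AE: "AE \<xi> in lborel. summable (\<lambda>k. norm (h k \<xi>))"
    by eventually_elim (auto intro: summable_suminf_not_top)
  have sumL1: "summable (\<lambda>k. LINT \<xi>|lborel. norm (h k \<xi>))"
    by (rule summable_comparison_test'[OF summable_mult[OF B, of ?C]]) (use wlq_le_L1(2)[OF h] in auto)
  show "wlq_le (\<lambda>\<xi>. \<Sum>k. h k \<xi>) (\<Sum>k. B k)"
  proof (rule wlq_le_Fatou)
    show "wlq_le (\<lambda>\<xi>. \<Sum>k<n. h k \<xi>) (\<Sum>k. B k)" for n
      by (rule wlq_le_mono[OF wlq_le_sum[OF h]]) (use B B0 in \<open>auto intro: sum_le_suminf\<close>)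
    show "AE \<xi> in lborel. (\<lambda>n. \<Sum>k<n. h k \<xi>) \<longlonglongrightarrow> (\<Sum>k. h k \<xi>)"
      using AE by eventually_elim (auto intro: summable_LIMSEQ summable_norm_cancel)
  qed measurable
  fix x :: 'a
  let ?e = "\<lambda>\<xi>::'a. exp (\<i> * complex_of_real (x \<bullet> \<xi>))"
  have "(\<lambda>k. LINT \<xi>|lborel. h k \<xi> * ?e \<xi>) sums (LINT \<xi>|lborel. (\<Sum>k. h k \<xi> * ?e \<xi>))"
  proof (rule sums_integral)
    show "integrable lborel (\<lambda>\<xi>. h k \<xi> * ?e \<xi>)" for k
      by (rule Bochner_Integration.integrable_bound[OF wlq_le_L1(1)[OF h[of k]]]) (auto simp: norm_mult)
    show "AE \<xi> in lborel. summable (\<lambda>k. norm (h k \<xi> * ?e \<xi>))" using AE by (simp add: norm_mult)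
    show "summable (\<lambda>k. LINT \<xi>|lborel. norm (h k \<xi> * ?e \<xi>))" using sumL1 by (simp add: norm_mult)
  qed
  also have "(LINT \<xi>|lborel. (\<Sum>k. h k \<xi> * ?e \<xi>)) = (LINT \<xi>|lborel. (\<Sum>k. h k \<xi>) * ?e \<xi>)"
  proof (intro integral_cong_AE)
    show "AE \<xi> in lborel. (\<Sum>k. h k \<xi> * ?e \<xi>) = (\<Sum>k. h k \<xi>) * ?e \<xi>"
      using AE by eventually_elim (auto intro!: suminf_mult2[symmetric] summable_norm_cancel)
  qed measurable
  finally show "(\<lambda>k. inv_fourier (h k) x) sums inv_fourier (\<lambda>\<xi>. \<Sum>k. h k \<xi>) x"
    unfolding inv_fourier_def by (rule sums_mult)
qed

text \<open>The factor 2 counts the two summands of the kernel estimate below, each of which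
  integrates to \<open>wconst\<close>; adding 1 makes positivity immediate.\<close>

definition conv_const :: real where
  "conv_const = c * (2 * wconst + 1) powr (1 / q')"

lemma conv_const_pos: "0 < conv_const"
  using c_pos wconst_nonneg by (simp add: conv_const_def add_nonneg_pos)

text \<open>The larger of w(\<xi> - \<eta>) and w(\<eta>) is at least w(\<xi>)/c, so the reciprocal
  of their product is at most c/w(\<xi>) times the reciprocal of the smaller one. The q'-th power of
  the latter is at most the sum of both reciprocals to the power q', and each of these integrates to
  \<open>wconst\<close>.\<close>

lemma nn_integral_inverse_weights:
  fixes \<xi> :: 'a
  shows "(\<integral>\<^sup>+\<eta>. ennreal ((1 / (w (\<xi> - \<eta>) * w \<eta>)) powr q') \<partial>lborel) \<le> ennreal ((conv_const / w \<xi>) powr q')"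
proof -
  have le: "(1 / (w (\<xi> - \<eta>) * w \<eta>)) powr q' \<le> (c / w \<xi>) powr q' * (w (\<xi> - \<eta>) powr (- q') + w \<eta> powr (- q'))" for \<eta>
  proof -
    let ?a = "w (\<xi> - \<eta>)" and ?b = "w \<eta>"
    have pos: "0 < ?a" "0 < ?b" "0 < w \<xi>" using weight_pos by auto
    have max: "w \<xi> \<le> c * max ?a ?b" using weight_add_le[of "\<xi> - \<eta>" \<eta>] by simp
    have "w \<xi> * min ?a ?b \<le> c * (max ?a ?b * min ?a ?b)"
      using mult_right_mono[OF max, of "min ?a ?b"] pos by (simp add: mult.assoc)
    also have "max ?a ?b * min ?a ?b = ?a * ?b" by (auto simp: max_def min_def)
    finally have "1 / (?a * ?b) \<le> c / w \<xi> * (1 / min ?a ?b)"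
      using pos by (simp add: field_simps min_def split: if_splits)
    then have "(1 / (?a * ?b)) powr q' \<le> (c / w \<xi> * (1 / min ?a ?b)) powr q'"
      using pos q'_gt_1 by (intro powr_mono2) auto
    also have "\<dots> = (c / w \<xi>) powr q' * min ?a ?b powr (- q')"
      using pos c_pos by (simp add: powr_mult powr_divide powr_minus_divide)
    also have "\<dots> \<le> (c / w \<xi>) powr q' * (?a powr (- q') + ?b powr (- q'))"
      by (intro mult_left_mono) (auto simp: min_def)
    finally show ?thesis .
  qed
  have "(\<integral>\<^sup>+\<eta>. ennreal ((1 / (w (\<xi> - \<eta>) * w \<eta>)) powr q') \<partial>lborel)
      \<le> (\<integral>\<^sup>+\<eta>. ennreal ((c / w \<xi>) powr q') * (ennreal (w (\<xi> - \<eta>) powr (- q')) + ennreal (w \<eta> powr (- q'))) \<partial>lborel)"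
    using le by (intro nn_integral_mono) (simp add: ennreal_mult[symmetric] ennreal_plus[symmetric] ennreal_leI del: ennreal_plus)
  also have "\<dots> = ennreal ((c / w \<xi>) powr q') * (ennreal wconst + ennreal wconst)"
    using nn_integral_reflect_translate[of "\<lambda>x. ennreal (w x powr (- q'))" \<xi>]
    by (simp add: nn_integral_cmult nn_integral_add nn_integral_weight)
  also have "\<dots> = ennreal ((c / w \<xi>) powr q' * (2 * wconst))"
    using wconst_nonneg by (simp add: ennreal_mult[symmetric] ennreal_plus[symmetric] del: ennreal_plus)
  also have "\<dots> \<le> ennreal ((conv_const / w \<xi>) powr q')"
  proof (rule ennreal_leI)
    have "(conv_const / w \<xi>) powr q' = (c / w \<xi>) powr q' * (2 * wconst + 1)"
      using wconst_nonneg c_pos weight_pos[of \<xi>] q'_gt_1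
      by (simp add: conv_const_def powr_mult powr_divide powr_powr)
    then show "(c / w \<xi>) powr q' * (2 * wconst) \<le> (conv_const / w \<xi>) powr q'"
      by (simp add: mult_left_mono)
  qed
  finally show ?thesis .
qed

text \<open>The algebra property. At fixed \<xi>, Hoelder separates the weighted functions from the
  kernel 1/(w(\<xi> - \<eta>) w(\<eta>)), whose L^q' norm is at most
  \<open>conv_const / w \<xi>\<close> and so cancels the outer weight. What remains is a convolution
  of q-th powers, whose integral factorises by Fubini.\<close>

lemma wlq_le_conv:
  assumes "wlq_le h A" "wlq_le k B"
  shows "wlq_le (conv h k) (conv_const * A * B)"
proof (rule hbI)
  note [measurable] = wlq_le_measurable[OF assms(1)] wlq_le_measurable[OF assms(2)]
  have A: "0 \<le> A" and B: "0 \<le> B" using assms wlq_le_nonneg by auto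
  then show "0 \<le> conv_const * A * B" using conv_const_pos by simp
  show "conv h k \<in> borel_measurable borel" by measurable
  define H where "H \<xi> = (w \<xi> * norm (h \<xi>)) powr q" for \<xi>
  define L where "L \<xi> = (w \<xi> * norm (k \<xi>)) powr q" for \<xi>
  have [measurable]: "H \<in> borel_measurable borel" "L \<in> borel_measurable borel"
    unfolding H_def[abs_def] L_def[abs_def] by measurable
  have HL: "0 \<le> H \<xi>" "0 \<le> L \<xi>" for \<xi> by (auto simp: H_def L_def)
  \<comment> \<open>Extended-valued, since a convolution of two integrable functions may be infinite
    at some points; there the pointwise bound is trivial.\<close>
  define \<Phi> where "\<Phi> \<xi> = (\<integral>\<^sup>+\<eta>. ennreal (H (\<xi> - \<eta>) * L \<eta>) \<partial>lborel)" for \<xi>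
  have pointwise: "ennreal ((w \<xi> * norm (conv h k \<xi>)) powr q) \<le> ennreal (conv_const powr q) * \<Phi> \<xi>" for \<xi>
  proof (cases "\<Phi> \<xi> = \<infinity>")
    case True
    then show ?thesis using conv_const_pos by (simp add: ennreal_mult_top)
  next
    case False
    then obtain \<phi> where \<phi>: "\<Phi> \<xi> = ennreal \<phi>" "0 \<le> \<phi>" by (cases "\<Phi> \<xi>") auto
    have "(\<integral>\<^sup>+\<eta>. ennreal ((w (\<xi> - \<eta>) * norm (h (\<xi> - \<eta>)) * (w \<eta> * norm (k \<eta>))) * (1 / (w (\<xi> - \<eta>) * w \<eta>))) \<partial>lborel)
      \<le> ennreal (\<phi> powr (1 / q) * (conv_const / w \<xi>))"
    proof (rule Holder_nn_integral[OF q_gt_1 q'_gt_1 conjugate_exponents])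
      show "(\<integral>\<^sup>+\<eta>. ennreal ((w (\<xi> - \<eta>) * norm (h (\<xi> - \<eta>)) * (w \<eta> * norm (k \<eta>))) powr q) \<partial>lborel)
        \<le> ennreal ((\<phi> powr (1 / q)) powr q)"
        using \<phi> q_gt_1 by (simp add: \<Phi>_def H_def L_def powr_mult powr_powr)
      show "(\<integral>\<^sup>+\<eta>. ennreal ((1 / (w (\<xi> - \<eta>) * w \<eta>)) powr q') \<partial>lborel) \<le> ennreal ((conv_const / w \<xi>) powr q')"
        by (rule nn_integral_inverse_weights)
    qed (use conv_const_pos in auto)
    moreover have "(w (\<xi> - \<eta>) * norm (h (\<xi> - \<eta>)) * (w \<eta> * norm (k \<eta>))) * (1 / (w (\<xi> - \<eta>) * w \<eta>))
        = norm (h (\<xi> - \<eta>)) * norm (k \<eta>)" for \<eta>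
      using weight_pos[of "\<xi> - \<eta>"] weight_pos[of \<eta>] by simp
    ultimately have "ennreal (norm (conv h k \<xi>)) \<le> ennreal (\<phi> powr (1 / q) * (conv_const / w \<xi>))"
      using norm_conv_le[of h k \<xi>] by (metis (no_types, lifting) nn_integral_cong order_trans)
    then have "norm (conv h k \<xi>) \<le> \<phi> powr (1 / q) * (conv_const / w \<xi>)"
      using conv_const_pos by simp
    then have "w \<xi> * norm (conv h k \<xi>) \<le> conv_const * \<phi> powr (1 / q)"
      using weight_pos[of \<xi>] by (simp add: field_simps)
    then have "(w \<xi> * norm (conv h k \<xi>)) powr q \<le> (conv_const * \<phi> powr (1 / q)) powr q"
      using q_gt_1 by (intro powr_mono2) auto
    also have "\<dots> = conv_const powr q * \<phi>"
      using \<phi> q_gt_1 conv_const_pos by (simp add: powr_mult powr_powr)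
    finally show ?thesis using \<phi> by (simp add: ennreal_mult[symmetric] ennreal_leI)
  qed
  have "(\<integral>\<^sup>+\<xi>. \<Phi> \<xi> \<partial>lborel) = (\<integral>\<^sup>+\<eta>. \<integral>\<^sup>+\<xi>. ennreal (H (\<xi> - \<eta>) * L \<eta>) \<partial>lborel \<partial>lborel)"
    unfolding \<Phi>_def by (rule lborel_pair.Fubini') measurable
  also have "\<dots> = (\<integral>\<^sup>+\<eta>. ennreal (L \<eta>) * (\<integral>\<^sup>+\<xi>. ennreal (H \<xi>) \<partial>lborel) \<partial>lborel)"
  proof (intro nn_integral_cong)
    fix \<eta>
    have "(\<integral>\<^sup>+\<xi>. ennreal (H (\<xi> - \<eta>) * L \<eta>) \<partial>lborel) = ennreal (L \<eta>) * (\<integral>\<^sup>+\<xi>. ennreal (H (\<xi> - \<eta>)) \<partial>lborel)"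
      using HL by (simp add: ennreal_mult nn_integral_multc mult.commute[of "ennreal (L \<eta>)"])
    then show "(\<integral>\<^sup>+\<xi>. ennreal (H (\<xi> - \<eta>) * L \<eta>) \<partial>lborel) = ennreal (L \<eta>) * (\<integral>\<^sup>+\<xi>. ennreal (H \<xi>) \<partial>lborel)"
      using nn_integral_translate[of "\<lambda>x. ennreal (H x)" \<eta>] by simp
  qed
  also have "\<dots> = (\<integral>\<^sup>+\<eta>. ennreal (L \<eta>) \<partial>lborel) * (\<integral>\<^sup>+\<xi>. ennreal (H \<xi>) \<partial>lborel)"
    by (simp add: nn_integral_multc)
  also have "\<dots> \<le> ennreal (B powr q) * ennreal (A powr q)"
    using wlq_le_le[OF assms(1)] wlq_le_le[OF assms(2)] by (intro mult_mono) (auto simp: H_def L_def)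
  finally have int\<Phi>: "(\<integral>\<^sup>+\<xi>. \<Phi> \<xi> \<partial>lborel) \<le> ennreal (B powr q) * ennreal (A powr q)" .
  have [measurable]: "\<Phi> \<in> borel_measurable borel"
  proof -
    have "\<Phi> \<in> borel_measurable lborel" unfolding \<Phi>_def[abs_def]
      by (rule lborel.borel_measurable_nn_integral) measurable
    then show ?thesis by simp
  qed
  have "(\<integral>\<^sup>+\<xi>. ennreal ((w \<xi> * norm (conv h k \<xi>)) powr q) \<partial>lborel)
      \<le> (\<integral>\<^sup>+\<xi>. ennreal (conv_const powr q) * \<Phi> \<xi> \<partial>lborel)"
    by (intro nn_integral_mono pointwise)
  also have "\<dots> \<le> ennreal (conv_const powr q) * (ennreal (B powr q) * ennreal (A powr q))"
    using int\<Phi> by (simp add: nn_integral_cmult mult_left_mono)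
  also have "\<dots> = ennreal ((conv_const * A * B) powr q)"
    using A B conv_const_pos by (simp add: ennreal_mult[symmetric] powr_mult mult_ac)
  finally show "(\<integral>\<^sup>+\<xi>. ennreal ((w \<xi> * norm (conv h k \<xi>)) powr q) \<partial>lborel) \<le> ennreal ((conv_const * A * B) powr q)" .
qed

definition fconst :: real where "fconst = (2 * pi) powr (- real DIM('a))"

lemma fconst_pos: "0 < fconst"
  by (simp add: fconst_def)

text \<open>The first summand is the constant of the product estimate, the second that of the
  supremum bound through L^1; the sum dominates both.\<close>

definition \<kappa> :: real where "\<kappa> = fconst * conv_const + fconst * wconst powr (1 / q')"

lemma \<kappa>_pos: "0 < \<kappa>"
  using fconst_pos conv_const_pos unfolding \<kappa>_def by (intro add_pos_nonneg mult_nonneg_nonneg) auto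

text \<open>The norm is rescaled by \<open>\<kappa>\<close> so that it becomes submultiplicative and dominates the supremum norm.\<close>
definition fl_le :: "('a \<Rightarrow> complex) \<Rightarrow> real \<Rightarrow> bool" where
  "fl_le f B \<longleftrightarrow> (\<exists>h. wlq_le h (B / \<kappa>) \<and> f = inv_fourier h)"

lemma fl_le_nonneg: "fl_le f B \<Longrightarrow> 0 \<le> B"
  unfolding fl_le_def using wlq_le_nonneg \<kappa>_pos by (force simp: zero_le_divide_iff)

lemma fl_le_bound:
  assumes "fl_le f B"
  shows "norm (f x) \<le> B"
proof -
  obtain h where h: "wlq_le h (B / \<kappa>)" "f = inv_fourier h" using assms by (auto simp: fl_le_def)
  have B: "0 \<le> B" using fl_le_nonneg[OF assms] .
  have "norm (f x) \<le> fconst * (LINT \<xi>|lborel. norm (h \<xi>))"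
    unfolding h(2) fconst_def by (rule norm_inv_fourier_le)
  also have "\<dots> \<le> fconst * (wconst powr (1 / q') * (B / \<kappa>))"
    using wlq_le_L1(2)[OF h(1)] fconst_pos by (intro mult_left_mono) auto
  also have "\<dots> = fconst * wconst powr (1 / q') * B / \<kappa>" by simp
  also have "\<dots> \<le> \<kappa> * B / \<kappa>"
    using \<kappa>_pos B fconst_pos conv_const_pos by (intro divide_right_mono mult_right_mono) (auto simp: \<kappa>_def)
  also have "\<dots> = B" using \<kappa>_pos by simp
  finally show ?thesis .
qed

lemma fl_le_add:
  assumes "fl_le f A" "fl_le g B"
  shows "fl_le (\<lambda>x. f x + g x) (A + B)"
proof -
  obtain h k where h: "wlq_le h (A / \<kappa>)" "f = inv_fourier h" and k: "wlq_le k (B / \<kappa>)" "g = inv_fourier k"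
    using assms by (auto simp: fl_le_def)
  have "wlq_le (\<lambda>\<xi>. h \<xi> + k \<xi>) ((A + B) / \<kappa>)"
    using wlq_le_add[OF h(1) k(1)] by (simp add: add_divide_distrib)
  moreover have "(\<lambda>x. f x + g x) = inv_fourier (\<lambda>\<xi>. h \<xi> + k \<xi>)"
    using inv_fourier_add[OF wlq_le_L1(1)[OF h(1)] wlq_le_L1(1)[OF k(1)]] h k by auto
  ultimately show ?thesis unfolding fl_le_def by blast
qed

lemma fl_le_cmult:
  assumes "fl_le f A"
  shows "fl_le (\<lambda>x. a * f x) (norm a * A)"
proof -
  obtain h where h: "wlq_le h (A / \<kappa>)" "f = inv_fourier h" using assms by (auto simp: fl_le_def)
  have "wlq_le (\<lambda>\<xi>. a * h \<xi>) (norm a * A / \<kappa>)" using wlq_le_cmult[OF h(1)] by simp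
  moreover have "(\<lambda>x. a * f x) = inv_fourier (\<lambda>\<xi>. a * h \<xi>)"
    by (simp add: h(2) inv_fourier_cmult fun_eq_iff)
  ultimately show ?thesis unfolding fl_le_def by blast
qed

lemma fl_le_mult:
  assumes "fl_le f A" "fl_le g B"
  shows "fl_le (\<lambda>x. f x * g x) (A * B)"
proof -
  obtain h k where h: "wlq_le h (A / \<kappa>)" "f = inv_fourier h" and k: "wlq_le k (B / \<kappa>)" "g = inv_fourier k"
    using assms by (auto simp: fl_le_def)
  have AB: "0 \<le> A" "0 \<le> B" using assms fl_le_nonneg by auto
  have "wlq_le (\<lambda>\<xi>. complex_of_real fconst * conv h k \<xi>) (norm (complex_of_real fconst) * (conv_const * (A / \<kappa>) * (B / \<kappa>)))"
    by (intro wlq_le_cmult wlq_le_conv h k)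
  moreover have "norm (complex_of_real fconst) * (conv_const * (A / \<kappa>) * (B / \<kappa>)) \<le> A * B / \<kappa>"
  proof -
    have "fconst * conv_const \<le> \<kappa>" using fconst_pos by (simp add: \<kappa>_def)
    then have "fconst * conv_const * (A * B) / (\<kappa> * \<kappa>) \<le> \<kappa> * (A * B) / (\<kappa> * \<kappa>)"
      using AB \<kappa>_pos by (intro divide_right_mono mult_right_mono) auto
    then show ?thesis using \<kappa>_pos fconst_pos by (simp add: mult_ac)
  qed
  ultimately have "wlq_le (\<lambda>\<xi>. complex_of_real fconst * conv h k \<xi>) (A * B / \<kappa>)" using wlq_le_mono by blast
  moreover have "(\<lambda>x. f x * g x) = inv_fourier (\<lambda>\<xi>. complex_of_real fconst * conv h k \<xi>)"
    using inv_fourier_mult[OF wlq_le_measurable[OF h(1)] wlq_le_measurable[OF k(1)] wlq_le_L1(1)[OF h(1)] wlq_le_L1(1)[OF k(1)]] h k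
    by (auto simp: fconst_def)
  ultimately show ?thesis unfolding fl_le_def by blast
qed

lemma fl_le_sums:
  assumes f: "\<And>k. fl_le (f k) (B k)" and B: "summable B" and g: "\<And>x. (\<lambda>k. f k x) sums g x"
  shows "fl_le g (\<Sum>k. B k)"
proof -
  have "\<forall>k. \<exists>h. wlq_le h (B k / \<kappa>) \<and> f k = inv_fourier h" using f by (auto simp: fl_le_def)
  then obtain h where h: "\<And>k. wlq_le (h k) (B k / \<kappa>)" "\<And>k. f k = inv_fourier (h k)" by metis
  have sum: "summable (\<lambda>k. B k / \<kappa>)" using B by (rule summable_divide)
  have "wlq_le (\<lambda>\<xi>. \<Sum>k. h k \<xi>) ((\<Sum>k. B k) / \<kappa>)"
    using wlq_le_suminf(1)[OF h(1) sum] suminf_divide[OF B] by simp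
  moreover have "g x = inv_fourier (\<lambda>\<xi>. \<Sum>k. h k \<xi>) x" for x
    using wlq_le_suminf(2)[OF h(1) sum, of x] g[of x] h(2) sums_unique2 by simp
  then have "g = inv_fourier (\<lambda>\<xi>. \<Sum>k. h k \<xi>)" by blast
  ultimately show ?thesis unfolding fl_le_def by blast
qed

text \<open>Nonzero constants do not vanish at infinity and so lie outside the algebra, yet
  polynomials in \<open>f\<close> have constant terms. Adding the modulus of the constant to the
  norm of the rest keeps the bound submultiplicative.\<close>

definition ufl_le :: "('a \<Rightarrow> complex) \<Rightarrow> real \<Rightarrow> bool" where
  "ufl_le f B \<longleftrightarrow> (\<exists>a g A. fl_le g A \<and> f = (\<lambda>x. a + g x) \<and> norm a + A \<le> B)"

lemma ufl_le_mono: "ufl_le f B \<Longrightarrow> B \<le> B' \<Longrightarrow> ufl_le f B'"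
  unfolding ufl_le_def using order_trans by blast

lemma fl_le_0: "fl_le (\<lambda>x. 0) 0"
  unfolding fl_le_def by (rule exI[of _ "\<lambda>_. 0"]) (use wlq_le_0 in \<open>auto simp: inv_fourier_def\<close>)

lemma ufl_le_fl_le: "fl_le f B \<Longrightarrow> ufl_le f B"
  unfolding ufl_le_def by (intro exI[of _ 0] exI[of _ f] exI[of _ B]) auto

lemma ufl_le_const: "ufl_le (\<lambda>x. a) (norm a)"
  unfolding ufl_le_def by (intro exI[of _ a] exI[of _ "\<lambda>x. 0"] exI[of _ 0]) (auto simp: fl_le_0)

lemma ufl_le_add:
  assumes "ufl_le f A" "ufl_le g B"
  shows "ufl_le (\<lambda>x. f x + g x) (A + B)"
proof -
  obtain a f0 A0 where f: "fl_le f0 A0" "f = (\<lambda>x. a + f0 x)" "norm a + A0 \<le> A" using assms by (auto simp: ufl_le_def)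
  obtain b g0 B0 where g: "fl_le g0 B0" "g = (\<lambda>x. b + g0 x)" "norm b + B0 \<le> B" using assms by (auto simp: ufl_le_def)
  show ?thesis unfolding ufl_le_def
    by (intro exI[of _ "a + b"] exI[of _ "\<lambda>x. f0 x + g0 x"] exI[of _ "A0 + B0"] conjI fl_le_add f g)
       (use f g norm_triangle_ineq[of a b] in auto)
qed

lemma ufl_le_mult:
  assumes "ufl_le f A" "ufl_le g B"
  shows "ufl_le (\<lambda>x. f x * g x) (A * B)"
proof -
  obtain a f0 A0 where f: "fl_le f0 A0" "f = (\<lambda>x. a + f0 x)" "norm a + A0 \<le> A" using assms by (auto simp: ufl_le_def)
  obtain b g0 B0 where g: "fl_le g0 B0" "g = (\<lambda>x. b + g0 x)" "norm b + B0 \<le> B" using assms by (auto simp: ufl_le_def)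
  have "fl_le (\<lambda>x. (a * g0 x + b * f0 x) + f0 x * g0 x) (norm a * B0 + norm b * A0 + A0 * B0)"
    by (intro fl_le_add fl_le_cmult fl_le_mult f g)
  moreover have "(\<lambda>x. f x * g x) = (\<lambda>x. a * b + ((a * g0 x + b * f0 x) + f0 x * g0 x))"
    using f g by (simp add: algebra_simps)
  moreover have "norm (a * b) + (norm a * B0 + norm b * A0 + A0 * B0) \<le> A * B"
  proof -
    have "(norm a + A0) * (norm b + B0) \<le> A * B"
      using f g fl_le_nonneg[OF f(1)] fl_le_nonneg[OF g(1)] order_trans[OF _ f(3)] by (intro mult_mono) auto
    then show ?thesis by (simp add: norm_mult algebra_simps)
  qed
  ultimately show ?thesis unfolding ufl_le_def by blast
qed

lemma ufl_le_power:
  assumes "ufl_le f A"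
  shows "ufl_le (\<lambda>x. f x ^ n) (A ^ n)"
  by (induction n) (use ufl_le_const[of 1] ufl_le_mult[OF assms] in auto)

text \<open>The constants and the bounds of the remaining parts are each dominated by
  \<open>B\<close>, so the two series are summed separately.\<close>

lemma ufl_le_sums:
  assumes f: "\<And>k. ufl_le (f k) (B k)" and B: "summable B" and g: "\<And>x. (\<lambda>k. f k x) sums g x"
  shows "ufl_le g (\<Sum>k. B k)"
proof -
  have "\<forall>k. \<exists>a h A. fl_le h A \<and> f k = (\<lambda>x. a + h x) \<and> norm a + A \<le> B k" using f by (auto simp: ufl_le_def)
  then obtain a h A where h: "\<And>k. fl_le (h k) (A k)" "\<And>k. f k = (\<lambda>x. a k + h k x)" "\<And>k. norm (a k) + A k \<le> B k"
    by metis
  have A0: "0 \<le> A k" for k using fl_le_nonneg[OF h(1)] .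
  have "A k \<le> B k" for k using h(3)[of k] norm_ge_zero[of "a k"] by linarith
  then have sA: "summable A"
    by (intro summable_comparison_test'[OF B]) (use A0 in auto)
  have "norm (a k) \<le> B k" for k using h(3)[of k] A0[of k] by linarith
  then have sa: "summable (\<lambda>k. norm (a k))"
    by (intro summable_comparison_test'[OF B]) auto
  have "(\<lambda>k. h k x) sums (g x - (\<Sum>k. a k))" for x
    using sums_diff[OF g[of x] summable_sums[OF summable_norm_cancel[OF sa]]] by (simp add: h(2))
  then have "fl_le (\<lambda>x. g x - (\<Sum>k. a k)) (\<Sum>k. A k)" by (rule fl_le_sums[OF h(1) sA])
  moreover have "norm (\<Sum>k. a k) + (\<Sum>k. A k) \<le> (\<Sum>k. B k)"
  proof -
    have "norm (\<Sum>k. a k) + (\<Sum>k. A k) \<le> (\<Sum>k. norm (a k)) + (\<Sum>k. A k)"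
      using summable_norm[OF sa] by simp
    also have "\<dots> = (\<Sum>k. norm (a k) + A k)" by (rule suminf_add[OF sa sA])
    also have "\<dots> \<le> (\<Sum>k. B k)" by (rule suminf_le[OF h(3) summable_add[OF sa sA] B])
    finally show ?thesis .
  qed
  ultimately show ?thesis unfolding ufl_le_def
    by (intro exI[of _ "\<Sum>k. a k"] exI[of _ "\<lambda>x. g x - (\<Sum>k. a k)"] exI[of _ "\<Sum>k. A k"]) auto
qed

end

section \<open>Gaussian summation\<close>

lemma gaussian_fourier_real:
  "(LINT x|lborel. exp (\<i> * complex_of_real (x * t)) * complex_of_real (exp (- x\<^sup>2 / 2)))
    = complex_of_real (sqrt (2 * pi) * exp (- t\<^sup>2 / 2))"
  and integrable_gaussian_fourier_real:
  "integrable lborel (\<lambda>x::real. exp (\<i> * complex_of_real (x * t)) * complex_of_real (exp (- x\<^sup>2 / 2)))"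
proof -
  have "char std_normal_distribution t = (LINT x|lborel. std_normal_density x *\<^sub>R exp (\<i> * complex_of_real (t * x)))"
    unfolding char_def by (subst integral_density) (auto intro: normal_density_nonneg)
  also have "\<dots> = (LINT x|lborel. complex_of_real (1 / sqrt (2 * pi)) * (exp (\<i> * complex_of_real (x * t)) * complex_of_real (exp (- x\<^sup>2 / 2))))"
    by (intro Bochner_Integration.integral_cong refl)
       (simp add: std_normal_density_def scaleR_conv_of_real mult_ac)
  also have "\<dots> = complex_of_real (1 / sqrt (2 * pi)) * (LINT x|lborel. exp (\<i> * complex_of_real (x * t)) * complex_of_real (exp (- x\<^sup>2 / 2)))"
    by simp
  finally have "complex_of_real (exp (- t\<^sup>2 / 2)) = complex_of_real (1 / sqrt (2 * pi)) * (LINT x|lborel. exp (\<i> * complex_of_real (x * t)) * complex_of_real (exp (- x\<^sup>2 / 2)))"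
    by (simp add: char_std_normal_distribution)
  then show eq: "(LINT x|lborel. exp (\<i> * complex_of_real (x * t)) * complex_of_real (exp (- x\<^sup>2 / 2)))
    = complex_of_real (sqrt (2 * pi) * exp (- t\<^sup>2 / 2))"
    by (simp add: field_simps)
  \<comment> \<open>A Bochner integral that does not exist has the value 0. The value just computed
    is not 0, hence the integrand is integrable. The same device gives the integrability of
    \<open>gauss\<close> and of its dilates.\<close>
  show "integrable lborel (\<lambda>x::real. exp (\<i> * complex_of_real (x * t)) * complex_of_real (exp (- x\<^sup>2 / 2)))"
  proof (rule ccontr)
    assume "\<not> ?thesis"
    then have "complex_of_real (sqrt (2 * pi) * exp (- t\<^sup>2 / 2)) = 0"
      unfolding eq[symmetric] by (rule not_integrable_integral_eq)
    then show False by simp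
  qed
qed

definition gauss :: "'a::euclidean_space \<Rightarrow> real" where
  "gauss x = exp (- (norm x)\<^sup>2 / 2)"

lemma gauss_pos: "0 < gauss x" and gauss_le_1: "gauss x \<le> 1"
  by (auto simp: gauss_def)

lemma gauss_nonneg [simp]: "0 \<le> gauss x" and abs_gauss [simp]: "\<bar>gauss x\<bar> = gauss x"
  by (auto simp: gauss_def)

lemma gauss_measurable [measurable]: "gauss \<in> borel_measurable borel"
  unfolding gauss_def[abs_def] by measurable

lemma continuous_gauss: "continuous_on A gauss"
  unfolding gauss_def[abs_def] by (intro continuous_intros) auto

text \<open>This is (2 pi)^(n/2), the integral of \<open>gauss\<close>. Its square is (2 pi)^n,
  which matches the normalising factor of \<open>inv_fourier\<close>. The dimension sits in the
  type, hence the \<open>itself\<close> argument.\<close>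

definition gconst :: "'a::euclidean_space itself \<Rightarrow> real" where
  "gconst _ = sqrt (2 * pi) ^ DIM('a)"

lemma gconst_pos: "0 < gconst TYPE('a::euclidean_space)"
  by (simp add: gconst_def)

text \<open>Both the exponential and the Gaussian factorise over the coordinates, and each
  coordinate integral is the characteristic function of the standard normal distribution up to the
  factor sqrt (2 pi).\<close>

lemma gauss_fourier:
  fixes \<xi> :: "'a::euclidean_space"
  shows "(LINT x|lborel. exp (\<i> * complex_of_real (x \<bullet> \<xi>)) * complex_of_real (gauss x))
    = complex_of_real (gconst TYPE('a) * gauss \<xi>)"
proof -
  interpret product_sigma_finite "\<lambda>_::'a. lborel :: real measure" ..
  let ?T = "\<lambda>f::'a \<Rightarrow> real. \<Sum>b\<in>Basis. f b *\<^sub>R b"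
  have "(LINT x|lborel. exp (\<i> * complex_of_real (x \<bullet> \<xi>)) * complex_of_real (gauss x))
    = (LINT x|distr (\<Pi>\<^sub>M b\<in>Basis. (lborel :: real measure)) borel ?T. exp (\<i> * complex_of_real (x \<bullet> \<xi>)) * complex_of_real (gauss x))"
    by (subst lborel_eq) simp
  also have "\<dots> = (LINT f|(\<Pi>\<^sub>M b\<in>Basis. (lborel :: real measure)). exp (\<i> * complex_of_real (?T f \<bullet> \<xi>)) * complex_of_real (gauss (?T f)))"
    by (intro integral_distr) auto
  also have "\<dots> = (LINT f|(\<Pi>\<^sub>M b\<in>Basis. (lborel :: real measure)). (\<Prod>b\<in>Basis. exp (\<i> * complex_of_real (f b * (\<xi> \<bullet> b))) * complex_of_real (exp (- (f b)\<^sup>2 / 2))))"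
  proof (intro Bochner_Integration.integral_cong refl)
    fix f :: "'a \<Rightarrow> real"
    have 1: "?T f \<bullet> \<xi> = (\<Sum>b\<in>Basis. f b * (\<xi> \<bullet> b))"
      unfolding inner_sum_left inner_scaleR_left by (simp add: inner_commute)
    have 2: "(norm (?T f))\<^sup>2 = (\<Sum>b\<in>Basis. (f b)\<^sup>2)"
      by (simp only: power2_norm_eq_inner) (subst euclidean_inner, simp add: power2_eq_square)
    have "exp (\<i> * complex_of_real (?T f \<bullet> \<xi>)) = (\<Prod>b\<in>Basis. exp (\<i> * complex_of_real (f b * (\<xi> \<bullet> b))))"
      unfolding 1 by (simp only: of_real_sum sum_distrib_left exp_sum[OF finite_Basis])
    moreover have "gauss (?T f) = (\<Prod>b\<in>Basis. exp (- (f b)\<^sup>2 / 2))"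
      unfolding gauss_def 2 by (simp only: sum_negf[symmetric] sum_divide_distrib exp_sum[OF finite_Basis])
    ultimately show "exp (\<i> * complex_of_real (?T f \<bullet> \<xi>)) * complex_of_real (gauss (?T f)) =
       (\<Prod>b\<in>Basis. exp (\<i> * complex_of_real (f b * (\<xi> \<bullet> b))) * complex_of_real (exp (- (f b)\<^sup>2 / 2)))"
      by (simp only: prod.distrib of_real_prod)
  qed
  also have "\<dots> = (\<Prod>b\<in>Basis. LINT x|lborel. exp (\<i> * complex_of_real (x * (\<xi> \<bullet> b))) * complex_of_real (exp (- x\<^sup>2 / 2)))"
    by (intro product_integral_prod integrable_gaussian_fourier_real finite_Basis)
  also have "\<dots> = (\<Prod>b\<in>Basis. complex_of_real (sqrt (2 * pi) * exp (- (\<xi> \<bullet> b)\<^sup>2 / 2)))"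
    by (simp only: gaussian_fourier_real)
  also have "\<dots> = complex_of_real (gconst TYPE('a) * gauss \<xi>)"
  proof -
    have "(norm \<xi>)\<^sup>2 = (\<Sum>b\<in>Basis. (\<xi> \<bullet> b)\<^sup>2)"
      by (simp only: power2_norm_eq_inner) (subst euclidean_inner, simp add: power2_eq_square)
    then have "gauss \<xi> = (\<Prod>b\<in>Basis. exp (- (\<xi> \<bullet> b)\<^sup>2 / 2))"
      unfolding gauss_def by (simp only: sum_negf[symmetric] sum_divide_distrib exp_sum[OF finite_Basis])
    then show ?thesis by (simp add: gconst_def prod.distrib)
  qed
  finally show ?thesis .
qed

lemma integrable_gauss: "integrable lborel (gauss :: 'a::euclidean_space \<Rightarrow> real)"
  and integral_gauss: "(LINT x|lborel. gauss (x::'a)) = gconst TYPE('a)"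
proof -
  have eq: "(LINT x|lborel. complex_of_real (gauss (x::'a))) = complex_of_real (gconst TYPE('a))"
    using gauss_fourier[of "0::'a"] by (simp add: gauss_def)
  have "integrable lborel (\<lambda>x::'a. complex_of_real (gauss x))"
    using eq gconst_pos[where 'a='a] not_integrable_integral_eq by fastforce
  then show int: "integrable lborel (gauss :: 'a \<Rightarrow> real)"
    by (simp add: complex_of_real_integrable_eq)
  show "(LINT x|lborel. gauss (x::'a)) = gconst TYPE('a)"
    using eq by simp
qed

lemma integrable_gauss_scale:
  assumes e: "0 < e"
  shows "integrable lborel (\<lambda>x::'a::euclidean_space. gauss (e *\<^sub>R x))"
proof -
  have "complex_of_real (gconst TYPE('a)) = complex_of_real (\<bar>e\<bar> ^ DIM('a)) * (LINT x|lborel. complex_of_real (gauss (0 + e *\<^sub>R x :: 'a)))"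
    using lborel_integral_affine[of e "\<lambda>x. complex_of_real (gauss x)" "0::'a"] e
    by (simp add: integral_gauss)
  then have "(LINT x|lborel. complex_of_real (gauss (e *\<^sub>R x :: 'a))) \<noteq> 0"
    using gconst_pos[where 'a='a] by auto
  then have "integrable lborel (\<lambda>x. complex_of_real (gauss (e *\<^sub>R x :: 'a)))"
    using not_integrable_integral_eq by blast
  then show ?thesis by (simp add: complex_of_real_integrable_eq)
qed

text \<open>Gaussian summation of the inversion integral: the left-hand side regularises
  \<open>\<integral> inv_fourier u x * exp (- \<i> x\<cdot>\<xi>) dx\<close>, the right-hand side is an average of \<open>u\<close> near \<open>\<xi>\<close>.\<close>
lemma gauss_summation:
  fixes u :: "'a::euclidean_space \<Rightarrow> complex"
  assumes u: "integrable lborel u" and e: "0 < e"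
  shows "(LINT x|lborel. inv_fourier u x * exp (- (\<i> * complex_of_real (x \<bullet> \<xi>))) * complex_of_real (gauss (e *\<^sub>R x)))
    = complex_of_real (1 / gconst TYPE('a)) * (LINT y|lborel. u (\<xi> + e *\<^sub>R y) * complex_of_real (gauss y))"
proof -
  let ?n = "DIM('a)"
  let ?c = "complex_of_real ((2 * pi) powr (- real ?n))"
  have [measurable]: "u \<in> borel_measurable borel" using borel_measurable_integrable[OF u] by simp
  define F where "F x \<eta> = u \<eta> * (exp (\<i> * complex_of_real (x \<bullet> (\<eta> - \<xi>))) * complex_of_real (gauss (e *\<^sub>R x)))" for x \<eta>
  have [measurable]: "case_prod F \<in> borel_measurable (lborel \<Otimes>\<^sub>M lborel)"
    unfolding F_def[abs_def] by measurable
  have ige: "integrable lborel (\<lambda>x::'a. gauss (e *\<^sub>R x))"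
    by (rule integrable_gauss_scale[OF e])
  have "(\<integral>\<^sup>+p. norm (case_prod F p) \<partial>(lborel \<Otimes>\<^sub>M lborel)) = (\<integral>\<^sup>+x. (\<integral>\<^sup>+\<eta>. norm (F x \<eta>) \<partial>lborel) \<partial>lborel)"
    by (subst lborel.nn_integral_fst[symmetric]) (auto simp: split_beta')
  also have "\<dots> = (\<integral>\<^sup>+x. (\<integral>\<^sup>+\<eta>. ennreal (norm (u \<eta>)) * ennreal (gauss (e *\<^sub>R x :: 'a)) \<partial>lborel) \<partial>lborel)"
    by (simp add: F_def norm_mult ennreal_mult less_imp_le[OF gauss_pos])
  also have "\<dots> = (\<integral>\<^sup>+\<eta>. ennreal (norm (u \<eta>)) \<partial>lborel) * (\<integral>\<^sup>+x. ennreal (gauss (e *\<^sub>R x)) \<partial>(lborel :: 'a measure))"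
    by (simp add: nn_integral_multc nn_integral_cmult)
  also have "\<dots> < \<infinity>"
    using u ige by (auto simp: integrable_iff_bounded ennreal_mult_less_top less_imp_le[OF gauss_pos])
  finally have int: "integrable (lborel \<Otimes>\<^sub>M lborel) (case_prod F)"
    by (intro integrableI_bounded) auto
  have I: "(LINT x|lborel. exp (\<i> * complex_of_real (x \<bullet> \<zeta>)) * complex_of_real (gauss (e *\<^sub>R x)))
     = complex_of_real ((1 / e) ^ ?n * gconst TYPE('a) * gauss ((1 / e) *\<^sub>R \<zeta>))" for \<zeta> :: 'a
  proof -
    have "(LINT x|lborel. exp (\<i> * complex_of_real (x \<bullet> \<zeta>)) * complex_of_real (gauss (e *\<^sub>R x)))
      = complex_of_real (\<bar>1 / e\<bar> ^ ?n) * (LINT x|lborel. exp (\<i> * complex_of_real ((0 + (1 / e) *\<^sub>R x) \<bullet> \<zeta>)) * complex_of_real (gauss (e *\<^sub>R (0 + (1 / e) *\<^sub>R x))))"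
      using e by (intro lborel_integral_affine) auto
    also have "\<dots> = complex_of_real ((1 / e) ^ ?n) * (LINT x|lborel. exp (\<i> * complex_of_real (x \<bullet> ((1 / e) *\<^sub>R \<zeta>))) * complex_of_real (gauss x))"
      using e by simp
    also have "\<dots> = complex_of_real ((1 / e) ^ ?n * gconst TYPE('a) * gauss ((1 / e) *\<^sub>R \<zeta>))"
      unfolding gauss_fourier by simp
    finally show ?thesis .
  qed
  have "inv_fourier u x * exp (- (\<i> * complex_of_real (x \<bullet> \<xi>))) * complex_of_real (gauss (e *\<^sub>R x)) = ?c * (LINT \<eta>|lborel. F x \<eta>)" for x
  proof -
    have "F x \<eta> = u \<eta> * exp (\<i> * complex_of_real (x \<bullet> \<eta>)) * (exp (- (\<i> * complex_of_real (x \<bullet> \<xi>))) * complex_of_real (gauss (e *\<^sub>R x)))" for \<eta>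
      by (simp add: F_def inner_diff_right exp_diff exp_minus field_simps right_diff_distrib)
    then have "(LINT \<eta>|lborel. F x \<eta>) = (LINT \<eta>|lborel. u \<eta> * exp (\<i> * complex_of_real (x \<bullet> \<eta>))) * (exp (- (\<i> * complex_of_real (x \<bullet> \<xi>))) * complex_of_real (gauss (e *\<^sub>R x)))"
      by (simp only: integral_mult_left_zero)
    then show ?thesis by (simp only: inv_fourier_def mult.assoc)
  qed
  then have "(LINT x|lborel. inv_fourier u x * exp (- (\<i> * complex_of_real (x \<bullet> \<xi>))) * complex_of_real (gauss (e *\<^sub>R x)))
    = ?c * (LINT x|lborel. LINT \<eta>|lborel. F x \<eta>)" by simp
  also have "(LINT x|lborel. LINT \<eta>|lborel. F x \<eta>) = (LINT \<eta>|lborel. LINT x|lborel. F x \<eta>)"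
    using lborel_pair.Fubini_integral[OF int] ..
  also have "\<dots> = complex_of_real ((1 / e) ^ ?n * gconst TYPE('a)) * (LINT \<eta>|lborel. u \<eta> * complex_of_real (gauss ((1 / e) *\<^sub>R (\<eta> - \<xi>))))"
  proof -
    have "(LINT x|lborel. F x \<eta>) = complex_of_real ((1 / e) ^ ?n * gconst TYPE('a)) * (u \<eta> * complex_of_real (gauss ((1 / e) *\<^sub>R (\<eta> - \<xi>))))" for \<eta>
      unfolding F_def integral_mult_right_zero I by (simp only: of_real_mult mult_ac)
    then show ?thesis by (simp only: integral_mult_right_zero)
  qed
  also have "(LINT \<eta>|lborel. u \<eta> * complex_of_real (gauss ((1 / e) *\<^sub>R (\<eta> - \<xi>))))
     = complex_of_real (\<bar>e\<bar> ^ ?n) * (LINT y|lborel. u (\<xi> + e *\<^sub>R y) * complex_of_real (gauss ((1 / e) *\<^sub>R ((\<xi> + e *\<^sub>R y) - \<xi>))))"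
    using e by (intro lborel_integral_affine) auto
  also have "\<dots> = complex_of_real (e ^ ?n) * (LINT y|lborel. u (\<xi> + e *\<^sub>R y) * complex_of_real (gauss y))"
    using e by simp
  also have "?c * (complex_of_real ((1 / e) ^ ?n * gconst TYPE('a)) * (complex_of_real (e ^ ?n) * (LINT y|lborel. u (\<xi> + e *\<^sub>R y) * complex_of_real (gauss y))))
     = complex_of_real (1 / gconst TYPE('a)) * (LINT y|lborel. u (\<xi> + e *\<^sub>R y) * complex_of_real (gauss y))"
  proof -
    have "(2 * pi) powr (- real ?n) * ((1 / e) ^ ?n * gconst TYPE('a) * e ^ ?n) = 1 / gconst TYPE('a)"
    proof -
      have "(1 / e) ^ ?n * e ^ ?n = 1" using e by (simp add: power_divide)
      moreover have "(2 * pi) powr (- real ?n) = 1 / (gconst TYPE('a) * gconst TYPE('a))"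
      proof -
        have "gconst TYPE('a) * gconst TYPE('a) = (2 * pi) ^ ?n"
          unfolding gconst_def power_mult_distrib[symmetric] by simp
        then show ?thesis by (simp add: powr_minus_divide powr_realpow)
      qed
      moreover have "(2 * pi) powr (- real ?n) * ((1 / e) ^ ?n * gconst TYPE('a) * e ^ ?n) = (2 * pi) powr (- real ?n) * gconst TYPE('a) * ((1 / e) ^ ?n * e ^ ?n)"
        by (simp only: mult_ac)
      ultimately show ?thesis using gconst_pos[where 'a='a] by simp
    qed
    then have "?c * (complex_of_real ((1 / e) ^ ?n * gconst TYPE('a)) * complex_of_real (e ^ ?n)) = complex_of_real (1 / gconst TYPE('a))"
      by (metis of_real_mult)
    then show ?thesis by (simp only: mult.assoc[symmetric])
  qed
  finally show ?thesis .
qed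

text \<open>A weak form of Fourier inversion. Since \<open>gauss\<close> is at most 1, the
  regularised integrals of \<open>gauss_summation\<close> are bounded by the L^1 norm of
  \<open>inv_fourier u\<close>; as the scale tends to 0 the averages on the other side converge to
  u(\<xi>), by continuity and boundedness of u. The constant is 1 because the forward transform
  carries no normalising factor.\<close>

lemma inversion_sup_bound:
  fixes u :: "'a::euclidean_space \<Rightarrow> complex"
  assumes u: "integrable lborel u" and cont: "continuous_on UNIV u" and bd: "\<And>\<xi>. norm (u \<xi>) \<le> M"
    and v: "integrable lborel (inv_fourier u)"
  shows "norm (u \<xi>) \<le> (LINT x|lborel. norm (inv_fourier u x))"
proof -
  let ?L = "LINT x|lborel. norm (inv_fourier u x)"
  let ?g = "gconst TYPE('a)"
  have [measurable]: "u \<in> borel_measurable borel" using borel_measurable_integrable[OF u] by simp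
  have [measurable]: "inv_fourier u \<in> borel_measurable borel" using borel_measurable_integrable[OF v] by simp
  define e where "e k = 1 / real (Suc k)" for k
  have e: "0 < e k" for k by (simp add: e_def)
  have e0: "e \<longlonglongrightarrow> 0" unfolding e_def using LIMSEQ_Suc[OF lim_1_over_n[where 'a=real]] by simp
  have le: "norm (LINT y|lborel. u (\<xi> + e k *\<^sub>R y) * complex_of_real (gauss y)) \<le> ?g * ?L" for k
  proof -
    let ?f = "\<lambda>x. inv_fourier u x * exp (- (\<i> * complex_of_real (x \<bullet> \<xi>))) * complex_of_real (gauss (e k *\<^sub>R x))"
    have fle: "norm (?f x) \<le> norm (inv_fourier u x)" for x
      using gauss_le_1[of "e k *\<^sub>R x"] gauss_pos[of "e k *\<^sub>R x"] by (simp add: norm_mult mult_left_le)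
    have "norm (LINT x|lborel. ?f x) \<le> (LINT x|lborel. norm (?f x))" by (rule integral_norm_bound)
    also have "\<dots> \<le> ?L"
      using v fle by (intro integral_mono integrable_norm Bochner_Integration.integrable_bound[OF v]) auto
    finally have "norm (complex_of_real (1 / ?g) * (LINT y|lborel. u (\<xi> + e k *\<^sub>R y) * complex_of_real (gauss y))) \<le> ?L"
      unfolding gauss_summation[OF u e] .
    then show ?thesis using gconst_pos[where 'a='a] by (simp add: norm_mult norm_divide field_simps)
  qed
  have "(\<lambda>k. LINT y|lborel. u (\<xi> + e k *\<^sub>R y) * complex_of_real (gauss y)) \<longlonglongrightarrow> (LINT y|lborel. u \<xi> * complex_of_real (gauss (y::'a)))"
  proof (rule integral_dominated_convergence[where w="\<lambda>y. M * gauss y"])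
    show "integrable lborel (\<lambda>y::'a. M * gauss y)" by (rule integrable_mult_right[OF integrable_gauss])
    show "AE y in lborel. (\<lambda>k. u (\<xi> + e k *\<^sub>R y) * complex_of_real (gauss y)) \<longlonglongrightarrow> u \<xi> * complex_of_real (gauss y)"
    proof (intro AE_I2 tendsto_mult tendsto_const)
      fix y
      have "(\<lambda>k. \<xi> + e k *\<^sub>R y) \<longlonglongrightarrow> \<xi> + 0 *\<^sub>R y" by (intro tendsto_intros e0)
      moreover have "isCont u \<xi>" using cont continuous_on_eq_continuous_at open_UNIV by blast
      ultimately show "(\<lambda>k. u (\<xi> + e k *\<^sub>R y)) \<longlonglongrightarrow> u \<xi>"
        using isCont_tendsto_compose by force
    qed
    show "AE y in lborel. norm (u (\<xi> + e k *\<^sub>R y) * complex_of_real (gauss y)) \<le> M * gauss y" for k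
      by (intro AE_I2) (simp add: norm_mult mult_right_mono bd)
  qed measurable
  then have "(\<lambda>k. norm (LINT y|lborel. u (\<xi> + e k *\<^sub>R y) * complex_of_real (gauss y))) \<longlonglongrightarrow> norm (LINT y|lborel. u \<xi> * complex_of_real (gauss (y::'a)))"
    by (rule tendsto_norm)
  then have "norm (LINT y|lborel. u \<xi> * complex_of_real (gauss (y::'a))) \<le> ?g * ?L"
    by (rule LIMSEQ_le_const2) (use le in auto)
  then show ?thesis
    using gconst_pos[where 'a='a] by (simp add: norm_mult integral_gauss mult.commute[of _ ?g])
qed

text \<open>For nonnegative v the Gaussian-weighted integral at frequency 0 is also an L^1 norm, and
  it is at most M for every scale; Fatou removes the Gaussian. Applied to a squared modulus, this
  takes the place of Plancherel's theorem.\<close>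

lemma integrable_inv_fourier_nonneg:
  fixes u :: "'a::euclidean_space \<Rightarrow> complex" and v :: "'a \<Rightarrow> real"
  assumes u: "integrable lborel u" and bd: "\<And>\<xi>. norm (u \<xi>) \<le> M"
    and v: "\<And>x. inv_fourier u x = complex_of_real (v x)" "\<And>x. 0 \<le> v x" and [measurable]: "v \<in> borel_measurable borel"
  shows "integrable lborel v"
proof (rule integrableI_bounded)
  let ?g = "gconst TYPE('a)"
  have [measurable]: "u \<in> borel_measurable borel" using borel_measurable_integrable[OF u] by simp
  have M: "0 \<le> M" using bd[of 0] norm_ge_zero order_trans by blast
  define e where "e k = 1 / real (Suc k)" for k
  have e: "0 < e k" for k by (simp add: e_def)
  have e0: "e \<longlonglongrightarrow> 0" unfolding e_def using LIMSEQ_Suc[OF lim_1_over_n[where 'a=real]] by simp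
  have le: "(\<integral>\<^sup>+x. ennreal (v x * gauss (e k *\<^sub>R x)) \<partial>lborel) \<le> ennreal M" for k
  proof -
    define B where "B = (2 * pi) powr (- real DIM('a)) * (LINT \<xi>|lborel. norm (u \<xi>))"
    have B: "v x \<le> B" for x using norm_inv_fourier_le[of u x] v by (simp add: B_def)
    have "integrable lborel (\<lambda>x::'a. B * gauss (e k *\<^sub>R x))"
      by (rule integrable_mult_right[OF integrable_gauss_scale[OF e]])
    then have int: "integrable lborel (\<lambda>x. v x * gauss (e k *\<^sub>R x))"
      by (rule Bochner_Integration.integrable_bound)
         (auto simp: abs_mult v(2) intro!: mult_right_mono order_trans[OF B abs_ge_self])
    have "complex_of_real (LINT x|lborel. v x * gauss (e k *\<^sub>R x)) = (LINT x|lborel. inv_fourier u x * exp (- (\<i> * complex_of_real (x \<bullet> 0))) * complex_of_real (gauss (e k *\<^sub>R x)))"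
      by (simp add: v flip: integral_complex_of_real)
    also have "\<dots> = complex_of_real (1 / ?g) * (LINT y|lborel. u (0 + e k *\<^sub>R y) * complex_of_real (gauss y))"
      by (rule gauss_summation[OF u e])
    finally have "norm (complex_of_real (LINT x|lborel. v x * gauss (e k *\<^sub>R x))) = 1 / ?g * norm (LINT y|lborel. u (e k *\<^sub>R y) * complex_of_real (gauss y))"
      using gconst_pos[where 'a='a] by (simp add: norm_mult norm_divide)
    also have "\<dots> \<le> 1 / ?g * (LINT y|lborel. norm (u (e k *\<^sub>R y) * complex_of_real (gauss y)))"
      using gconst_pos[where 'a='a] by (intro mult_left_mono integral_norm_bound) auto
    also have "\<dots> \<le> 1 / ?g * (LINT y|lborel. M * gauss (y::'a))"
    proof (intro mult_left_mono integral_mono)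
      have le: "norm (u (e k *\<^sub>R y) * complex_of_real (gauss y)) \<le> M * gauss y" for y
        by (simp add: norm_mult mult_right_mono bd)
      then show "norm (u (e k *\<^sub>R y) * complex_of_real (gauss y)) \<le> M * gauss y" for y .
      show "integrable lborel (\<lambda>y::'a. M * gauss y)" by (rule integrable_mult_right[OF integrable_gauss])
      then show "integrable lborel (\<lambda>y. norm (u (e k *\<^sub>R y) * complex_of_real (gauss y)))"
        by (rule Bochner_Integration.integrable_bound) (use order_trans[OF le abs_ge_self] in auto)
    qed (use gconst_pos[where 'a='a] in auto)
    also have "\<dots> = M" using gconst_pos[where 'a='a] by (simp add: integral_gauss)
    finally have "(LINT x|lborel. v x * gauss (e k *\<^sub>R x)) \<le> M" by (simp add: abs_le_iff)
    moreover have "(\<integral>\<^sup>+x. ennreal (v x * gauss (e k *\<^sub>R x)) \<partial>lborel) = ennreal (LINT x|lborel. v x * gauss (e k *\<^sub>R x))"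
      by (rule nn_integral_eq_integral[OF int]) (intro AE_I2 mult_nonneg_nonneg v(2) gauss_nonneg)
    ultimately show ?thesis by (simp add: ennreal_leI)
  qed
  have "(\<integral>\<^sup>+x. ennreal (norm (v x)) \<partial>lborel) = (\<integral>\<^sup>+x. liminf (\<lambda>k. ennreal (v x * gauss (e k *\<^sub>R x))) \<partial>lborel)"
  proof (intro nn_integral_cong)
    fix x :: 'a
    have "(\<lambda>k. e k *\<^sub>R x) \<longlonglongrightarrow> 0 *\<^sub>R x" by (intro tendsto_scaleR e0 tendsto_const)
    moreover have "isCont (gauss :: 'a \<Rightarrow> real) 0"
      using continuous_gauss[of UNIV] continuous_on_eq_continuous_at open_UNIV by blast
    ultimately have "(\<lambda>k. gauss (e k *\<^sub>R x)) \<longlonglongrightarrow> gauss (0::'a)"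
      using isCont_tendsto_compose by force
    then have "(\<lambda>k. v x * gauss (e k *\<^sub>R x)) \<longlonglongrightarrow> v x * gauss (0::'a)" by (rule tendsto_mult_left)
    then have "(\<lambda>k. ennreal (v x * gauss (e k *\<^sub>R x))) \<longlonglongrightarrow> ennreal (v x)"
      by (intro tendsto_ennrealI) (simp add: gauss_def)
    then show "ennreal (norm (v x)) = liminf (\<lambda>k. ennreal (v x * gauss (e k *\<^sub>R x)))"
      using v(2)[of x] by (metis abs_of_nonneg lim_imp_Liminf real_norm_def trivial_limit_sequentially)
  qed
  also have "\<dots> \<le> liminf (\<lambda>k. \<integral>\<^sup>+x. ennreal (v x * gauss (e k *\<^sub>R x)) \<partial>lborel)"
    by (intro nn_integral_liminf) measurable
  also have "\<dots> \<le> liminf (\<lambda>k. ennreal M)"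
    using le by (intro Liminf_mono always_eventually allI)
  finally have "(\<integral>\<^sup>+x. ennreal (norm (v x)) \<partial>lborel) \<le> ennreal M" by (simp add: Liminf_const)
  then show "(\<integral>\<^sup>+x. ennreal (norm (v x)) \<partial>lborel) < \<infinity>" using le_less_trans by fastforce
qed measurable

section \<open>Band-limited functions\<close>

text \<open>Continuity, rather than membership in some L^p, is demanded so that the pointwise bound
  \<open>inversion_sup_bound\<close> applies. Convolution preserves the class and adds the
  radii.\<close>

definition cont_supp :: "real \<Rightarrow> ('a::euclidean_space \<Rightarrow> complex) \<Rightarrow> bool" where
  "cont_supp R h \<longleftrightarrow> continuous_on UNIV h \<and> (\<forall>\<xi>. R < norm \<xi> \<longrightarrow> h \<xi> = 0)"

lemma cont_supp_mono: "cont_supp R h \<Longrightarrow> R \<le> S \<Longrightarrow> cont_supp S h"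
  by (auto simp: cont_supp_def)

lemma cont_supp_measurable: "cont_supp R h \<Longrightarrow> h \<in> borel_measurable borel"
  unfolding cont_supp_def by (auto intro: borel_measurable_continuous_onI)

lemma cont_supp_bounded:
  fixes h :: "'a::euclidean_space \<Rightarrow> complex"
  assumes "cont_supp R h"
  obtains M where "0 \<le> M" "\<And>\<xi>. norm (h \<xi>) \<le> M"
proof -
  have "compact (h ` cball 0 R)"
    using assms by (intro compact_continuous_image) (auto simp: cont_supp_def intro: continuous_on_subset)
  then obtain M where M: "\<forall>y\<in>h ` cball 0 R. norm y \<le> M"
    using compact_imp_bounded bounded_iff by blast
  have "norm (h \<xi>) \<le> max M 0" for \<xi>
  proof (cases "norm \<xi> \<le> R")
    case True
    then show ?thesis using M by (auto simp: le_max_iff_disj)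
  next
    case False
    then show ?thesis using assms by (auto simp: cont_supp_def)
  qed
  then show ?thesis using that[of "max M 0"] by simp
qed

lemma cont_supp_integrable:
  fixes h :: "'a::euclidean_space \<Rightarrow> complex"
  assumes "cont_supp R h"
  shows "integrable lborel h"
proof -
  note [measurable] = cont_supp_measurable[OF assms]
  obtain M where M: "0 \<le> M" "\<And>\<xi>. norm (h \<xi>) \<le> M" using cont_supp_bounded[OF assms] by blast
  have "integrable lborel (\<lambda>\<xi>. M * indicator (cball (0::'a) R) \<xi> :: real)"
    using emeasure_bounded_finite[of "cball (0::'a) R"]
    by (intro integrable_mult_right integrable_real_indicator) auto
  then show ?thesis
  proof (rule Bochner_Integration.integrable_bound)
    show "AE \<xi> in lborel. norm (h \<xi>) \<le> norm (M * indicator (cball (0::'a) R) \<xi> :: real)"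
      using M assms by (intro AE_I2) (auto simp: cont_supp_def indicator_def)
  qed measurable
qed

lemma cont_supp_add: "cont_supp R h \<Longrightarrow> cont_supp R k \<Longrightarrow> cont_supp R (\<lambda>\<xi>. h \<xi> + k \<xi>)"
  by (auto simp: cont_supp_def intro!: continuous_intros)

lemma cont_supp_cmult: "cont_supp R h \<Longrightarrow> cont_supp R (\<lambda>\<xi>. a * h \<xi>)"
  by (auto simp: cont_supp_def intro!: continuous_intros)

lemma cont_supp_cnj:
  fixes h :: "'a::euclidean_space \<Rightarrow> complex"
  assumes "cont_supp R h"
  shows "cont_supp R (\<lambda>\<xi>. cnj (h (- \<xi>)))"
proof -
  have "continuous_on UNIV (\<lambda>\<xi>. h (- \<xi>))"
    using assms by (intro continuous_on_compose2[of UNIV h UNIV uminus] continuous_intros) (auto simp: cont_supp_def)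
  then show ?thesis using assms by (auto simp: cont_supp_def intro!: continuous_intros)
qed

lemma cont_supp_conv:
  fixes h :: "'a::euclidean_space \<Rightarrow> complex"
  assumes h: "cont_supp R h" and k: "cont_supp S k"
  shows "cont_supp (R + S) (conv h k)"
proof -
  note [measurable] = cont_supp_measurable[OF h] cont_supp_measurable[OF k]
  obtain M where M: "0 \<le> M" "\<And>\<xi>. norm (h \<xi>) \<le> M" using cont_supp_bounded[OF h] by blast
  have "conv h k \<xi> = 0" if "R + S < norm \<xi>" for \<xi>
  proof -
    have "h (\<xi> - \<eta>) * k \<eta> = 0" for \<eta>
    proof (cases "norm \<eta> \<le> S")
      case True
      then have "R < norm (\<xi> - \<eta>)" using that norm_triangle_ineq2[of \<xi> \<eta>] by linarith
      then show ?thesis using h by (simp add: cont_supp_def)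
    next
      case False
      then show ?thesis using k by (simp add: cont_supp_def)
    qed
    then show ?thesis by (simp only: conv_def Bochner_Integration.integral_zero)
  qed
  moreover have "continuous_on UNIV (conv h k)"
  proof (rule continuous_on_sequentiallyI)
    fix u \<xi> assume u: "u \<longlonglongrightarrow> (\<xi> :: 'a)"
    show "(\<lambda>n. conv h k (u n)) \<longlonglongrightarrow> conv h k \<xi>"
      unfolding conv_def
    proof (rule integral_dominated_convergence[where w="\<lambda>\<eta>. M * norm (k \<eta>)"])
      show "integrable lborel (\<lambda>\<eta>. M * norm (k \<eta>))"
        by (intro integrable_mult_right integrable_norm cont_supp_integrable[OF k])
      show "AE \<eta> in lborel. (\<lambda>n. h (u n - \<eta>) * k \<eta>) \<longlonglongrightarrow> h (\<xi> - \<eta>) * k \<eta>"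
      proof (intro AE_I2 tendsto_mult tendsto_const)
        fix \<eta>
        have "isCont h (\<xi> - \<eta>)" using h continuous_on_eq_continuous_at open_UNIV unfolding cont_supp_def by blast
        moreover have "(\<lambda>n. u n - \<eta>) \<longlonglongrightarrow> \<xi> - \<eta>" by (intro tendsto_diff u tendsto_const)
        ultimately show "(\<lambda>n. h (u n - \<eta>)) \<longlonglongrightarrow> h (\<xi> - \<eta>)" by (rule isCont_tendsto_compose)
      qed
      show "AE \<eta> in lborel. norm (h (u n - \<eta>) * k \<eta>) \<le> M * norm (k \<eta>)" for n
        using M by (intro AE_I2) (simp add: norm_mult mult_right_mono)
    qed measurable
  qed
  ultimately show ?thesis by (simp add: cont_supp_def)
qed

text \<open>The squared modulus is the function times its conjugate, hence the inverse transform of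
  a convolution that is again continuous with bounded support. Being nonnegative, it is integrable
  by \<open>integrable_inv_fourier_nonneg\<close>.\<close>

lemma inv_fourier_cont_supp_square_integrable:
  fixes h :: "'a::euclidean_space \<Rightarrow> complex"
  assumes h: "cont_supp R h"
  shows "integrable lborel (\<lambda>x. (norm (inv_fourier h x))\<^sup>2)"
proof -
  note [measurable] = cont_supp_measurable[OF h]
  let ?k = "\<lambda>\<xi>. cnj (h (- \<xi>))"
  let ?u = "\<lambda>\<xi>. complex_of_real ((2 * pi) powr (- real DIM('a))) * conv h ?k \<xi>"
  have k: "cont_supp R ?k" by (rule cont_supp_cnj[OF h])
  note [measurable] = cont_supp_measurable[OF k]
  have u: "cont_supp (R + R) ?u" by (intro cont_supp_cmult cont_supp_conv h k)
  obtain M where M: "\<And>\<xi>. norm (?u \<xi>) \<le> M" using cont_supp_bounded[OF u] by blast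
  show ?thesis
  proof (rule integrable_inv_fourier_nonneg[OF cont_supp_integrable[OF u] M])
    fix x
    have "inv_fourier ?u x = inv_fourier h x * inv_fourier ?k x"
      by (intro inv_fourier_mult[symmetric] cont_supp_integrable[OF h] cont_supp_integrable[OF k]) measurable
    then show "inv_fourier ?u x = complex_of_real ((norm (inv_fourier h x))\<^sup>2)"
      unfolding complex_norm_square inv_fourier_cnj[OF cont_supp_measurable[OF h]] .
  qed auto
qed

definition band_lim :: "real \<Rightarrow> ('a::euclidean_space \<Rightarrow> complex) \<Rightarrow> bool" where
  "band_lim R f \<longleftrightarrow> (\<exists>h. cont_supp R h \<and> f = inv_fourier h)"

lemma band_lim_mono: "band_lim R f \<Longrightarrow> R \<le> S \<Longrightarrow> band_lim S f"
  unfolding band_lim_def using cont_supp_mono by blast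

lemma band_lim_measurable: "band_lim R f \<Longrightarrow> f \<in> borel_measurable borel"
  unfolding band_lim_def using cont_supp_measurable inv_fourier_measurable by blast

lemma band_lim_square_integrable: "band_lim R f \<Longrightarrow> integrable lborel (\<lambda>x. (norm (f x))\<^sup>2)"
  unfolding band_lim_def using inv_fourier_cont_supp_square_integrable by blast

lemma band_lim_mult:
  fixes f :: "'a::euclidean_space \<Rightarrow> complex"
  assumes "band_lim R f" "band_lim S g"
  shows "band_lim (R + S) (\<lambda>x. f x * g x)"
proof -
  obtain h k where h: "cont_supp R h" "f = inv_fourier h" and k: "cont_supp S k" "g = inv_fourier k"
    using assms by (auto simp: band_lim_def)
  show ?thesis unfolding band_lim_def
    by (intro exI[of _ "\<lambda>\<xi>. complex_of_real ((2 * pi) powr (- real DIM('a))) * conv h k \<xi>"] conjI cont_supp_cmult cont_supp_conv h k ext)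
       (simp add: h k inv_fourier_mult[OF cont_supp_measurable[OF h(1)] cont_supp_measurable[OF k(1)] cont_supp_integrable[OF h(1)] cont_supp_integrable[OF k(1)]])
qed

lemma band_lim_cmult:
  fixes f :: "'a::euclidean_space \<Rightarrow> complex"
  assumes "band_lim R f"
  shows "band_lim R (\<lambda>x. a * f x)"
proof -
  obtain h where h: "cont_supp R h" "f = inv_fourier h" using assms by (auto simp: band_lim_def)
  have "inv_fourier (\<lambda>\<xi>. a * h \<xi>) x = a * inv_fourier h x" for x by (rule inv_fourier_cmult)
  then show ?thesis unfolding band_lim_def using h cont_supp_cmult[OF h(1), of a] by (intro exI[of _ "\<lambda>\<xi>. a * h \<xi>"]) auto
qed

lemma band_lim_add:
  fixes f :: "'a::euclidean_space \<Rightarrow> complex"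
  assumes "band_lim R f" "band_lim R g"
  shows "band_lim R (\<lambda>x. f x + g x)"
proof -
  obtain h k where h: "cont_supp R h" "f = inv_fourier h" and k: "cont_supp R k" "g = inv_fourier k"
    using assms by (auto simp: band_lim_def)
  have "inv_fourier (\<lambda>\<xi>. h \<xi> + k \<xi>) x = inv_fourier h x + inv_fourier k x" for x
    by (rule inv_fourier_add[OF cont_supp_integrable[OF h(1)] cont_supp_integrable[OF k(1)]])
  then show ?thesis unfolding band_lim_def using h k cont_supp_add[OF h(1) k(1)]
    by (intro exI[of _ "\<lambda>\<xi>. h \<xi> + k \<xi>"]) auto
qed

lemma band_lim_0: "band_lim R (\<lambda>x. 0)"
  unfolding band_lim_def by (rule exI[of _ "\<lambda>_. 0"]) (auto simp: cont_supp_def inv_fourier_def)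

lemma band_lim_sum: "finite A \<Longrightarrow> (\<And>i. i \<in> A \<Longrightarrow> band_lim R (f i)) \<Longrightarrow> band_lim R (\<lambda>x. \<Sum>i\<in>A. f i x)"
  by (induction A rule: finite_induct) (auto intro: band_lim_0 band_lim_add)

text \<open>Exponents start at 1: the constant function 1 is not square integrable, so it is not
  band-limited in the present sense.\<close>

lemma band_lim_power: "band_lim R f \<Longrightarrow> band_lim (R * real (Suc k)) (\<lambda>x. f x ^ Suc k)"
proof (induction k)
  case (Suc k)
  show ?case using band_lim_mult[OF Suc.prems Suc.IH[OF Suc.prems]] by (simp add: algebra_simps)
qed simp

text \<open>The factor f^2 gives every monomial a positive exponent, so
  \<open>band_lim_power\<close> covers all of them; the highest exponent is at most d + 2.\<close>

lemma band_lim_square_mult_poly: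
  fixes f :: "'a::euclidean_space \<Rightarrow> complex"
  assumes f: "band_lim R f" and R: "0 \<le> R" and d: "degree r \<le> d"
  shows "band_lim (R * real (d + 2)) (\<lambda>x. (f x)\<^sup>2 * poly r (f x))"
proof -
  have "band_lim (R * real (d + 2)) (\<lambda>x. coeff r i * f x ^ (Suc (Suc i)))" if "i \<le> degree r" for i
    by (intro band_lim_cmult band_lim_mono[OF band_lim_power[OF f]] mult_left_mono R) (use that d in auto)
  then have "band_lim (R * real (d + 2)) (\<lambda>x. \<Sum>i\<le>degree r. coeff r i * f x ^ (Suc (Suc i)))"
    by (intro band_lim_sum) auto
  moreover have "(\<Sum>i\<le>degree r. coeff r i * f x ^ (Suc (Suc i))) = (f x)\<^sup>2 * poly r (f x)" for x
    by (simp add: poly_altdef sum_distrib_left power2_eq_square mult_ac)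
  ultimately show ?thesis by simp
qed

section \<open>Weighted norms of band-limited functions\<close>

context fourier_weight begin

text \<open>On the ball of radius R the weight is at most (1+R)^N and the volume is V R^n. The norm
  contains the volume to the power 1/q only; with V+1 and 1+R in place of V and R the base is at
  least 1, and x \<le> x^q then allows the first power. \<open>C\<close> and \<open>N\<close> are
  chosen before \<open>R\<close>, \<open>h\<close> and \<open>L\<close>: this uniformity is what the
  polynomial estimates use.\<close>

lemma wlq_le_bounded_support:
  "\<exists>C N. 0 \<le> C \<and> (\<forall>R h L. 0 \<le> R \<longrightarrow> h \<in> borel_measurable borel \<longrightarrow> (\<forall>\<xi>. R < norm \<xi> \<longrightarrow> h \<xi> = 0)
    \<longrightarrow> (\<forall>\<xi>. norm (h \<xi>) \<le> L) \<longrightarrow> wlq_le h (C * (1 + R) ^ N * L))"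
proof -
  let ?n = "DIM('a)"
  let ?V = "unit_ball_vol (real ?n)"
  obtain N where N: "\<And>x. w x \<le> (1 + norm x) ^ N" using weight_growth by blast
  have V: "0 \<le> ?V" by (rule unit_ball_vol_nonneg) simp
  have "wlq_le h ((?V + 1) * (1 + R) ^ (N + ?n) * L)"
    if R: "0 \<le> R" and [measurable]: "h \<in> borel_measurable borel" and supp: "\<And>\<xi>. R < norm \<xi> \<Longrightarrow> h \<xi> = 0"
      and L: "\<And>\<xi>. norm (h \<xi>) \<le> L" for R h L
  proof (rule hbI)
    have L0: "0 \<le> L" using L[of 0] norm_ge_zero order_trans by blast
    then show "0 \<le> (?V + 1) * (1 + R) ^ (N + ?n) * L" using V R by simp
    let ?A = "(1 + R) ^ N * L"
    have A: "0 \<le> ?A" using L0 R by simp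
    have "(\<integral>\<^sup>+\<xi>. ennreal ((w \<xi> * norm (h \<xi>)) powr q) \<partial>lborel) \<le> (\<integral>\<^sup>+\<xi>. ennreal (?A powr q) * indicator (cball (0::'a) R) \<xi> \<partial>lborel)"
    proof (intro nn_integral_mono)
      fix \<xi> :: 'a
      show "ennreal ((w \<xi> * norm (h \<xi>)) powr q) \<le> ennreal (?A powr q) * indicator (cball (0::'a) R) \<xi>"
      proof (cases "norm \<xi> \<le> R")
        case True
        have "w \<xi> \<le> (1 + R) ^ N" using N[of \<xi>] power_mono[of "1 + norm \<xi>" "1 + R" N] True by simp
        then have "w \<xi> * norm (h \<xi>) \<le> ?A" using L R by (intro mult_mono) auto
        then show ?thesis using True q_gt_1 by (auto simp: indicator_def intro!: ennreal_leI powr_mono2)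
      qed (use supp q_gt_1 in auto)
    qed
    also have "\<dots> = ennreal (?A powr q) * emeasure lborel (cball (0::'a) R)"
      by (rule nn_integral_cmult_indicator) simp
    also have "emeasure lborel (cball (0::'a) R) = ennreal (?V * R ^ ?n)"
      by (rule emeasure_cball[OF R])
    also have "ennreal (?A powr q) * ennreal (?V * R ^ ?n) = ennreal (?A powr q * (?V * R ^ ?n))"
      using V R by (intro ennreal_mult[symmetric]) auto
    also have "\<dots> \<le> ennreal (((?V + 1) * (1 + R) ^ (N + ?n) * L) powr q)"
    proof (rule ennreal_leI)
      have le1: "x \<le> x powr q" if "1 \<le> x" for x :: real
        using powr_mono[of 1 q x] q_gt_1 that by simp
      have "?V * R ^ ?n \<le> (?V + 1) * (1 + R) ^ ?n" using V R by (intro mult_mono power_mono) auto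
      also have "\<dots> \<le> ((?V + 1) * (1 + R) ^ ?n) powr q"
      proof (rule le1)
        have "1 * 1 \<le> (?V + 1) * (1 + R) ^ ?n" using V R by (intro mult_mono one_le_power) auto
        then show "1 \<le> (?V + 1) * (1 + R) ^ ?n" by simp
      qed
      finally have "?A powr q * (?V * R ^ ?n) \<le> ?A powr q * ((?V + 1) * (1 + R) ^ ?n) powr q"
        by (intro mult_left_mono) auto
      also have "\<dots> = (?A * ((?V + 1) * (1 + R) ^ ?n)) powr q" using A V R by (simp add: powr_mult)
      also have "?A * ((?V + 1) * (1 + R) ^ ?n) = (?V + 1) * (1 + R) ^ (N + ?n) * L"
        by (simp add: power_add mult_ac)
      finally show "?A powr q * (?V * R ^ ?n) \<le> ((?V + 1) * (1 + R) ^ (N + ?n) * L) powr q" .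
    qed
    finally show "(\<integral>\<^sup>+\<xi>. ennreal ((w \<xi> * norm (h \<xi>)) powr q) \<partial>lborel) \<le> ennreal (((?V + 1) * (1 + R) ^ (N + ?n) * L) powr q)" .
  qed fact
  then show ?thesis using V by (intro exI[of _ "?V + 1"] exI[of _ "N + ?n"]) auto
qed

text \<open>\<open>inversion_sup_bound\<close> bounds the transform pointwise by the L^1 norm of the
  function, and a bounded function on a ball of radius R has a weighted norm polynomial in R. This
  is the source of the polynomial loss.\<close>

lemma fl_le_of_band_lim_integrable:
  "\<exists>C N. 0 \<le> C \<and> (\<forall>R f L. 0 \<le> R \<longrightarrow> band_lim R f \<longrightarrow> integrable lborel f \<longrightarrow> (LINT x|lborel. norm (f x)) \<le> L
    \<longrightarrow> fl_le f (C * (1 + R) ^ N * L))"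
proof -
  obtain C N where C: "0 \<le> C" and CN: "\<And>R h L. 0 \<le> R \<Longrightarrow> h \<in> borel_measurable borel \<Longrightarrow> (\<And>\<xi>. R < norm \<xi> \<Longrightarrow> h \<xi> = 0)
    \<Longrightarrow> (\<And>\<xi>. norm (h \<xi>) \<le> L) \<Longrightarrow> wlq_le h (C * (1 + R) ^ N * L)"
    using wlq_le_bounded_support by blast
  have "fl_le f (\<kappa> * C * (1 + R) ^ N * L)"
    if R: "0 \<le> R" and f: "band_lim R f" "integrable lborel f" and L: "(LINT x|lborel. norm (f x)) \<le> L" for R f L
  proof -
    obtain h where h: "cont_supp R h" "f = inv_fourier h" using f by (auto simp: band_lim_def)
    obtain M where M: "\<And>\<xi>. norm (h \<xi>) \<le> M" using cont_supp_bounded[OF h(1)] by blast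
    have "norm (h \<xi>) \<le> L" for \<xi>
      using inversion_sup_bound[OF cont_supp_integrable[OF h(1)] _ M, of \<xi>] f h L by (auto simp: cont_supp_def)
    then have "wlq_le h (C * (1 + R) ^ N * L)"
      using h(1) by (intro CN R cont_supp_measurable[OF h(1)]) (auto simp: cont_supp_def)
    then show ?thesis unfolding fl_le_def using h \<kappa>_pos by (intro exI[of _ h]) (auto simp: mult.assoc)
  qed
  then show ?thesis using C \<kappa>_pos by (intro exI[of _ "\<kappa> * C"] exI[of _ N]) auto
qed

end

section \<open>Density of band-limited functions and decay at infinity\<close>

lemma AE_not_in_negligible:
  assumes "negligible (N :: 'a::euclidean_space set)"
  shows "AE x in lborel. x \<notin> N"
proof -
  have "AE x in lebesgue. x \<notin> N"
    using assms by (intro AE_not_in) (simp add: negligible_iff_null_sets)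
  then show ?thesis by (simp add: AE_completion_iff)
qed

context fourier_weight begin

lemma wlq_le_dominated_approx:
  fixes h :: "'a \<Rightarrow> complex"
  assumes [measurable]: "h \<in> borel_measurable borel" "\<And>n. k n \<in> borel_measurable borel"
    and lim: "AE \<xi> in lborel. (\<lambda>n. k n \<xi>) \<longlonglongrightarrow> h \<xi>"
    and dom: "\<And>n \<xi>. (w \<xi> * norm (h \<xi> - k n \<xi>)) powr q \<le> G \<xi>" and G: "integrable lborel G"
    and e: "0 < e"
  shows "\<exists>n::nat. wlq_le (\<lambda>\<xi>. h \<xi> - k n \<xi>) e"
proof -
  let ?F = "\<lambda>n \<xi>. (w \<xi> * norm (h \<xi> - k n \<xi>)) powr q"
  have "(\<lambda>n. LINT \<xi>|lborel. ?F n \<xi>) \<longlonglongrightarrow> (LINT \<xi>|(lborel :: 'a measure). 0)"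
  proof (rule integral_dominated_convergence[where w=G])
    show "AE \<xi> in lborel. (\<lambda>n. ?F n \<xi>) \<longlonglongrightarrow> 0"
      using lim
    proof eventually_elim
      case (elim \<xi>)
      then have "(\<lambda>n. w \<xi> * norm (h \<xi> - k n \<xi>)) \<longlonglongrightarrow> w \<xi> * norm (h \<xi> - h \<xi>)"
        by (intro tendsto_intros)
      then have "(\<lambda>n. ?F n \<xi>) \<longlonglongrightarrow> (w \<xi> * norm (h \<xi> - h \<xi>)) powr q"
        using q_gt_1 by (intro tendsto_powr2 tendsto_const) auto
      then show ?case by simp
    qed
  qed (use dom G in auto)
  then have "(\<lambda>n. LINT \<xi>|lborel. ?F n \<xi>) \<longlonglongrightarrow> 0" by simp
  moreover have "0 < e powr q" using e by simp
  ultimately have "\<forall>\<^sub>F n in sequentially. (LINT \<xi>|lborel. ?F n \<xi>) < e powr q"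
    by (rule order_tendstoD)
  then obtain n where n: "(LINT \<xi>|lborel. ?F n \<xi>) < e powr q" by (auto simp: eventually_sequentially)
  have "integrable lborel (?F n)"
    by (rule Bochner_Integration.integrable_bound[OF G]) (auto intro!: AE_I2 order_trans[OF dom abs_ge_self])
  then have "(\<integral>\<^sup>+\<xi>. ennreal (?F n \<xi>) \<partial>lborel) = ennreal (LINT \<xi>|lborel. ?F n \<xi>)"
    by (intro nn_integral_eq_integral) auto
  then have "wlq_le (\<lambda>\<xi>. h \<xi> - k n \<xi>) e"
    using n e by (intro hbI) (auto intro: ennreal_leI)
  then show ?thesis by blast
qed

text \<open>Two applications of dominated convergence. Truncation in both frequency and value leaves
  a bounded function \<open>t m\<close> with bounded support; this is almost everywhere a limit of
  continuous functions, which are then modified so as to share one integrable majorant.\<close>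

lemma wlq_le_cont_supp_approx:
  assumes h: "wlq_le h A" and e: "0 < e"
  shows "\<exists>R k. 0 \<le> R \<and> cont_supp R k \<and> wlq_le (\<lambda>\<xi>. h \<xi> - k \<xi>) e"
proof -
  note [measurable] = wlq_le_measurable[OF h]
  define t where "t m \<xi> = (if norm \<xi> \<le> real m \<and> norm (h \<xi>) \<le> real m then h \<xi> else 0)" for m \<xi>
  have [measurable]: "t m \<in> borel_measurable borel" for m unfolding t_def[abs_def] by measurable
  have "\<exists>m. wlq_le (\<lambda>\<xi>. h \<xi> - t m \<xi>) (e / 2)"
  proof (rule wlq_le_dominated_approx)
    show "AE \<xi> in lborel. (\<lambda>m. t m \<xi>) \<longlonglongrightarrow> h \<xi>"
    proof (intro AE_I2 tendsto_eventually)
      fix \<xi> :: 'a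
      obtain M :: nat where "max (norm \<xi>) (norm (h \<xi>)) \<le> real M" using real_arch_simple by blast
      then show "\<forall>\<^sub>F m in sequentially. t m \<xi> = h \<xi>"
        by (intro eventually_sequentiallyI[of M]) (auto simp: t_def)
    qed
    show "(w \<xi> * norm (h \<xi> - t n \<xi>)) powr q \<le> (w \<xi> * norm (h \<xi>)) powr q" for n \<xi>
      using q_gt_1 by (intro powr_mono2) (auto simp: t_def)
    show "integrable lborel (\<lambda>\<xi>. (w \<xi> * norm (h \<xi>)) powr q)"
      using wlq_le_le[OF h] by (intro integrableI_bounded) (auto intro: le_less_trans)
  qed (use e in auto)
  then obtain m where m: "wlq_le (\<lambda>\<xi>. h \<xi> - t m \<xi>) (e / 2)" by blast
  define r where "r = real m"
  have r: "0 \<le> r" by (simp add: r_def)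
  have t_bd: "norm (t m \<xi>) \<le> r" for \<xi> by (auto simp: t_def r_def)
  have t_supp: "t m \<xi> = 0" if "r < norm \<xi>" for \<xi> using that by (auto simp: t_def r_def)
  have "t m \<in> borel_measurable lebesgue" by (simp add: measurable_completion)
  from lebesgue_measurable_imp_measurable_on[OF this, of UNIV]
  obtain N g where N: "negligible N" and g: "\<And>n. continuous_on UNIV (g n)"
    and lim: "\<And>\<xi>. \<xi> \<notin> N \<Longrightarrow> (\<lambda>n. g n \<xi>) \<longlonglongrightarrow> t m \<xi>"
    unfolding measurable_on_def by auto
  \<comment> \<open>Projection onto the disc of radius r fixes all values of \<open>t m\<close> and
    bounds the approximants uniformly.\<close>
  define clip where "clip z = closest_point (cball 0 r) z" for z :: complex
  have clip_cont: "continuous_on UNIV clip" unfolding clip_def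
    using r by (intro continuous_on_closest_point) auto
  have clip_bd: "norm (clip z) \<le> r" for z
    using closest_point_in_set[of "cball (0::complex) r" z] r by (auto simp: clip_def)
  have clip_id: "clip z = z" if "norm z \<le> r" for z
    using that by (simp add: clip_def closest_point_self)
  \<comment> \<open>Equal to 1 up to radius r and to 0 from radius r + 1 on. It confines the
    supports to one ball and leaves the limit unchanged, as \<open>t m\<close> vanishes beyond
    radius r.\<close>
  define cut where "cut \<xi> = max 0 (min 1 (r + 1 - norm \<xi>))" for \<xi> :: 'a
  have chi: "0 \<le> cut \<xi>" "cut \<xi> \<le> 1" for \<xi> by (auto simp: cut_def)
  define k where "k n \<xi> = complex_of_real (cut \<xi>) * clip (g n \<xi>)" for n \<xi>
  have k: "cont_supp (r + 1) (k n)" for n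
    unfolding cont_supp_def
  proof (intro conjI allI impI)
    have "continuous_on UNIV (\<lambda>\<xi>. clip (g n \<xi>))"
      by (rule continuous_on_compose2[OF clip_cont g]) auto
    then show "continuous_on UNIV (k n)" unfolding k_def cut_def by (intro continuous_intros)
    show "k n \<xi> = 0" if "r + 1 < norm \<xi>" for \<xi> using that by (simp add: k_def cut_def)
  qed
  note [measurable] = cont_supp_measurable[OF k]
  obtain Nw where Nw: "\<And>x. w x \<le> (1 + norm x) ^ Nw" using weight_growth by blast
  have "\<exists>n. wlq_le (\<lambda>\<xi>. t m \<xi> - k n \<xi>) (e / 2)"
  proof (rule wlq_le_dominated_approx)
    show "AE \<xi> in lborel. (\<lambda>n. k n \<xi>) \<longlonglongrightarrow> t m \<xi>"
      using AE_not_in_negligible[OF N]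
    proof eventually_elim
      case (elim \<xi>)
      have "isCont clip (t m \<xi>)" using clip_cont continuous_on_eq_continuous_at open_UNIV by blast
      then have "(\<lambda>n. clip (g n \<xi>)) \<longlonglongrightarrow> clip (t m \<xi>)"
        using lim[OF elim] by (rule isCont_tendsto_compose)
      then have "(\<lambda>n. k n \<xi>) \<longlonglongrightarrow> complex_of_real (cut \<xi>) * t m \<xi>"
        unfolding k_def clip_id[OF t_bd] by (intro tendsto_mult tendsto_const)
      moreover have "complex_of_real (cut \<xi>) * t m \<xi> = t m \<xi>"
        using t_supp[of \<xi>] by (cases "norm \<xi> \<le> r") (auto simp: cut_def)
      ultimately show ?case by simp
    qed
    show "(w \<xi> * norm (t m \<xi> - k n \<xi>)) powr q \<le> ((2 + r) ^ Nw * (2 * r)) powr q * indicator (cball 0 (r + 1)) \<xi>" for n \<xi>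
    proof (cases "norm \<xi> \<le> r + 1")
      case True
      have "norm (k n \<xi>) \<le> 1 * r" unfolding k_def norm_mult
        using chi clip_bd by (intro mult_mono) auto
      then have "norm (t m \<xi> - k n \<xi>) \<le> 2 * r"
        using norm_triangle_ineq4[of "t m \<xi>" "k n \<xi>"] t_bd[of \<xi>] by simp
      moreover have "w \<xi> \<le> (2 + r) ^ Nw"
        by (rule order_trans[OF Nw power_mono]) (use True in auto)
      ultimately have "w \<xi> * norm (t m \<xi> - k n \<xi>) \<le> (2 + r) ^ Nw * (2 * r)"
        using r by (intro mult_mono) auto
      then show ?thesis using True q_gt_1 by (auto simp: indicator_def intro!: powr_mono2)
    next
      case False
      then have "t m \<xi> = 0" "k n \<xi> = 0" using t_supp k by (auto simp: cont_supp_def)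
      then show ?thesis using q_gt_1 by simp
    qed
    show "integrable lborel (\<lambda>\<xi>. ((2 + r) ^ Nw * (2 * r)) powr q * indicator (cball (0::'a) (r + 1)) \<xi>)"
      using emeasure_bounded_finite[of "cball (0::'a) (r + 1)"]
      by (intro integrable_mult_right integrable_real_indicator) auto
  qed (use e in auto)
  then obtain n where n: "wlq_le (\<lambda>\<xi>. t m \<xi> - k n \<xi>) (e / 2)" by blast
  have "wlq_le (\<lambda>\<xi>. h \<xi> - k n \<xi>) e" using wlq_le_add[OF m n] by simp
  then show ?thesis using k r by (intro exI[of _ "r + 1"] exI[of _ "k n"]) auto
qed

lemma fl_le_band_lim_approx:
  assumes f: "fl_le f A" and e: "0 < e"
  shows "\<exists>R g. 0 \<le> R \<and> band_lim R g \<and> fl_le (\<lambda>x. f x - g x) e"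
proof -
  obtain h where h: "wlq_le h (A / \<kappa>)" "f = inv_fourier h" using f by (auto simp: fl_le_def)
  obtain R k where k: "0 \<le> R" "cont_supp R k" "wlq_le (\<lambda>\<xi>. h \<xi> - k \<xi>) (e / \<kappa>)"
    using wlq_le_cont_supp_approx[OF h(1), of "e / \<kappa>"] e \<kappa>_pos by auto
  have "inv_fourier h x = inv_fourier (\<lambda>\<xi>. h \<xi> - k \<xi>) x + inv_fourier k x" for x
    using inv_fourier_add[OF wlq_le_L1(1)[OF k(3)] cont_supp_integrable[OF k(2)], of x] by simp
  then have "(\<lambda>x. f x - inv_fourier k x) = inv_fourier (\<lambda>\<xi>. h \<xi> - k \<xi>)" using h by auto
  then show ?thesis unfolding fl_le_def band_lim_def using k by (intro exI[of _ R] exI[of _ "inv_fourier k"]) auto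
qed

end

text \<open>Half-period shift: translation by a = pi x / |x|^2 reverses the sign of the exponential.
  Twice the integral is therefore bounded by the L^1 distance between h and its translate by a, and
  a tends to 0 as x goes to infinity.\<close>

lemma Riemann_Lebesgue_cont_supp:
  fixes h :: "'a::euclidean_space \<Rightarrow> complex"
  assumes h: "cont_supp R h"
  shows "(inv_fourier h \<longlongrightarrow> 0) at_infinity"
proof (rule ccontr)
  note [measurable] = cont_supp_measurable[OF h]
  let ?c = "complex_of_real ((2 * pi) powr (- real DIM('a)))"
  assume "\<not> ?thesis"
  then obtain e where e: "0 < e" "\<And>b. \<exists>x::'a. b \<le> norm x \<and> e \<le> norm (inv_fourier h x)"
    unfolding Lim_at_infinity by (auto simp: not_less)
  \<comment> \<open>Since 4 exceeds pi, the shifts \<open>a n\<close> have norm at most 1, and all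
    translates of h are supported in the ball of radius R + 1.\<close>
  then have "\<forall>n. \<exists>x::'a. real (n + 4) \<le> norm x \<and> e \<le> norm (inv_fourier h x)" by blast
  then obtain X :: "nat \<Rightarrow> 'a" where X: "\<And>n. real (n + 4) \<le> norm (X n)" "\<And>n. e \<le> norm (inv_fourier h (X n))"
    by metis
  define a where "a n = (pi / (norm (X n))\<^sup>2) *\<^sub>R X n" for n
  have Xpos: "0 < norm (X n)" for n using X(1)[of n] by linarith
  have Xa: "X n \<bullet> a n = pi" for n
    using Xpos[of n] by (simp add: a_def power2_norm_eq_inner[symmetric])
  have norm_a: "norm (a n) = pi / norm (X n)" for n
    using Xpos[of n] by (simp add: a_def power2_eq_square)
  have a_le: "norm (a n) \<le> pi / real (n + 4)" for n
    unfolding norm_a using X(1)[of n] Xpos[of n] by (intro divide_left_mono) auto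
  have a1: "norm (a n) \<le> 1" for n
  proof -
    have "pi / real (n + 4) \<le> 1" using pi_less_4 by (simp add: divide_le_eq)
    then show ?thesis using a_le[of n] by linarith
  qed
  have a0: "a \<longlonglongrightarrow> 0"
  proof (rule Lim_null_comparison)
    show "\<forall>\<^sub>F n in sequentially. norm (a n) \<le> pi / real (n + 4)" using a_le by simp
    show "(\<lambda>n. pi / real (n + 4)) \<longlonglongrightarrow> 0"
      using LIMSEQ_ignore_initial_segment[OF lim_const_over_n[of pi], of 4] by simp
  qed
  obtain M where M: "0 \<le> M" "\<And>\<xi>. norm (h \<xi>) \<le> M" using cont_supp_bounded[OF h] by blast
  have "(\<lambda>n. LINT \<xi>|lborel. norm (h \<xi> - h (\<xi> - a n))) \<longlonglongrightarrow> (LINT \<xi>|lborel. norm (h \<xi> - h (\<xi> - 0)))"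
  proof (rule integral_dominated_convergence[where w="\<lambda>\<xi>. 2 * M * indicator (cball (0::'a) (R + 1)) \<xi>"])
    show "integrable lborel (\<lambda>\<xi>. 2 * M * indicator (cball (0::'a) (R + 1)) \<xi>)"
      using emeasure_bounded_finite[of "cball (0::'a) (R + 1)"]
      by (intro integrable_mult_right integrable_real_indicator) auto
    show "AE \<xi> in lborel. (\<lambda>n. norm (h \<xi> - h (\<xi> - a n))) \<longlonglongrightarrow> norm (h \<xi> - h (\<xi> - 0))"
    proof (intro AE_I2 tendsto_norm tendsto_diff tendsto_const)
      fix \<xi>
      have "isCont h (\<xi> - 0)" using h continuous_on_eq_continuous_at open_UNIV unfolding cont_supp_def by blast
      moreover have "(\<lambda>n. \<xi> - a n) \<longlonglongrightarrow> \<xi> - 0" by (intro tendsto_diff a0 tendsto_const)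
      ultimately show "(\<lambda>n. h (\<xi> - a n)) \<longlonglongrightarrow> h (\<xi> - 0)" by (rule isCont_tendsto_compose)
    qed
    show "AE \<xi> in lborel. norm (norm (h \<xi> - h (\<xi> - a n))) \<le> 2 * M * indicator (cball (0::'a) (R + 1)) \<xi>" for n
    proof (intro AE_I2)
      fix \<xi>
      show "norm (norm (h \<xi> - h (\<xi> - a n))) \<le> 2 * M * indicator (cball (0::'a) (R + 1)) \<xi>"
      proof (cases "norm \<xi> \<le> R + 1")
        case True
        then show ?thesis
          using norm_triangle_ineq4[of "h \<xi>" "h (\<xi> - a n)"] M(2)[of \<xi>] M(2)[of "\<xi> - a n"] by simp
      next
        case False
        then have "R < norm (\<xi> - a n)" using norm_triangle_ineq2[of \<xi> "a n"] a1[of n] by linarith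
        then have "h \<xi> = 0" "h (\<xi> - a n) = 0" using h False by (auto simp: cont_supp_def)
        then show ?thesis using M by simp
      qed
    qed
  qed measurable
  then have lim: "(\<lambda>n. norm ?c * (LINT \<xi>|lborel. norm (h \<xi> - h (\<xi> - a n)))) \<longlonglongrightarrow> 0"
    using tendsto_mult_right_zero by fastforce
  have "2 * norm (inv_fourier h (X n)) \<le> norm ?c * (LINT \<xi>|lborel. norm (h \<xi> - h (\<xi> - a n)))" for n
  proof -
    let ?e = "\<lambda>\<xi>. exp (\<i> * complex_of_real (X n \<bullet> \<xi>))"
    have hi: "integrable lborel (\<lambda>\<xi>. h \<xi> * ?e \<xi>)"
      by (rule Bochner_Integration.integrable_bound[OF cont_supp_integrable[OF h]]) (auto simp: norm_mult)
    have shift: "h (\<xi> - a n) * ?e (\<xi> - a n) = - (h (\<xi> - a n) * ?e \<xi>)" for \<xi>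
      by (simp add: inner_diff_right Xa right_diff_distrib exp_diff)
    have cont_supp': "cont_supp (R + 1) (\<lambda>\<xi>. h (\<xi> - a n))"
      unfolding cont_supp_def
    proof (intro conjI allI impI)
      show "continuous_on UNIV (\<lambda>\<xi>. h (\<xi> - a n))"
        using h by (intro continuous_on_compose2[of UNIV h UNIV "\<lambda>\<xi>. \<xi> - a n"] continuous_intros) (auto simp: cont_supp_def)
      show "h (\<xi> - a n) = 0" if "R + 1 < norm \<xi>" for \<xi>
      proof -
        have "R < norm (\<xi> - a n)" using that norm_triangle_ineq2[of \<xi> "a n"] a1[of n] by linarith
        then show ?thesis using h by (simp add: cont_supp_def)
      qed
    qed
    have hi': "integrable lborel (\<lambda>\<xi>. h (\<xi> - a n) * ?e \<xi>)"
      by (rule Bochner_Integration.integrable_bound[OF cont_supp_integrable[OF cont_supp']]) (auto simp: norm_mult)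
    have "(LINT \<xi>|lborel. h \<xi> * ?e \<xi>) = (LINT \<xi>|lborel. h (\<xi> - a n) * ?e (\<xi> - a n))"
      by (rule lborel_integral_translate[symmetric]) measurable
    also have "\<dots> = - (LINT \<xi>|lborel. h (\<xi> - a n) * ?e \<xi>)"
      unfolding shift by simp
    finally have "2 * (LINT \<xi>|lborel. h \<xi> * ?e \<xi>) = (LINT \<xi>|lborel. h \<xi> * ?e \<xi>) - (LINT \<xi>|lborel. h (\<xi> - a n) * ?e \<xi>)"
      by simp
    also have "\<dots> = (LINT \<xi>|lborel. h \<xi> * ?e \<xi> - h (\<xi> - a n) * ?e \<xi>)"
      using hi hi' by simp
    also have "\<dots> = (LINT \<xi>|lborel. (h \<xi> - h (\<xi> - a n)) * ?e \<xi>)"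
      by (simp add: left_diff_distrib)
    finally have "norm (2 * (LINT \<xi>|lborel. h \<xi> * ?e \<xi>)) = norm (LINT \<xi>|lborel. (h \<xi> - h (\<xi> - a n)) * ?e \<xi>)"
      by (rule arg_cong)
    also have "\<dots> \<le> (LINT \<xi>|lborel. norm ((h \<xi> - h (\<xi> - a n)) * ?e \<xi>))" by (rule integral_norm_bound)
    finally have "2 * norm (LINT \<xi>|lborel. h \<xi> * ?e \<xi>) \<le> (LINT \<xi>|lborel. norm (h \<xi> - h (\<xi> - a n)))"
      by (simp add: norm_mult[of 2] norm_mult[of "h _ - h _"])
    then have "norm ?c * (2 * norm (LINT \<xi>|lborel. h \<xi> * ?e \<xi>)) \<le> norm ?c * (LINT \<xi>|lborel. norm (h \<xi> - h (\<xi> - a n)))"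
      by (intro mult_left_mono) auto
    then show ?thesis by (simp add: inv_fourier_def norm_mult mult.left_commute)
  qed
  then have "2 * e \<le> norm ?c * (LINT \<xi>|lborel. norm (h \<xi> - h (\<xi> - a n)))" for n
    using X(2)[of n] by (meson mult_left_mono order_trans zero_le_numeral)
  then have "2 * e \<le> 0" using lim by (intro LIMSEQ_le_const[OF lim]) auto
  then show False using e by simp
qed

lemma (in fourier_weight) fl_le_vanishes_at_infinity:
  assumes f: "fl_le f A"
  shows "(f \<longlongrightarrow> 0) at_infinity"
  unfolding tendsto_iff
proof (intro allI impI)
  fix e :: real assume e: "0 < e"
  obtain R g where g: "band_lim R g" "fl_le (\<lambda>x. f x - g x) (e / 2)" using fl_le_band_lim_approx[OF f, of "e / 2"] e by auto
  have "(g \<longlongrightarrow> 0) at_infinity" using g(1) Riemann_Lebesgue_cont_supp by (auto simp: band_lim_def)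
  then have "\<forall>\<^sub>F x in at_infinity. dist (g x) 0 < e / 2" using e by (intro tendstoD) auto
  then show "\<forall>\<^sub>F x in at_infinity. dist (f x) 0 < e"
  proof eventually_elim
    case (elim x)
    have "norm (f x) \<le> norm (f x - g x) + norm (g x)" using norm_triangle_ineq[of "f x - g x" "g x"] by simp
    then show ?case using elim fl_le_bound[OF g(2), of x] by simp
  qed
qed

section \<open>Polynomial estimates\<close>

text \<open>The substitution w + 1/w conjugates z^2 - 2 to squaring. The iterates are thus rescaled
  Chebyshev polynomials of degree 2^j.\<close>

lemma joukowski_iterate:
  fixes w :: complex
  assumes "w \<noteq> 0"
  shows "((\<lambda>z. z\<^sup>2 - 2) ^^ j) (w + 1 / w) = w ^ (2 ^ j) + 1 / w ^ (2 ^ j)"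
proof (induction j)
  case (Suc j)
  let ?v = "w ^ (2 ^ j)"
  have "?v \<noteq> 0" using assms by simp
  then have "(?v + 1 / ?v)\<^sup>2 - 2 = ?v\<^sup>2 + 1 / ?v\<^sup>2"
    by (simp add: field_simps power2_eq_square)
  moreover have "w ^ (2 ^ Suc j) = ?v\<^sup>2"
    by (simp add: power_mult[symmetric] mult.commute)
  ultimately show ?case using Suc by simp
qed simp

text \<open>Write z = w + 1/w with |w| \<ge> 1. If |w| = 1, then z = 2 Re w lies in [-2,2];
  otherwise |w| > 1 and w^(2^j) dominates its reciprocal.\<close>

lemma chebyshev_iterate_escapes:
  fixes z :: complex
  assumes "z \<notin> complex_of_real ` {-2..2}"
  obtains j where "3 < norm (((\<lambda>z. z\<^sup>2 - 2) ^^ j) z)"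
proof -
  have "\<exists>w. w \<noteq> 0 \<and> z = w + 1 / w"
  proof -
    \<comment> \<open>A root of w^2 - z w + 1, which is the equation z = w + 1/w cleared of
      denominators.\<close>
    define w where "w = z / 2 + csqrt (z\<^sup>2 - 4) / 2"
    have "2 * w - z = csqrt (z\<^sup>2 - 4)" by (simp add: w_def distrib_left)
    then have "(2 * w - z)\<^sup>2 = z\<^sup>2 - 4" by (metis power2_csqrt)
    then have "4 * (w * w + 1) = 4 * (z * w)" by (simp add: power2_eq_square algebra_simps)
    then have *: "w * w + 1 = z * w" by (metis mult_left_cancel zero_neq_numeral)
    then have "w \<noteq> 0" by auto
    with * show ?thesis by (intro exI[of _ w]) (auto simp: field_simps)
  qed
  then obtain w0 where w0: "w0 \<noteq> 0" "z = w0 + 1 / w0" by blast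
  define w where "w = (if norm w0 \<ge> 1 then w0 else 1 / w0)"
  have w: "w \<noteq> 0" "z = w + 1 / w" "norm w \<ge> 1"
    using w0 by (auto simp: w_def norm_divide)
  have "norm w \<noteq> 1"
  proof
    assume "norm w = 1"
    then have "1 / w = cnj w" by (simp add: divide_conv_cnj)
    then have "z = complex_of_real (2 * Re w)" using w by (simp add: complex_add_cnj)
    moreover have "\<bar>Re w\<bar> \<le> 1" using abs_Re_le_cmod[of w] \<open>norm w = 1\<close> by simp
    then have "2 * Re w \<in> {-2..2}" by auto
    ultimately show False using assms by blast
  qed
  with w have w1: "norm w > 1" by simp
  \<comment> \<open>The reciprocal of the power has norm at most 1, so more than 3 remains after
    subtracting it.\<close>
  obtain j where j: "4 < norm w ^ j" using real_arch_pow[OF w1] by blast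
  have "norm w ^ j \<le> norm w ^ (2 ^ j)"
    using w1 by (intro power_increasing) (auto intro: less_imp_le less_exp)
  with j have j': "4 < norm (w ^ (2 ^ j))" by (simp add: norm_power)
  have "norm (1 / w ^ (2 ^ j)) \<le> 1"
    using j' by (simp add: norm_divide divide_le_eq_1)
  moreover have "norm (w ^ (2 ^ j)) - norm (1 / w ^ (2 ^ j)) \<le> norm (w ^ (2 ^ j) + 1 / w ^ (2 ^ j))"
    by (metis norm_diff_ineq)
  ultimately have "3 < norm (w ^ (2 ^ j) + 1 / w ^ (2 ^ j))" using j' by linarith
  then show ?thesis using that joukowski_iterate[OF w(1), of j] w(2) by metis
qed

text \<open>The escape region is forward invariant, so the sets of points that have escaped after j
  steps increase with j.\<close>

lemma norm_square_minus_two_gt: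
  fixes z :: complex
  assumes "3 < norm z"
  shows "3 < norm (z\<^sup>2 - 2)"
proof -
  have "norm z * norm z > 3 * 3" using assms by (intro mult_strict_mono) auto
  then show ?thesis
    using norm_triangle_ineq2[of "z\<^sup>2" 2] by (simp add: norm_mult power2_eq_square)
qed

text \<open>An affine map \<open>l\<close> carries [a,b] onto [-2,2], which z^2 - 2 maps into
  itself, so all iterates stay within 2 there. Each point off the interval eventually exceeds 3 and
  never returns; compactness of C then yields one iterate for all its points. The gap between 2 and
  3 is what produces geometric convergence later.\<close>

lemma polynomial_separating_interval:
  fixes a b :: real
  assumes "a < b" "compact C" "C \<inter> complex_of_real ` {a..b} = {}"
  obtains T :: "complex poly"
  where "\<And>z. z \<in> C \<Longrightarrow> 3 < norm (poly T z)"
    and "\<And>x. x \<in> {a..b} \<Longrightarrow> norm (poly T (complex_of_real x)) \<le> 2"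
proof -
  define l :: "complex poly" where "l = smult (of_real (4 / (b - a))) [:- of_real ((a + b) / 2), 1:]"
  define T where "T j = ((\<lambda>p. p\<^sup>2 - [:2:]) ^^ j) l" for j
  let ?phi = "\<lambda>z::complex. z\<^sup>2 - 2"
  have T: "poly (T j) z = (?phi ^^ j) (poly l z)" for j z
    by (induction j) (auto simp: T_def)
  have l: "poly l z = of_real (4 / (b - a)) * (z - of_real ((a + b) / 2))" for z
  proof -
    have "poly (smult k [:- m, 1:]) z = k * (z - m)" for k m by (simp add: algebra_simps)
    then show ?thesis unfolding l_def .
  qed
  have lx: "poly l (of_real x) = of_real (4 / (b - a) * (x - (a + b) / 2))" for x
    unfolding l by simp
  have mono: "3 < norm (poly (T k) z)" if "3 < norm (poly (T j) z)" "j \<le> k" for j k z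
    using that(2)
  proof (induction rule: dec_induct)
    case (step n)
    then show ?case using norm_square_minus_two_gt by (simp add: T)
  qed (use that in simp)
  have esc: "\<exists>j. 3 < norm (poly (T j) z)" if "z \<in> C" for z
  proof -
    have "poly l z \<notin> complex_of_real ` {-2..2}"
    proof
      assume "poly l z \<in> complex_of_real ` {-2..2}"
      then obtain y where y: "y \<in> {-2..2}" "poly l z = of_real y" by auto
      define x where "x = (a + b) / 2 + y * (b - a) / 4"
      have "z = of_real x"
      proof -
        have "poly l z = poly l (of_real x)"
          unfolding lx y(2) using assms(1) by (simp add: x_def)
        then show ?thesis using assms(1) unfolding l by simp
      qed
      moreover have "x \<in> {a..b}"
      proof -
        have "0 \<le> (y + 2) * (b - a)" "0 \<le> (2 - y) * (b - a)"
          using y(1) assms(1) by auto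
        moreover have "4 * (x - a) = (y + 2) * (b - a)" "4 * (b - x) = (2 - y) * (b - a)"
          by (simp_all add: x_def algebra_simps add_divide_distrib diff_divide_distrib)
        ultimately show ?thesis by auto
      qed
      ultimately show False using assms(3) that by blast
    qed
    then show ?thesis using chebyshev_iterate_escapes T by metis
  qed
  have "\<exists>j. \<forall>z\<in>C. 3 < norm (poly (T j) z)"
  proof -
    define O' where "O' j = {z. 3 < norm (poly (T j) z)}" for j
    have op: "open (O' j)" for j unfolding O'_def
      by (intro open_Collect_less continuous_intros)
    have "C \<subseteq> (\<Union>j\<in>UNIV. O' j)" using esc by (auto simp: O'_def)
    then obtain J where J: "finite J" "C \<subseteq> (\<Union>j\<in>J. O' j)"
      using compactE_image[OF assms(2), of UNIV O'] op by auto
    then have "\<forall>z\<in>C. 3 < norm (poly (T (Max (insert 0 J))) z)"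
    proof (intro ballI)
      fix z assume "z \<in> C"
      then obtain j where "j \<in> J" "3 < norm (poly (T j) z)" using J by (auto simp: O'_def)
      then show "3 < norm (poly (T (Max (insert 0 J))) z)"
        using J(1) mono[of j z "Max (insert 0 J)"] by simp
    qed
    then show ?thesis by blast
  qed
  then obtain j where j: "\<And>z. z \<in> C \<Longrightarrow> 3 < norm (poly (T j) z)" by blast
  have real: "\<exists>y\<in>{-2..2}. poly (T j) (of_real x) = of_real y" if "x \<in> {a..b}" for x j
  proof (induction j)
    case 0
    have "4 / (b - a) * (x - (a + b) / 2) \<in> {-2..2}"
      using that assms(1) by (auto simp: field_simps)
    moreover have "poly (T 0) (of_real x) = of_real (4 / (b - a) * (x - (a + b) / 2))"
      unfolding T using lx by simp
    ultimately show ?case by blast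
  next
    case (Suc j)
    then obtain y where y: "y \<in> {-2..2}" "poly (T j) (of_real x) = of_real y" by auto
    have "y\<^sup>2 \<le> 2\<^sup>2" using y(1) by (intro abs_le_square_iff[THEN iffD1]) auto
    then have "y\<^sup>2 - 2 \<in> {-2..2}" by auto
    moreover have "poly (T (Suc j)) (of_real x) = of_real (y\<^sup>2 - 2)"
      using y(2) by (simp add: T)
    ultimately show ?case by blast
  qed
  have "norm (poly (T j) (complex_of_real x)) \<le> 2" if "x \<in> {a..b}" for x
    using real[OF that, of j] by auto
  with j show ?thesis using that by blast
qed

text \<open>Used with c = F(\<zeta>), d = \<zeta> - z, s = T(z) and t = T(\<zeta>): one step of the
  expansion of the Cauchy kernel, in which (t - s)/d becomes a polynomial in z.\<close>

lemma telescope_identity: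
  fixes c d s t :: complex
  assumes "d \<noteq> 0" "t \<noteq> 0"
  shows "c / d * (s / t) ^ m - c / d * (s / t) ^ Suc m = c * s ^ m / t ^ (m + 1) * ((t - s) / d)"
proof -
  have "c / d * (s / t) ^ m - c / d * (s / t) ^ Suc m = c / d * (s / t) ^ m * (1 - s / t)"
    by (simp add: right_diff_distrib)
  also have "1 - s / t = (t - s) / t"
    using assms by (simp add: diff_divide_distrib)
  finally show ?thesis by (simp add: power_divide)
qed

text \<open>Cauchy's formula with 1/(\<zeta> - z) expanded as the sum over m of T(z)^m /
  T(\<zeta>)^(m+1) times (T(\<zeta>) - T(z)) / (\<zeta> - z). The last quotient is a polynomial in z
  with powers below D = deg T, so the m-th term is \<open>T ^ m\<close> times a polynomial whose
  coefficients are contour integrals. This gives both the degree bound and, from the sizes of T on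
  the contour and near the interval, the decay.\<close>

lemma polynomial_series_near_interval:
  fixes F :: "complex \<Rightarrow> complex" and a b :: real
  assumes "a < b" and U: "open U" "complex_of_real ` {a..b} \<subseteq> U" and F: "F holomorphic_on U"
  obtains Q :: "nat \<Rightarrow> complex poly" and D :: nat and C \<theta> \<eta> :: real
  where "0 < \<eta>" "0 \<le> C" "0 < \<theta>" "\<theta> < 1" "\<And>m. degree (Q m) \<le> D * (m + 1)"
    and "\<And>m x z. x \<in> {a..b} \<Longrightarrow> z \<in> ball (complex_of_real x) \<eta> \<Longrightarrow> norm (poly (Q m) z) \<le> C * \<theta> ^ m"
    and "\<And>x z. x \<in> {a..b} \<Longrightarrow> z \<in> ball (complex_of_real x) \<eta> \<Longrightarrow> (\<lambda>m. poly (Q m) z) sums F z"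
proof -
  let ?K = "complex_of_real ` {a..b}"
  have K: "compact ?K" by (intro compact_continuous_image continuous_intros) auto
  obtain e where e: "e > 0" "(\<Union>k\<in>?K. ball k e) \<subseteq> U"
    using compact_subset_open_imp_ball_epsilon_subset[OF K U] by blast
  \<comment> \<open>Points of W differ from the interval by less than e/2 in each coordinate, hence
    by less than e. The contour, at distance parameter e/4, then runs inside the convex set W, as
    Cauchy's formula requires.\<close>
  define W where "W = box (Complex (a - e/2) (-e/2)) (Complex (b + e/2) (e/2))"
  have W: "open W" "convex W" "bounded W" by (auto simp: W_def)
  have "W \<subseteq> U"
  proof
    fix z assume "z \<in> W"
    then have z: "a - e/2 < Re z" "Re z < b + e/2" "\<bar>Im z\<bar> < e/2"
      by (auto simp: W_def in_box_complex_iff)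
    define x where "x = max a (min b (Re z))"
    have x: "x \<in> {a..b}" "\<bar>x - Re z\<bar> < e/2" using assms(1) z e(1) by (auto simp: x_def max_def min_def)
    have "norm (of_real x - z) \<le> \<bar>x - Re z\<bar> + \<bar>Im z\<bar>"
      using cmod_le[of "of_real x - z"] by simp
    then have "z \<in> ball (of_real x) e" using x z by (simp add: dist_norm)
    then show "z \<in> U" using e(2) x(1) by blast
  qed
  then have FW: "F holomorphic_on W" using F holomorphic_on_subset by blast
  define a1 a3 where "a1 = Complex (a - e/4) (-e/4)" and "a3 = Complex (b + e/4) (e/4)"
  define g where "g = rectpath a1 a3"
  have a13: "Re a1 \<le> Re a3" "Im a1 \<le> Im a3" using assms(1) e(1) by (auto simp: a1_def a3_def)
  have img: "path_image g = cbox a1 a3 - box a1 a3"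
    using path_image_rectpath_cbox_minus_box[OF a13] by (simp add: g_def)
  have cimg: "compact (path_image g)" by (simp add: g_def compact_path_image)
  have gW: "path_image g \<subseteq> W"
    using e(1) by (auto simp: img W_def a1_def a3_def in_box_complex_iff in_cbox_complex_iff)
  have KB: "?K \<subseteq> box a1 a3"
    using e(1) by (auto simp: a1_def a3_def in_box_complex_iff)
  obtain T :: "complex poly" where T: "\<And>z. z \<in> path_image g \<Longrightarrow> 3 < norm (poly T z)"
     "\<And>x. x \<in> {a..b} \<Longrightarrow> norm (poly T (complex_of_real x)) \<le> 2"
    using polynomial_separating_interval[OF assms(1) cimg] KB img by blast
  define D where "D = degree T"
  \<comment> \<open>The coefficient of z^j in (T(\<zeta>) - T(z)) / (\<zeta> - z).\<close>
  define t where "t j \<zeta> = (\<Sum>k = Suc j..D. coeff T k * \<zeta> ^ (k - Suc j))" for j \<zeta>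
  have tdiff: "poly T \<zeta> - poly T z = (\<zeta> - z) * (\<Sum>j<D. t j \<zeta> * z ^ j)" for \<zeta> z
  proof -
    have "poly T z - poly T \<zeta> = (z - \<zeta>) * (\<Sum>j<D. t j \<zeta> * z ^ j)"
      unfolding poly_altdef D_def[symmetric] sub_polyfun t_def by (simp add: sum_distrib_right)
    then show ?thesis by (simp add: algebra_simps)
  qed
  have t_holo: "t j holomorphic_on A" for j A unfolding t_def by (intro holomorphic_intros)
  define G where "G j \<zeta> = F \<zeta> * t j \<zeta>" for j \<zeta>
  have Gh: "G j holomorphic_on W" for j unfolding G_def by (intro holomorphic_intros FW t_holo)
  have Th: "poly T holomorphic_on A" for A
    by (intro holomorphic_intros)
  have "\<exists>B. \<forall>\<zeta>\<in>path_image g. norm (f \<zeta>) < B" if "f holomorphic_on W" for f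
  proof -
    have "continuous_on (path_image g) f"
      using holomorphic_on_imp_continuous_on[OF that] gW continuous_on_subset by blast
    then have "bounded (f ` path_image g)" using cimg compact_continuous_image compact_imp_bounded by blast
    then obtain B where "\<forall>x\<in>f ` path_image g. norm x \<le> B" by (auto simp: bounded_iff)
    then show ?thesis by (intro exI[of _ "B + 1"]) force
  qed
  note bd = this
  obtain B0 where B0: "\<forall>\<zeta>\<in>path_image g. norm (F \<zeta>) < B0" using bd[OF FW] by blast
  have "\<forall>j. \<exists>B. \<forall>\<zeta>\<in>path_image g. norm (G j \<zeta>) < B" using bd[OF Gh] by blast
  then obtain BG where BG: "\<And>j \<zeta>. \<zeta>\<in>path_image g \<Longrightarrow> norm (G j \<zeta>) < BG j" by metis
  \<comment> \<open>An open neighbourhood of the contour on which all its strict bounds persist: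
    \<open>contour_integral_bound_exists\<close> compares integrals with bounds on an open set, by a
    factor that does not depend on the integrand.\<close>
  define S0 where "S0 = {\<zeta>\<in>W. 3 < norm (poly T \<zeta>)} \<inter> {\<zeta>\<in>W. norm (F \<zeta>) < B0} \<inter> (\<Inter>j<D. {\<zeta>\<in>W. norm (G j \<zeta>) < BG j})"
  have less_open: "open {\<zeta>\<in>W. norm (f \<zeta>) < c}" if "f holomorphic_on W" for f and c::real
  proof -
    have "open (W \<inter> (\<lambda>\<zeta>. norm (f \<zeta>)) -` {..<c})"
      using holomorphic_on_imp_continuous_on[OF that]
      by (intro continuous_open_preimage continuous_intros W) auto
    then show ?thesis by (simp add: vimage_def Int_def)
  qed
  have "open {\<zeta>\<in>W. 3 < norm (poly T \<zeta>)}"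
  proof -
    have "open (W \<inter> {\<zeta>. 3 < norm (poly T \<zeta>)})"
      by (intro open_Int W open_Collect_less continuous_intros)
    then show ?thesis by (simp add: Int_def)
  qed
  then have "open S0" unfolding S0_def by (intro open_Int open_INT ballI less_open[OF FW] less_open[OF Gh]) auto
  have gS0: "path_image g \<subseteq> S0" using gW T(1) B0 BG by (auto simp: S0_def)
  have S0W: "S0 \<subseteq> W" by (auto simp: S0_def)
  have vg: "valid_path g" by (simp add: g_def)
  obtain L where L: "L > 0" "\<And>f B. f holomorphic_on S0 \<Longrightarrow> (\<And>z. z \<in> S0 \<Longrightarrow> norm (f z) \<le> B) \<Longrightarrow> norm (contour_integral g f) \<le> L * B"
    using contour_integral_bound_exists[OF \<open>open S0\<close> vg gS0] by blast
  define A where "A m j = contour_integral g (\<lambda>\<zeta>. G j \<zeta> / poly T \<zeta> ^ (m + 1)) / (2 * pi * \<i>)" for m j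
  have TS0: "norm (poly T \<zeta>) > 3" if "\<zeta> \<in> S0" for \<zeta> using that by (auto simp: S0_def)
  then have TS0': "poly T \<zeta> \<noteq> 0" if "\<zeta> \<in> S0" for \<zeta> using that by fastforce
  have Ah: "(\<lambda>\<zeta>. G j \<zeta> / poly T \<zeta> ^ (m + 1)) holomorphic_on S0" for j m
    using TS0' holomorphic_on_subset[OF Gh S0W] by (intro holomorphic_intros Th) auto
  have BG0: "BG j \<ge> 0" for j
  proof -
    have "path_image g \<noteq> {}" by simp
    then show ?thesis using BG[of _ j] norm_ge_zero by (metis ex_in_conv less_le_not_le linorder_le_cases order_trans)
  qed
  have Abd: "norm (A m j) \<le> L * BG j * (1/3) ^ m" if "j < D" for m j
  proof -
    have "norm (contour_integral g (\<lambda>\<zeta>. G j \<zeta> / poly T \<zeta> ^ (m + 1))) \<le> L * (BG j / 3 ^ (m + 1))"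
    proof (rule L(2)[OF Ah])
      fix \<zeta> assume z: "\<zeta> \<in> S0"
      have "\<zeta> \<in> {\<zeta> \<in> W. norm (G j \<zeta>) < BG j}" using z that unfolding S0_def by blast
      then have "norm (G j \<zeta>) \<le> BG j" by simp
      moreover have "3 ^ (m + 1) \<le> norm (poly T \<zeta>) ^ (m + 1)"
        using TS0[OF z] by (intro power_mono) auto
      ultimately show "norm (G j \<zeta> / poly T \<zeta> ^ (m + 1)) \<le> BG j / 3 ^ (m + 1)"
        unfolding norm_divide norm_power using BG0 by (intro frac_le) auto
    qed
    also have "\<dots> \<le> L * BG j * (1/3) ^ m"
      using L(1) BG0[of j] by (simp add: field_simps)
    finally have 1: "norm (contour_integral g (\<lambda>\<zeta>. G j \<zeta> / poly T \<zeta> ^ (m + 1))) \<le> L * BG j * (1/3) ^ m" .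
    have "norm (A m j) = norm (contour_integral g (\<lambda>\<zeta>. G j \<zeta> / poly T \<zeta> ^ (m + 1))) / (2 * pi)"
      by (simp add: A_def norm_divide norm_mult)
    also have "\<dots> \<le> norm (contour_integral g (\<lambda>\<zeta>. G j \<zeta> / poly T \<zeta> ^ (m + 1))) / 1"
      using pi_gt3 by (intro divide_left_mono) auto
    finally show ?thesis using 1 by simp
  qed
  define P where "P m = (\<Sum>j<D. monom (A m j) j)" for m
  define Q where "Q m = T ^ m * P m" for m
  have Pz: "poly (P m) z = (\<Sum>j<D. A m j * z ^ j)" for m z by (simp add: P_def poly_sum poly_monom)
  have degP: "degree (P m) \<le> D" for m
    unfolding P_def by (intro degree_sum_le) (auto intro: order.trans[OF degree_monom_le])
  have deg: "degree (Q m) \<le> D * (m + 1)" for m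
  proof -
    have "degree (Q m) \<le> degree (T ^ m) + degree (P m)" unfolding Q_def by (rule degree_mult_le)
    also have "\<dots> \<le> D * m + D" using degP[of m] degree_power_le[of T m] by (simp add: D_def)
    finally show ?thesis by simp
  qed
  \<comment> \<open>The value 5/2 lies strictly between the bound 2 on the interval and the bound 3
    on the contour, so V is a neighbourhood of the interval and (5/2)/3 = 5/6 is below 1.\<close>
  define V where "V = box a1 a3 \<inter> {z. norm (poly T z) < 5/2}"
  have "open V" unfolding V_def by (intro open_Int open_Collect_less continuous_intros) auto
  moreover have "?K \<subseteq> V" using KB T(2) by (force simp: V_def)
  ultimately obtain \<eta> where \<eta>: "\<eta> > 0" "(\<Union>k\<in>?K. ball k \<eta>) \<subseteq> V"
    using compact_subset_open_imp_ball_epsilon_subset[OF K] by blast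
  obtain R where R: "\<And>z. z \<in> box a1 a3 \<Longrightarrow> norm z \<le> R"
    using bounded_box[of a1 a3] by (auto simp: bounded_iff)
  define C where "C = (\<Sum>j<D. L * BG j * (max R 0) ^ j)"
  have "C \<ge> 0" unfolding C_def using L(1) BG0 by (intro sum_nonneg mult_nonneg_nonneg) auto
  have Qbd: "norm (poly (Q m) z) \<le> C * (5/6) ^ m" if "z \<in> V" for m z
  proof -
    have "norm (poly (P m) z) \<le> (\<Sum>j<D. norm (A m j * z ^ j))" unfolding Pz by (rule norm_sum)
    also have "\<dots> \<le> (\<Sum>j<D. (L * BG j * (1/3) ^ m) * (max R 0) ^ j)"
    proof (intro sum_mono)
      fix j assume "j \<in> {..<D}"
      have "norm z \<le> max R 0" using R that by (force simp: V_def)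
      then show "norm (A m j * z ^ j) \<le> (L * BG j * (1/3) ^ m) * (max R 0) ^ j"
        unfolding norm_mult norm_power using L(1) BG0 \<open>j \<in> {..<D}\<close>
        by (intro mult_mono Abd power_mono) auto
    qed
    also have "\<dots> = C * (1/3) ^ m"
      unfolding C_def sum_distrib_right by (intro sum.cong) (auto simp: mult_ac)
    finally have "norm (poly (P m) z) \<le> C * (1/3) ^ m" .
    moreover have "norm (poly T z) ^ m \<le> (5/2) ^ m" using that by (intro power_mono) (auto simp: V_def)
    ultimately have "norm (poly (Q m) z) \<le> (5/2) ^ m * (C * (1/3) ^ m)"
      unfolding Q_def poly_mult norm_mult poly_power norm_power by (intro mult_mono) auto
    also have "\<dots> = C * (5/6) ^ m" by (simp add: power_mult_distrib[symmetric] mult_ac flip: power_mult_distrib)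
    finally show ?thesis .
  qed
  have Qsums: "(\<lambda>m. poly (Q m) z) sums F z" if "z \<in> V" for z
  proof -
    have zb: "z \<in> box a1 a3" and Tz: "norm (poly T z) < 5/2" using that by (auto simp: V_def)
    have zW: "z \<in> W" using zb e(1) by (auto simp: W_def a1_def a3_def in_box_complex_iff)
    have zg: "z \<notin> path_image g" using zb img by blast
    \<comment> \<open>The remainder after m terms: E 0 is F(z) by Cauchy's formula, consecutive
      differences are the terms of the series, and E m tends to 0 like (5/6)^m.\<close>
    define E where "E m = contour_integral g (\<lambda>\<zeta>. F \<zeta> / (\<zeta> - z) * (poly T z / poly T \<zeta>) ^ m) / (2 * pi * \<i>)" for m
    obtain d where d: "d > 0" "\<And>\<zeta>. \<zeta> \<in> path_image g \<Longrightarrow> d \<le> dist z \<zeta>"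
      using separate_point_closed[OF compact_imp_closed[OF cimg] zg] by auto
    \<comment> \<open>Removing a disc about z excludes the pole and bounds the kernel by 2/d, while
      the contour, at distance at least d from z, stays inside.\<close>
    define S1 where "S1 = S0 - cball z (d/2)"
    have S1: "open S1" "path_image g \<subseteq> S1" "S1 \<subseteq> S0"
      using \<open>open S0\<close> gS0 d by (auto simp: S1_def open_Diff) (smt (verit) d(2) field_sum_of_halves)
    obtain L1 where L1: "L1 > 0" "\<And>f B. f holomorphic_on S1 \<Longrightarrow> (\<And>z. z \<in> S1 \<Longrightarrow> norm (f z) \<le> B) \<Longrightarrow> norm (contour_integral g f) \<le> L1 * B"
      using contour_integral_bound_exists[OF S1(1) vg S1(2)] by blast
    have zS1: "d/2 < norm (\<zeta> - z)" if "\<zeta> \<in> S1" for \<zeta> using that by (auto simp: S1_def dist_norm norm_minus_commute)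
    have z_ne: "\<zeta> - z \<noteq> 0" if "\<zeta> \<in> S1" for \<zeta> using zS1[OF that] d(1) by auto
    have Eh: "(\<lambda>\<zeta>. F \<zeta> / (\<zeta> - z) * (poly T z / poly T \<zeta>) ^ m) holomorphic_on S1" for m
      using TS0' S1(3) z_ne holomorphic_on_subset[OF FW] S0W
      by (intro holomorphic_intros Th) auto
    have Ei: "(\<lambda>\<zeta>. F \<zeta> / (\<zeta> - z) * (poly T z / poly T \<zeta>) ^ m) contour_integrable_on g" for m
      by (rule contour_integrable_holomorphic_simple[OF Eh S1(1) vg S1(2)])
    have Ai: "(\<lambda>\<zeta>. G j \<zeta> / poly T \<zeta> ^ (m + 1)) contour_integrable_on g" for j m
      by (rule contour_integrable_holomorphic_simple[OF Ah \<open>open S0\<close> vg gS0])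
    have E0: "E 0 = F z"
    proof -
      have "((\<lambda>w. F w / (w - z)) has_contour_integral (2 * pi * \<i> * winding_number g z * F z)) g"
        using W FW zW vg gW zg
        by (intro Cauchy_integral_formula_convex_simple[OF W(2)]) (auto simp: interior_open g_def)
      moreover have "winding_number g z = 1" unfolding g_def by (rule winding_number_rectpath[OF zb])
      ultimately have "contour_integral g (\<lambda>w. F w / (w - z)) = 2 * pi * \<i> * F z"
        by (simp add: contour_integral_unique)
      then show ?thesis by (simp add: E_def)
    qed
    have step: "poly (Q m) z = E m - E (Suc m)" for m
    proof -
      have "contour_integral g (\<lambda>\<zeta>. F \<zeta> / (\<zeta> - z) * (poly T z / poly T \<zeta>) ^ m - F \<zeta> / (\<zeta> - z) * (poly T z / poly T \<zeta>) ^ Suc m)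
          = contour_integral g (\<lambda>\<zeta>. \<Sum>j<D. (poly T z ^ m * z ^ j) * (G j \<zeta> / poly T \<zeta> ^ (m + 1)))"
      proof (rule contour_integral_eq)
        fix \<zeta> assume "\<zeta> \<in> path_image g"
        then have nz: "\<zeta> - z \<noteq> 0" "poly T \<zeta> \<noteq> 0" using z_ne S1 TS0' by blast+
        have "F \<zeta> / (\<zeta> - z) * (poly T z / poly T \<zeta>) ^ m - F \<zeta> / (\<zeta> - z) * (poly T z / poly T \<zeta>) ^ Suc m
            = F \<zeta> * poly T z ^ m / poly T \<zeta> ^ (m + 1) * ((poly T \<zeta> - poly T z) / (\<zeta> - z))"
          using telescope_identity[OF nz] .
        also have "(poly T \<zeta> - poly T z) / (\<zeta> - z) = (\<Sum>j<D. t j \<zeta> * z ^ j)"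
          using nz unfolding tdiff by simp
        finally show "F \<zeta> / (\<zeta> - z) * (poly T z / poly T \<zeta>) ^ m - F \<zeta> / (\<zeta> - z) * (poly T z / poly T \<zeta>) ^ Suc m
            = (\<Sum>j<D. (poly T z ^ m * z ^ j) * (G j \<zeta> / poly T \<zeta> ^ (m + 1)))"
          by (simp add: sum_distrib_left sum_divide_distrib G_def mult_ac)
      qed
      also have "\<dots> = (\<Sum>j<D. (poly T z ^ m * z ^ j) * contour_integral g (\<lambda>\<zeta>. G j \<zeta> / poly T \<zeta> ^ (m + 1)))"
        by (subst contour_integral_sum)
           (use contour_integrable_lmul[OF Ai] contour_integral_lmul[OF Ai] in \<open>simp_all only: finite_lessThan\<close>)
      finally have eq: "contour_integral g (\<lambda>\<zeta>. F \<zeta> / (\<zeta> - z) * (poly T z / poly T \<zeta>) ^ m - F \<zeta> / (\<zeta> - z) * (poly T z / poly T \<zeta>) ^ Suc m)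
          = (\<Sum>j<D. (poly T z ^ m * z ^ j) * contour_integral g (\<lambda>\<zeta>. G j \<zeta> / poly T \<zeta> ^ (m + 1)))" .
      have "E m - E (Suc m) = (\<Sum>j<D. (poly T z ^ m * z ^ j) * contour_integral g (\<lambda>\<zeta>. G j \<zeta> / poly T \<zeta> ^ (m + 1))) / (2 * pi * \<i>)"
        unfolding eq[symmetric] contour_integral_diff[OF Ei Ei] by (simp only: E_def diff_divide_distrib)
      also have "\<dots> = poly (Q m) z"
        by (simp only: Q_def poly_mult Pz poly_power A_def sum_distrib_left sum_divide_distrib mult.assoc
             times_divide_eq_right times_divide_eq_left mult.left_commute mult.commute)
      finally show ?thesis ..
    qed
    have "(\<lambda>m. E m) \<longlonglongrightarrow> 0"
    proof (rule Lim_null_comparison)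
      show "\<forall>\<^sub>F m in sequentially. norm (E m) \<le> L1 * (B0 / (d/2)) * (5/6) ^ m"
      proof (intro always_eventually allI)
        fix m
        have B00: "B0 \<ge> 0" if "\<zeta> \<in> S0" for \<zeta> using that norm_ge_zero[of "F \<zeta>"] unfolding S0_def by (auto simp del: norm_ge_zero)
        have "norm (contour_integral g (\<lambda>\<zeta>. F \<zeta> / (\<zeta> - z) * (poly T z / poly T \<zeta>) ^ m)) \<le> L1 * (B0 / (d/2) * (5/6) ^ m)"
        proof (rule L1(2)[OF Eh])
          fix \<zeta> assume s: "\<zeta> \<in> S1"
          then have "norm (F \<zeta>) \<le> B0" using S1(3) by (auto simp: S0_def)
          moreover have "norm (poly T z / poly T \<zeta>) \<le> (5/2) / 3"
            unfolding norm_divide using Tz TS0[of \<zeta>] s S1(3) by (intro frac_le) auto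
          ultimately show "norm (F \<zeta> / (\<zeta> - z) * (poly T z / poly T \<zeta>) ^ m) \<le> B0 / (d/2) * (5/6) ^ m"
            unfolding norm_mult norm_power norm_divide[of "F \<zeta>"] using zS1[OF s] d(1) B00[of \<zeta>] s S1(3)
            by (intro mult_mono frac_le power_mono) auto
        qed
        moreover have "norm (E m) = norm (contour_integral g (\<lambda>\<zeta>. F \<zeta> / (\<zeta> - z) * (poly T z / poly T \<zeta>) ^ m)) / (2 * pi)"
          by (simp add: E_def norm_divide norm_mult)
        moreover have "\<dots> \<le> norm (contour_integral g (\<lambda>\<zeta>. F \<zeta> / (\<zeta> - z) * (poly T z / poly T \<zeta>) ^ m)) / 1"
          using pi_gt3 by (intro divide_left_mono) auto
        ultimately show "norm (E m) \<le> L1 * (B0 / (d/2)) * (5/6) ^ m" by simp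
      qed
      show "(\<lambda>m. L1 * (B0 / (d/2)) * (5/6) ^ m) \<longlonglongrightarrow> 0"
        by (intro tendsto_mult_right_zero LIMSEQ_power_zero) auto
    qed
    from telescope_sums'[OF this] show ?thesis by (simp add: step E0)
  qed
  have "z \<in> V" if "x \<in> {a..b}" "z \<in> ball (complex_of_real x) \<eta>" for x z
    using \<eta>(2) that by blast
  note inV = this
  show ?thesis
    by (rule that[OF \<eta>(1) \<open>C \<ge> 0\<close> _ _ deg Qbd[OF inV] Qsums[OF inV]]) auto
qed

text \<open>Choose t with t^(2N+2) = \<theta> and split \<theta>^m as (t^m)^N (t^m)^(N+2). The first
  factor absorbs the N-th power, because (1 + a(m+1)) t^m is bounded; the second is at most t^m and
  keeps the series summable.\<close>

lemma summable_power_mult_geometric: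
  fixes a \<theta> :: real
  assumes "0 < \<theta>" "\<theta> < 1" "0 \<le> a"
  shows "summable (\<lambda>m. (1 + a * real (m + 1)) ^ N * \<theta> ^ m)"
proof -
  define n where "n = real (2 * Suc N)"
  define t where "t = \<theta> powr (1 / n)"
  have t: "0 < t" "t < 1" using assms using powr_less_mono2[of "1 / n" \<theta> 1] by (auto simp: t_def n_def)
  have tn: "t ^ (2 * Suc N) = \<theta>"
  proof -
    have "t ^ (2 * Suc N) = t powr n" unfolding n_def by (rule powr_realpow[symmetric, OF t(1)])
    also have "\<dots> = \<theta>" using assms by (simp add: t_def powr_powr n_def)
    finally show ?thesis .
  qed
  have "(\<lambda>m. real m * t ^ m) \<longlonglongrightarrow> 0" using powser_times_n_limit_0[of t] t by simp
  moreover have "(\<lambda>m. t ^ m) \<longlonglongrightarrow> 0" using t by (intro LIMSEQ_power_zero) auto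
  ultimately have "(\<lambda>m. (1 + a) * t ^ m + a * (real m * t ^ m)) \<longlonglongrightarrow> (1 + a) * 0 + a * 0"
    by (rule tendsto_add[OF tendsto_mult_left tendsto_mult_left, rotated])
  then have "Bseq (\<lambda>m. (1 + a) * t ^ m + a * (real m * t ^ m))" by (intro convergent_imp_Bseq convergentI)
  then obtain B where B: "\<And>m. norm ((1 + a) * t ^ m + a * (real m * t ^ m)) \<le> B" by (auto simp: Bseq_def)
  have b: "(1 + a * real (m + 1)) * t ^ m \<le> B" "0 \<le> (1 + a * real (m + 1)) * t ^ m" for m
  proof -
    have "(1 + a * real (m + 1)) * t ^ m = (1 + a) * t ^ m + a * (real m * t ^ m)" by (simp add: algebra_simps)
    then show "(1 + a * real (m + 1)) * t ^ m \<le> B" using B[of m] by (simp add: abs_le_iff)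
    show "0 \<le> (1 + a * real (m + 1)) * t ^ m" using t assms by simp
  qed
  show ?thesis
  proof (rule summable_comparison_test')
    show "summable (\<lambda>m. B ^ N * t ^ m)" using t by (intro summable_mult summable_geometric) auto
    fix m :: nat assume "0 \<le> m"
    have "\<theta> ^ m = (t ^ m) ^ N * (t ^ m) ^ (N + 2)"
      unfolding tn[symmetric] power_mult[symmetric] power_add[symmetric]
      by (rule arg_cong[of _ _ "\<lambda>k. t ^ k"]) (simp add: algebra_simps)
    then have "(1 + a * real (m + 1)) ^ N * \<theta> ^ m = ((1 + a * real (m + 1)) * t ^ m) ^ N * (t ^ m) ^ (N + 2)"
      by (simp add: power_mult_distrib)
    also have "\<dots> \<le> B ^ N * t ^ m"
    proof (rule mult_mono)
      show "((1 + a * real (m + 1)) * t ^ m) ^ N \<le> B ^ N" using b by (intro power_mono) auto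
      have "t ^ m \<le> 1" using t by (simp add: power_le_one)
      then have "(t ^ m) ^ (N + 2) \<le> (t ^ m) ^ 1" using t by (intro power_decreasing) auto
      then show "(t ^ m) ^ (N + 2) \<le> t ^ m" by simp
      show "0 \<le> B ^ N" using b[of 0] by (intro zero_le_power) linarith
    qed (use t in simp)
    finally show "norm ((1 + a * real (m + 1)) ^ N * \<theta> ^ m) \<le> B ^ N * t ^ m"
      using assms by simp
  qed
qed

lemma higher_deriv_poly: "(deriv ^^ n) (poly p) = poly ((pderiv ^^ n) (p :: complex poly))"
proof (induction n)
  case (Suc n)
  have "deriv (poly r) = poly (pderiv r)" for r :: "complex poly"
    by (intro ext DERIV_imp_deriv poly_DERIV)
  then show ?case by (simp add: Suc)
qed simp

lemma poly_holomorphic: "poly p holomorphic_on A" for p :: "complex poly"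
  by (intro holomorphic_intros)

lemma degree_higher_pderiv_le: "degree ((pderiv ^^ n) (p :: complex poly)) \<le> degree p"
  by (induction n) (auto simp: degree_pderiv)

lemma poly_Cauchy_inequality:
  fixes p :: "complex poly"
  assumes "0 < r" "\<And>z. norm (\<zeta> - z) = r \<Longrightarrow> norm (poly p z) \<le> M"
  shows "norm (poly ((pderiv ^^ n) p) \<zeta>) \<le> fact n * M / r ^ n"
  using Cauchy_inequality[where f="poly p" and \<xi>=\<zeta> and r=r and B=M and n=n, OF poly_holomorphic _ assms]
  by (simp add: higher_deriv_poly holomorphic_on_imp_continuous_on[OF poly_holomorphic])

text \<open>For |z| \<ge> \<rho>, z^2 r(z) = p(z) - a - b z has norm at most M (2 + |z|/\<rho>),
  hence at most 3 M |z|^2/\<rho>^2. Inside the disc, where dividing by z^2 would lose control, the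
  maximum principle carries the bound over from the circle.\<close>

lemma poly_remainder_bound:
  fixes r :: "complex poly"
  assumes rho: "0 < \<rho>" and p: "p = pCons a (pCons b r)"
    and M: "\<And>z. norm z \<le> \<rho> \<Longrightarrow> norm (poly p z) \<le> M"
  shows "norm a \<le> M" "norm b \<le> M / \<rho>"
    and "norm (poly p z) \<le> M \<Longrightarrow> norm (poly r z) \<le> 3 * M / \<rho>\<^sup>2"
proof -
  have pz: "poly p z = a + z * (b + z * poly r z)" for z by (simp add: p)
  show a: "norm a \<le> M" using M[of 0] rho by (simp add: pz)
  have M0: "0 \<le> M" using a norm_ge_zero order_trans by blast
  have "norm (poly (pderiv p) 0) \<le> fact 1 * M / \<rho> ^ 1"
    using poly_Cauchy_inequality[OF rho, of 0 p M 1] M by simp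
  moreover have "poly (pderiv p) 0 = b" by (simp add: p pderiv_pCons)
  ultimately show b: "norm b \<le> M / \<rho>" by simp
  have outer: "norm (poly r z) \<le> 3 * M / \<rho>\<^sup>2" if z: "\<rho> \<le> norm z" and Mz: "norm (poly p z) \<le> M" for z
  proof -
    have zpos: "0 < norm z" using z rho by linarith
    have "z\<^sup>2 * poly r z = poly p z - a - b * z" by (simp add: pz power2_eq_square algebra_simps)
    then have "(norm z)\<^sup>2 * norm (poly r z) = norm (poly p z - a - b * z)"
      by (metis norm_mult norm_power)
    also have "\<dots> \<le> norm (poly p z) + norm a + norm b * norm z"
      using norm_triangle_ineq4[of "poly p z - a" "b * z"] norm_triangle_ineq4[of "poly p z" a]
      by (simp add: norm_mult)
    also have "\<dots> \<le> M + M + M / \<rho> * norm z"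
      using Mz a b zpos by (intro add_mono mult_right_mono) auto
    also have "\<dots> \<le> 3 * M / \<rho>\<^sup>2 * (norm z)\<^sup>2"
    proof -
      have q1: "1 \<le> norm z / \<rho>" using z rho by simp
      then have "norm z / \<rho> \<le> (norm z / \<rho>)\<^sup>2" 
        using mult_left_mono[of 1 "norm z / \<rho>" "norm z / \<rho>"] by (simp add: power2_eq_square)
      then have "M * (1 + 1 + norm z / \<rho>) \<le> M * (3 * (norm z / \<rho>)\<^sup>2)"
        using q1 M0 by (intro mult_left_mono) linarith+
      then show ?thesis by (simp add: power_divide algebra_simps)
    qed
    finally have "(norm z)\<^sup>2 * norm (poly r z) \<le> (norm z)\<^sup>2 * (3 * M / \<rho>\<^sup>2)" by (simp add: mult.commute)
    then show ?thesis by (rule mult_left_le_imp_le) (use zpos in simp)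
  qed
  have inner: "norm (poly r z) \<le> 3 * M / \<rho>\<^sup>2" if z: "norm z \<le> \<rho>" for z
  proof (rule maximum_modulus_frontier[of "poly r" "cball 0 \<rho>"])
    show "poly r holomorphic_on interior (cball 0 \<rho>)" by (rule poly_holomorphic)
    show "continuous_on (closure (cball 0 \<rho>)) (poly r)" by (rule holomorphic_on_imp_continuous_on[OF poly_holomorphic])
    show "norm (poly r z) \<le> 3 * M / \<rho>\<^sup>2" if "z \<in> frontier (cball 0 \<rho>)" for z
      using that rho M by (intro outer) auto
  qed (use z in auto)
  show "norm (poly r z) \<le> 3 * M / \<rho>\<^sup>2" if "norm (poly p z) \<le> M"
    using inner outer that by (cases "norm z \<le> \<rho>") auto
qed

context fourier_weight begin

text \<open>With p = a + b z + z^2 r, the constant a goes to the unit and b f is bounded through A.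
  The part f^2 r(f) is band-limited with radius R(d+2), and its L^1 norm is at most 3 M/\<rho>^2
  times the squared L^2 norm of f. The constants do not depend on p, so the estimate may be applied
  to infinitely many polynomials at once.\<close>

lemma ufl_le_poly_band_lim:
  assumes f: "band_lim R f" "0 \<le> R" "fl_le f A" and rho: "0 < \<rho>"
  shows "\<exists>C N. 0 \<le> C \<and> (\<forall>p d M. degree p \<le> d \<longrightarrow> (\<forall>z. norm z \<le> \<rho> \<longrightarrow> norm (poly p z) \<le> M) \<longrightarrow>
    (\<forall>x. norm (poly p (f x)) \<le> M) \<longrightarrow> ufl_le (\<lambda>x. poly p (f x)) (C * (1 + real d) ^ N * M))"
proof -
  obtain C N where C: "0 \<le> C" and CN: "\<And>R f L. 0 \<le> R \<Longrightarrow> band_lim R f \<Longrightarrow> integrable lborel f \<Longrightarrow>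
    (LINT x|lborel. norm (f x)) \<le> L \<Longrightarrow> fl_le f (C * (1 + R) ^ N * L)"
    using fl_le_of_band_lim_integrable by blast
  define I where "I = (LINT x|lborel. (norm (f x))\<^sup>2)"
  have I0: "0 \<le> I" by (simp add: I_def)
  have A0: "0 \<le> A" using fl_le_nonneg[OF f(3)] .
  note [measurable] = band_lim_measurable[OF f(1)]
  \<comment> \<open>One summand for each of the constant, linear and quadratic parts; (1 + 2R)^N
    comes from 1 + R(d+2) \<le> (1+2R)(1+d).\<close>
  define C' where "C' = 1 + A / \<rho> + C * (1 + 2 * R) ^ N * (3 / \<rho>\<^sup>2 * I)"
  have C': "0 \<le> C'" using A0 I0 C f(2) rho by (auto simp: C'_def intro!: add_nonneg_nonneg mult_nonneg_nonneg)
  have "ufl_le (\<lambda>x. poly p (f x)) (C' * (1 + real d) ^ N * M)"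
    if d: "degree p \<le> d" and M: "\<And>z. norm z \<le> \<rho> \<Longrightarrow> norm (poly p z) \<le> M" "\<And>x. norm (poly p (f x)) \<le> M" for p d M
  proof -
    obtain a p' where p': "p = pCons a p'" by (cases p)
    obtain b r where r: "p' = pCons b r" by (cases p')
    have p: "p = pCons a (pCons b r)" using p' r by simp
    have bd: "norm a \<le> M" "norm b \<le> M / \<rho>" "\<And>z. norm (poly p z) \<le> M \<Longrightarrow> norm (poly r z) \<le> 3 * M / \<rho>\<^sup>2"
      using poly_remainder_bound[OF rho p] M(1) by blast+
    have M0: "0 \<le> M" using bd(1) norm_ge_zero order_trans by blast
    have "degree r \<le> degree p" unfolding p by (simp add: degree_pCons_eq_if)
    then have dr: "degree r \<le> d" using d by simp
    let ?g = "\<lambda>x. (f x)\<^sup>2 * poly r (f x)"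
    have g_le: "norm (?g x) \<le> 3 * M / \<rho>\<^sup>2 * (norm (f x))\<^sup>2" for x
    proof -
      have "norm (?g x) = norm (poly r (f x)) * (norm (f x))\<^sup>2" by (simp add: norm_mult norm_power mult.commute)
      also have "\<dots> \<le> 3 * M / \<rho>\<^sup>2 * (norm (f x))\<^sup>2" by (intro mult_right_mono bd(3) M(2)) simp
      finally show ?thesis .
    qed
    have sq: "integrable lborel (\<lambda>x. 3 * M / \<rho>\<^sup>2 * (norm (f x))\<^sup>2)"
      by (rule integrable_mult_right[OF band_lim_square_integrable[OF f(1)]])
    have BLg: "band_lim (R * real (d + 2)) ?g" by (rule band_lim_square_mult_poly[OF f(1,2) dr])
    note [measurable] = band_lim_measurable[OF BLg]
    have gi: "integrable lborel ?g"
    proof (rule Bochner_Integration.integrable_bound[OF sq])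
      show "AE x in lborel. norm (?g x) \<le> norm (3 * M / \<rho>\<^sup>2 * (norm (f x))\<^sup>2)"
        unfolding real_norm_def by (intro AE_I2 order_trans[OF g_le abs_ge_self])
    qed measurable
    have "(LINT x|lborel. norm (?g x)) \<le> (LINT x|lborel. 3 * M / \<rho>\<^sup>2 * (norm (f x))\<^sup>2)"
      by (rule integral_mono[OF integrable_norm[OF gi] sq g_le])
    also have "\<dots> = 3 * M / \<rho>\<^sup>2 * I" by (simp add: I_def)
    finally have "fl_le ?g (C * (1 + R * real (d + 2)) ^ N * (3 * M / \<rho>\<^sup>2 * I))"
      using f(2) by (intro CN[OF _ BLg gi]) auto
    then have u: "ufl_le (\<lambda>x. a + (b * f x + ?g x)) (norm a + (norm b * A + C * (1 + R * real (d + 2)) ^ N * (3 * M / \<rho>\<^sup>2 * I)))"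
      using ufl_le_add[OF ufl_le_const ufl_le_fl_le[OF fl_le_add[OF fl_le_cmult[OF f(3)]]]] by blast
    have eq: "(\<lambda>x. a + (b * f x + ?g x)) = (\<lambda>x. poly p (f x))"
      by (simp add: p fun_eq_iff power2_eq_square algebra_simps)
    have "norm a + (norm b * A + C * (1 + R * real (d + 2)) ^ N * (3 * M / \<rho>\<^sup>2 * I)) \<le> C' * (1 + real d) ^ N * M"
    proof -
      have one: "1 \<le> (1 + real d) ^ N" by (rule one_le_power) simp
      have "1 + R * real (d + 2) \<le> (1 + 2 * R) * (1 + real d)"
        using f(2) by (simp add: algebra_simps mult_nonneg_nonneg)
      then have "(1 + R * real (d + 2)) ^ N \<le> ((1 + 2 * R) * (1 + real d)) ^ N"
        using f(2) by (intro power_mono) auto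
      then have "C * (1 + R * real (d + 2)) ^ N * (3 * M / \<rho>\<^sup>2 * I) \<le> C * ((1 + 2 * R) ^ N * (1 + real d) ^ N) * (3 * M / \<rho>\<^sup>2 * I)"
        using C M0 I0 by (intro mult_right_mono mult_left_mono) (auto simp: power_mult_distrib)
      moreover have "norm b * A \<le> M / \<rho> * A" using bd(2) A0 by (rule mult_right_mono)
      moreover have "M / \<rho> * A \<le> M / \<rho> * A * (1 + real d) ^ N"
      proof -
        have "0 \<le> M / \<rho> * A" using M0 rho A0 by simp
        from mult_left_mono[OF one this] show ?thesis by simp
      qed
      moreover have "M \<le> M * (1 + real d) ^ N"
        using mult_left_mono[OF one M0] by simp
      ultimately have "norm a + (norm b * A + C * (1 + R * real (d + 2)) ^ N * (3 * M / \<rho>\<^sup>2 * I))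
        \<le> M * (1 + real d) ^ N + (M / \<rho> * A * (1 + real d) ^ N + C * ((1 + 2 * R) ^ N * (1 + real d) ^ N) * (3 * M / \<rho>\<^sup>2 * I))"
        using bd(1) by linarith
      also have "\<dots> = C' * (1 + real d) ^ N * M" by (simp add: C'_def algebra_simps)
      finally show ?thesis .
    qed
    from ufl_le_mono[OF u this] show ?thesis unfolding eq .
  qed
  then show ?thesis using C' by (intro exI[of _ C'] exI[of _ N]) auto
qed

text \<open>Expand p(f) as the sum of P_j(g) (f-g)^j with g band-limited and f - g of algebra norm
  at most e. Cauchy's inequality on circles of radius 2e bounds P_j by M/(2e)^j, while (f-g)^j costs
  e^j, so the sum is dominated by a geometric series of ratio 1/2. All P_j have degree at most d and
  share the constants of the band-limited estimate.\<close>

lemma ufl_le_poly_fl_le: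
  assumes f: "fl_le f A" and S: "0 \<in> S" "\<And>x. f x \<in> S" and eta: "0 < \<eta>"
  shows "\<exists>C N. 0 \<le> C \<and> (\<forall>p d M. degree p \<le> d \<longrightarrow> (\<forall>s\<in>S. \<forall>z\<in>ball s \<eta>. norm (poly p z) \<le> M) \<longrightarrow>
    ufl_le (\<lambda>x. poly p (f x)) (C * (1 + real d) ^ N * M))"
proof -
  \<comment> \<open>The Taylor polynomials are evaluated within e of S, and Cauchy circles of radius
    2e are drawn there; 3e < \<eta> keeps them where p is bounded.\<close>
  define e where "e = \<eta> / 8"
  have e: "0 < e" using eta by (simp add: e_def)
  obtain R g where g: "0 \<le> R" "band_lim R g" "fl_le (\<lambda>x. f x - g x) e" using fl_le_band_lim_approx[OF f e] by blast
  have flg: "fl_le g (A + e)" using fl_le_add[OF f fl_le_cmult[OF g(3), of "- 1"]] by simp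
  obtain C N where C: "0 \<le> C" and CN: "\<And>p d M. degree p \<le> d \<Longrightarrow> (\<And>z. norm z \<le> e \<Longrightarrow> norm (poly p z) \<le> M) \<Longrightarrow>
    (\<And>x. norm (poly p (g x)) \<le> M) \<Longrightarrow> ufl_le (\<lambda>x. poly p (g x)) (C * (1 + real d) ^ N * M)"
    using ufl_le_poly_band_lim[OF g(2,1) flg e] by blast
  have "ufl_le (\<lambda>x. poly p (f x)) (2 * C * (1 + real d) ^ N * M)"
    if d: "degree p \<le> d" and M: "\<And>s z. s \<in> S \<Longrightarrow> z \<in> ball s \<eta> \<Longrightarrow> norm (poly p z) \<le> M" for p d M
  proof -
    have "norm (poly p 0) \<le> M" by (rule M[OF S(1)]) (use eta in simp)
    then have M0: "0 \<le> M" by (rule order_trans[OF norm_ge_zero])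
    define P where "P j = smult (1 / fact j) ((pderiv ^^ j) p)" for j
    have Pdeg: "degree (P j) \<le> d" for j
      using d degree_higher_pderiv_le[of j p] degree_smult_le[of "1 / fact j" "(pderiv ^^ j) p"]
      unfolding P_def by linarith
    have Pbd: "norm (poly (P j) z) \<le> M / (2 * e) ^ j" if z: "s \<in> S" "dist s z \<le> e" for j s z
    proof -
      have "norm (poly ((pderiv ^^ j) p) z) \<le> fact j * M / (2 * e) ^ j"
      proof (rule poly_Cauchy_inequality)
        fix y assume y: "norm (z - y) = 2 * e"
        have "dist s y \<le> dist s z + dist z y" by (rule dist_triangle)
        then have "dist s y < \<eta>" using y z e by (simp add: dist_norm e_def)
        then show "norm (poly p y) \<le> M" using M[OF z(1), of y] by simp
      qed (use e in simp)
      then show ?thesis by (simp add: P_def norm_mult norm_divide field_simps)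
    qed
    have ubj: "ufl_le (\<lambda>x. poly (P j) (g x) * (f x - g x) ^ j) (C * (1 + real d) ^ N * M * (1 / 2) ^ j)" for j
    proof -
      have "ufl_le (\<lambda>x. poly (P j) (g x)) (C * (1 + real d) ^ N * (M / (2 * e) ^ j))"
      proof (rule CN[OF Pdeg])
        \<comment> \<open>The band-limited estimate also wants a disc about 0; it is near S because
          0 belongs to S.\<close>
        show "norm (poly (P j) z) \<le> M / (2 * e) ^ j" if "norm z \<le> e" for z
          using Pbd[OF S(1)] that by simp
        show "norm (poly (P j) (g x)) \<le> M / (2 * e) ^ j" for x
          using Pbd[OF S(2)] fl_le_bound[OF g(3), of x] by (simp add: dist_norm)
      qed
      then have "ufl_le (\<lambda>x. poly (P j) (g x) * (f x - g x) ^ j) (C * (1 + real d) ^ N * (M / (2 * e) ^ j) * e ^ j)"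
        by (rule ufl_le_mult[OF _ ufl_le_power[OF ufl_le_fl_le[OF g(3)]]])
      moreover have "C * (1 + real d) ^ N * (M / (2 * e) ^ j) * e ^ j = C * (1 + real d) ^ N * M * (1 / 2) ^ j"
        using e by (simp add: power_mult_distrib power_divide)
      ultimately show ?thesis by simp
    qed
    have "ufl_le (\<lambda>x. poly p (f x)) (\<Sum>j. C * (1 + real d) ^ N * M * (1 / 2) ^ j)"
    proof (rule ufl_le_sums[OF ubj])
      show "summable (\<lambda>j. C * (1 + real d) ^ N * M * (1 / 2) ^ j)"
        by (intro summable_mult summable_geometric) simp
      fix x
      have "(\<lambda>n. (deriv ^^ n) (poly p) (g x) / fact n * (f x - g x) ^ n) sums poly p (f x)"
        by (rule holomorphic_power_series[OF poly_holomorphic, of _ _ "dist (g x) (f x) + 1"]) auto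
      then show "(\<lambda>j. poly (P j) (g x) * (f x - g x) ^ j) sums poly p (f x)"
        by (simp add: higher_deriv_poly P_def)
    qed
    moreover have "(\<Sum>j. C * (1 + real d) ^ N * M * (1 / 2) ^ j) = 2 * C * (1 + real d) ^ N * M"
      using suminf_mult[OF summable_geometric[of "1 / 2 :: real"], of "C * (1 + real d) ^ N * M"]
      by (simp add: suminf_geometric)
    ultimately show ?thesis by simp
  qed
  then show ?thesis using C by (intro exI[of _ "2 * C"] exI[of _ N]) auto
qed

end

section \<open>The Sobolev weight and the theorem\<close>

lemma jbr_ge_1: "1 \<le> jbr x"
  by (simp add: jbr_def)

lemma norm_le_jbr: "norm x \<le> jbr x"
  unfolding jbr_def by (rule real_le_rsqrt) simp

lemma jbr_le: "jbr x \<le> 1 + norm x"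
proof -
  have "1 + (norm x)\<^sup>2 \<le> (1 + norm x)\<^sup>2" by (simp add: power2_sum)
  then show ?thesis unfolding jbr_def by (intro real_le_lsqrt) auto
qed

lemma jbr_add_le: "jbr (x + y) \<le> jbr x + jbr y"
proof -
  have sq: "(jbr z)\<^sup>2 = 1 + (norm z)\<^sup>2" for z :: 'a by (simp add: jbr_def)
  have "(norm (x + y))\<^sup>2 \<le> (norm x + norm y)\<^sup>2"
    using norm_triangle_ineq by (intro power_mono) auto
  also have "\<dots> = (norm x)\<^sup>2 + (norm y)\<^sup>2 + 2 * (norm x * norm y)"
    by (simp add: power2_sum)
  also have "norm x * norm y \<le> jbr x * jbr y"
    using jbr_ge_1[of x] by (intro mult_mono norm_le_jbr) auto
  finally have "1 + (norm (x + y))\<^sup>2 \<le> (jbr x + jbr y)\<^sup>2"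
    by (simp add: power2_sum sq)
  then show ?thesis
    unfolding jbr_def[of "x + y"] using jbr_ge_1[of x] jbr_ge_1[of y] by (intro real_le_lsqrt) auto
qed

lemma jbr_measurable [measurable]: "jbr \<in> borel_measurable borel"
  unfolding jbr_def[abs_def] by measurable

text \<open>Dyadic comparison: where 2^k \<le> \<open>jbr x\<close> < 2^(k+1) the integrand is at
  most 2^(-pk), and x lies in a ball of volume V 2^((k+1)n). The resulting series is geometric with
  ratio 2^(n-p) < 1.\<close>

lemma integrable_jbr_powr:
  assumes p: "real DIM('a) < p"
  shows "integrable lborel (\<lambda>x::'a::euclidean_space. jbr x powr (- p))"
proof (rule integrableI_bounded)
  let ?n = "DIM('a)"
  let ?V = "unit_ball_vol (real ?n)"
  define r where "r = 2 powr (real ?n - p)"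
  have r: "0 < r" "r < 1" using p by (auto simp: r_def powr_less_one)
  have V: "0 \<le> ?V" by (rule unit_ball_vol_nonneg) simp
  have "(\<integral>\<^sup>+x. ennreal (norm (jbr (x::'a) powr (- p))) \<partial>lborel) \<le>
     (\<integral>\<^sup>+x. (\<Sum>k. ennreal (2 powr (- p * real k)) * indicator (ball (0::'a) (2 ^ Suc k)) x) \<partial>lborel)"
  proof (intro nn_integral_mono)
    fix x :: 'a
    obtain m where m: "jbr x < 2 ^ m" using real_arch_pow[of 2 "jbr x"] by auto
    define k where "k = (LEAST k. jbr x < 2 ^ Suc k)"
    have "(0::real) \<le> 2 ^ m" by simp
    then have "jbr x < 2 ^ Suc m" using m unfolding power_Suc by linarith
    then have k1: "jbr x < 2 ^ Suc k" unfolding k_def by (rule LeastI)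
    have k2: "2 ^ k \<le> jbr x"
    proof (cases k)
      case (Suc j)
      then have "\<not> jbr x < 2 ^ Suc j" unfolding k_def by (intro not_less_Least) auto
      then show ?thesis using Suc by simp
    qed (simp add: jbr_ge_1)
    have "jbr x powr (- p) \<le> (2 ^ k) powr (- p)"
      using k2 p by (intro powr_mono2') auto
    also have "\<dots> = 2 powr (- p * real k)"
      by (simp add: powr_realpow[symmetric] powr_powr mult.commute)
    finally have "ennreal (norm (jbr x powr (- p))) \<le> ennreal (2 powr (- p * real k)) * indicator (ball 0 (2 ^ Suc k)) x"
      using k1 norm_le_jbr[of x] by (auto simp: indicator_def ennreal_leI)
    also have "\<dots> \<le> (\<Sum>k. ennreal (2 powr (- p * real k)) * indicator (ball 0 (2 ^ Suc k)) x)"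
    proof -
      have "sum \<phi> {k} \<le> suminf \<phi>" for \<phi> :: "nat \<Rightarrow> ennreal" by (rule sum_le_suminf) auto
      from this[of "\<lambda>k. ennreal (2 powr (- p * real k)) * indicator (ball 0 (2 ^ Suc k)) x"]
      show ?thesis by (simp only: sum.insert sum.empty finite.emptyI empty_iff add_0_right simp_thms if_False)
    qed
    finally show "ennreal (norm (jbr x powr (- p))) \<le> (\<Sum>k. ennreal (2 powr (- p * real k)) * indicator (ball 0 (2 ^ Suc k)) x)" .
  qed
  also have "\<dots> = (\<Sum>k. ennreal (2 powr (- p * real k)) * emeasure lborel (ball (0::'a) (2 ^ Suc k)))"
  proof -
    have "(\<integral>\<^sup>+x. ennreal a * indicator (ball (0::'a) \<rho>) x \<partial>lborel) = ennreal a * emeasure lborel (ball (0::'a) \<rho>)" for a \<rho>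
      by (rule nn_integral_cmult_indicator) simp
    moreover have "(\<lambda>x. ennreal a * indicator (ball 0 \<rho>) x) \<in> borel_measurable (lborel :: 'a measure)" for a \<rho>
      by (intro borel_measurable_times_ennreal borel_measurable_const borel_measurable_indicator) simp
    ultimately show ?thesis by (simp only: nn_integral_suminf)
  qed
  also have "\<dots> = (\<Sum>k. ennreal (?V * 2 ^ ?n * r ^ k))"
  proof (intro suminf_cong)
    fix k
    have "r ^ k = 2 powr (- p * real k) * (2 ^ k) ^ ?n"
    proof -
      have "r ^ k = 2 powr ((real ?n - p) * real k)" by (simp add: r_def powr_power mult.commute)
      moreover have "(2 ^ k) ^ ?n = (2::real) powr (real k * real ?n)"
        by (simp add: powr_realpow flip: power_mult of_nat_mult)
      moreover have "(real ?n - p) * real k = - p * real k + real k * real ?n" by (simp add: algebra_simps)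
      ultimately show ?thesis by (simp only: powr_add)
    qed
    then have "2 powr (- p * real k) * (?V * (2 ^ Suc k) ^ ?n) = ?V * 2 ^ ?n * r ^ k"
      by (simp add: power_mult_distrib mult_ac)
    moreover have "emeasure lborel (ball (0::'a) (2 ^ Suc k)) = ennreal (?V * (2 ^ Suc k) ^ ?n)"
      by (rule emeasure_ball) simp
    moreover have "ennreal (2 powr (- p * real k)) * ennreal (?V * (2 ^ Suc k) ^ ?n) = ennreal (2 powr (- p * real k) * (?V * (2 ^ Suc k) ^ ?n))"
      using V by (intro ennreal_mult[symmetric]) auto
    ultimately show "ennreal (2 powr (- p * real k)) * emeasure lborel (ball (0::'a) (2 ^ Suc k)) = ennreal (?V * 2 ^ ?n * r ^ k)"
      by (simp only:)
  qed
  also have "\<dots> = ennreal (\<Sum>k. ?V * 2 ^ ?n * r ^ k)"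
    using r V by (intro suminf_ennreal2 summable_mult summable_geometric) auto
  finally show "(\<integral>\<^sup>+x. ennreal (norm (jbr (x::'a) powr (- p))) \<partial>lborel) < \<infinity>"
    by (simp add: le_less_trans)
qed measurable

text \<open>The constant 2^s stems from \<open>jbr (x + y)\<close> being at most twice the larger of
  \<open>jbr x\<close> and \<open>jbr y\<close>. Integrability amounts to s q' > n, and s > 0
  follows from the same hypothesis.\<close>

lemma fourier_weight_jbr:
  fixes q s :: real
  assumes "1 < q" "s > real DIM('a) / conj_exp q"
  shows "fourier_weight q (2 powr s) (\<lambda>x::'a::euclidean_space. jbr x powr s)"
proof
  have conj: "1 < conj_exp q" using assms(1) by (simp add: conj_exp_def)
  then have s: "0 < s" using assms(2) by (meson divide_nonneg_nonneg le_less_trans of_nat_0_le_iff less_imp_le less_trans zero_less_one)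
  show "1 < q" by fact
  show "(\<lambda>x::'a. jbr x powr s) \<in> borel_measurable borel" by measurable
  show "1 \<le> jbr x powr s" for x :: 'a using s jbr_ge_1[of x] by (simp add: ge_one_powr_ge_zero)
  show "jbr (x + y) powr s \<le> 2 powr s * max (jbr x powr s) (jbr y powr s)" for x y :: 'a
  proof -
    have pos: "0 \<le> jbr x" "0 \<le> jbr y" "0 \<le> jbr (x + y)" using jbr_ge_1 by (meson order_trans zero_le_one)+
    have "jbr (x + y) powr s \<le> (2 * max (jbr x) (jbr y)) powr s"
      using jbr_add_le[of x y] pos s by (intro powr_mono2) auto
    also have "\<dots> = 2 powr s * max (jbr x) (jbr y) powr s"
      using pos by (simp add: powr_mult)
    also have "\<dots> \<le> 2 powr s * max (jbr x powr s) (jbr y powr s)"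
      by (intro mult_left_mono) (auto simp: max_def)
    finally show ?thesis .
  qed
  show "integrable lborel (\<lambda>x::'a. (jbr x powr s) powr - (q / (q - 1)))"
  proof -
    have "real DIM('a) < s * conj_exp q" using assms(2) conj by (simp add: pos_divide_less_eq)
    from integrable_jbr_powr[OF this] show ?thesis by (simp add: powr_powr conj_exp_def)
  qed
  show "\<exists>N::nat. \<forall>x::'a. jbr x powr s \<le> (1 + norm x) ^ N"
  proof (intro exI allI)
    fix x :: 'a
    have "jbr x powr s \<le> (1 + norm x) powr s"
      using jbr_le[of x] jbr_ge_1[of x] s by (intro powr_mono2) auto
    also have "\<dots> \<le> (1 + norm x) powr real (nat \<lceil>s\<rceil>)"
      by (intro powr_mono real_nat_ceiling_ge) auto
    also have "\<dots> = (1 + norm x) ^ nat \<lceil>s\<rceil>"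
      by (rule powr_realpow) (simp add: add_pos_nonneg)
    finally show "jbr x powr s \<le> (1 + norm x) ^ nat \<lceil>s\<rceil>" .
  qed
qed

lemma zero_in_closure_range:
  fixes f :: "'a::euclidean_space \<Rightarrow> complex"
  assumes "(f \<longlongrightarrow> 0) at_infinity"
  shows "0 \<in> closure (range f)"
  unfolding closure_approachable
proof (intro allI impI)
  fix e :: real assume "0 < e"
  then obtain b where b: "\<And>x. b \<le> norm x \<Longrightarrow> dist (f x) 0 < e"
    using assms unfolding Lim_at_infinity by blast
  obtain x :: 'a where "norm x = max b 0" using vector_choose_size[of "max b 0"] by auto
  then show "\<exists>y\<in>range f. dist y 0 < e" using b[of x] by auto
qed

text \<open>Up to a small disc about 0 the range is the image of a ball, hence compact. A closure
  point y other than 0 is caught by choosing the disc of radius |y|/2, which excludes y.\<close>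

lemma compact_insert_0_range:
  fixes f :: "'a::euclidean_space \<Rightarrow> complex"
  assumes cont: "continuous_on UNIV f" and lim: "(f \<longlongrightarrow> 0) at_infinity"
  shows "compact (insert 0 (range f))"
proof -
  have cover: "\<exists>b. insert 0 (range f) \<subseteq> f ` cball 0 b \<union> cball 0 e" if e: "0 < e" for e
  proof -
    obtain b where b: "\<And>x. b \<le> norm x \<Longrightarrow> dist (f x) 0 < e"
      using lim e unfolding Lim_at_infinity by blast
    have "f x \<in> f ` cball 0 b \<union> cball 0 e" for x
      using b[of x] by (cases "b \<le> norm x") auto
    then have "range f \<subseteq> f ` cball 0 b \<union> cball 0 e" by blast
    moreover have "0 \<in> f ` cball 0 b \<union> cball 0 e" using e by simp
    ultimately show ?thesis by blast
  qed
  have im: "compact (f ` cball 0 b)" for b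
    using cont by (intro compact_continuous_image) (auto intro: continuous_on_subset)
  have "bounded (insert 0 (range f))"
  proof -
    obtain b where "insert 0 (range f) \<subseteq> f ` cball 0 b \<union> cball 0 1" using cover[of 1] by auto
    moreover have "bounded (f ` cball 0 b \<union> cball 0 1)" using compact_imp_bounded[OF im] by simp
    ultimately show ?thesis using bounded_subset by blast
  qed
  moreover have "closed (insert 0 (range f))"
  proof -
    have "y \<in> insert 0 (range f)" if y: "y \<in> closure (insert 0 (range f))" for y
    proof (cases "y = 0")
      case False
      then obtain b where "insert 0 (range f) \<subseteq> f ` cball 0 b \<union> cball 0 (norm y / 2)"
        using cover[of "norm y / 2"] by auto
      moreover have "closed (f ` cball 0 b \<union> cball 0 (norm y / 2))" by (intro closed_Un compact_imp_closed[OF im] closed_cball)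
      ultimately have "y \<in> f ` cball 0 b \<union> cball 0 (norm y / 2)"
        using y closure_minimal by blast
      then show ?thesis using False by auto
    qed simp
    then show ?thesis by (metis closure_subset closure_closed subsetI subset_antisym closed_closure)
  qed
  ultimately show ?thesis using compact_eq_bounded_closed by blast
qed

lemma of_real_image_Re_image:
  assumes "K \<subseteq> \<real>"
  shows "complex_of_real ` (Re ` K) = K"
proof -
  have "complex_of_real (Re z) = id z" if "z \<in> K" for z
    using assms that by (simp add: subset_iff)
  then have "(\<lambda>z. complex_of_real (Re z)) ` K = id ` K" by (rule image_cong[OF refl])
  then show ?thesis by (simp add: image_image)
qed

text \<open>The range with 0 added lies between the connected range and its closure, so it is
  connected; being also compact and real, it is a closed interval.\<close>

lemma real_range_subset_interval:
  fixes f :: "'a::euclidean_space \<Rightarrow> complex"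
  assumes cont: "continuous_on UNIV f" and lim: "(f \<longlongrightarrow> 0) at_infinity"
    and real: "\<And>x. f x \<in> \<real>" and U: "open U" "insert 0 (range f) \<subseteq> U"
  obtains a b where "a < b" "insert 0 (range f) \<subseteq> complex_of_real ` {a..b}" "complex_of_real ` {a..b} \<subseteq> U"
proof -
  let ?K = "insert 0 (range f)"
  have comp: "compact ?K" by (rule compact_insert_0_range[OF cont lim])
  have conn: "connected ?K"
  proof (rule connected_intermediate_closure[of "range f"])
    show "connected (range f)" using cont connected_UNIV by (rule connected_continuous_image)
    show "?K \<subseteq> closure (range f)" 
      using zero_in_closure_range[OF lim] closure_subset[of "range f"] by (simp only: insert_subset)
  qed (rule subset_insertI)
  have "continuous_on ?K Re" by (intro continuous_intros)
  then have "connected (Re ` ?K)" "compact (Re ` ?K)"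
    by (rule connected_continuous_image[OF _ conn], rule compact_continuous_image[OF _ comp])
  from iffD1[OF connected_compact_interval_1, OF conjI[OF this]]
  obtain a b where ab: "Re ` ?K = {a..b}" by (elim exE)
  have K: "?K = complex_of_real ` {a..b}"
  proof -
    have "?K \<subseteq> \<real>" using real by auto
    from of_real_image_Re_image[OF this] show ?thesis unfolding ab ..
  qed
  obtain e where e: "e > 0" "(\<Union>k\<in>?K. ball k e) \<subseteq> U"
    using compact_subset_open_imp_ball_epsilon_subset[OF comp U] by blast
  have "Re 0 \<in> {a..b}" unfolding ab[symmetric] by (intro imageI insertI1)
  then have "a \<le> b" by auto
  \<comment> \<open>The interval is widened within U because it may be a single point (for f = 0),
    whereas the polynomial expansion requires a < b.\<close>
  have sub: "complex_of_real ` {a - e/2..b + e/2} \<subseteq> U"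
  proof
    fix z assume "z \<in> complex_of_real ` {a - e/2..b + e/2}"
    then obtain x where x: "z = of_real x" "a - e/2 \<le> x" "x \<le> b + e/2" by auto
    define y where "y = max a (min b x)"
    have "y \<in> {a..b}" "\<bar>y - x\<bar> < e" using x e(1) \<open>a \<le> b\<close> by (auto simp: y_def max_def min_def)
    then have "of_real y \<in> ?K" "z \<in> ball (of_real y) e"
      unfolding K by (auto simp: x(1) dist_norm simp flip: of_real_diff)
    then show "z \<in> U" using e(2) by blast
  qed
  show ?thesis
    by (rule that[of "a - e/2" "b + e/2"]) (use sub K e(1) \<open>a \<le> b\<close> in auto)
qed

theorem theorem1p2:
  fixes q s :: real and f :: "'a::euclidean_space \<Rightarrow> complex"
    and F :: "complex \<Rightarrow> complex" and U :: "complex set"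
  assumes "1 < q"
    and "s > real DIM('a) / conj_exp q"
    and "f \<in> FL q s"
    and "\<forall>x. f x \<in> \<real>"
    and "open U" and "range f \<union> {0} \<subseteq> U"
    and "F analytic_on U"
    and "F 0 = 0"
  shows "\<exists>g \<in> FL q s. \<forall>x. g x = F (f x)"
proof -
  define w where "w x = jbr x powr s" for x :: 'a
  interpret fourier_weight q "2 powr s" w
    unfolding w_def[abs_def] by (rule fourier_weight_jbr[OF assms(1,2)])
  obtain h where h: "h \<in> borel_measurable lborel" "integrable lborel h"
    "integrable lborel (\<lambda>\<xi>. (w \<xi> * norm (h \<xi>)) powr q)" "f = inv_fourier h"
    using assms(3) unfolding FL_def w_def by auto
  define B where "B = (LINT \<xi>|lborel. (w \<xi> * norm (h \<xi>)) powr q) powr (1 / q)"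
  have "wlq_le h B"
  proof (rule hbI)
    have "(\<integral>\<^sup>+\<xi>. ennreal ((w \<xi> * norm (h \<xi>)) powr q) \<partial>lborel) = ennreal (LINT \<xi>|lborel. (w \<xi> * norm (h \<xi>)) powr q)"
      using h(3) by (intro nn_integral_eq_integral) auto
    also have "\<dots> = ennreal (B powr q)"
      using assms(1) by (simp add: B_def powr_powr integral_nonneg_AE)
    finally show "(\<integral>\<^sup>+\<xi>. ennreal ((w \<xi> * norm (h \<xi>)) powr q) \<partial>lborel) \<le> ennreal (B powr q)" by simp
  qed (use h in \<open>auto simp: B_def\<close>)
  then have f: "fl_le f (\<kappa> * B)" unfolding fl_le_def using h(4) \<kappa>_pos by (intro exI[of _ h]) auto
  have cont: "continuous_on UNIV f" using continuous_inv_fourier[OF h(2)] h(4) by simp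
  obtain a b where ab: "a < b" "insert 0 (range f) \<subseteq> complex_of_real ` {a..b}" "complex_of_real ` {a..b} \<subseteq> U"
    using real_range_subset_interval[OF cont fl_le_vanishes_at_infinity[OF f], of U] assms by auto
  have holF: "F holomorphic_on U" using assms(7) by (rule analytic_imp_holomorphic)
  obtain Q D C \<theta> \<eta> where Q: "0 < \<eta>" "0 \<le> C" "0 < \<theta>" "\<theta> < 1" "\<And>m. degree (Q m) \<le> D * (m + 1)"
    and Qbd: "\<And>m x z. x \<in> {a..b} \<Longrightarrow> z \<in> ball (complex_of_real x) \<eta> \<Longrightarrow> norm (poly (Q m) z) \<le> C * \<theta> ^ m"
    and Qsums: "\<And>x z. x \<in> {a..b} \<Longrightarrow> z \<in> ball (complex_of_real x) \<eta> \<Longrightarrow> (\<lambda>m. poly (Q m) z) sums F z"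
    using polynomial_series_near_interval[OF ab(1) assms(5) ab(3) holF] by metis
  define S where "S = complex_of_real ` {a..b}"
  have S: "0 \<in> S" "f x \<in> S" for x using ab(2) by (auto simp: S_def)
  obtain C' N where C': "0 \<le> C'" and poly_ufl_le: "\<And>p d M. degree p \<le> d \<Longrightarrow> (\<And>s z. s \<in> S \<Longrightarrow> z \<in> ball s \<eta> \<Longrightarrow> norm (poly p z) \<le> M)
    \<Longrightarrow> ufl_le (\<lambda>x. poly p (f x)) (C' * (1 + real d) ^ N * M)"
    using ufl_le_poly_fl_le[OF f S Q(1)] by blast
  \<comment> \<open>\<open>C'\<close> and \<open>N\<close> are the same for every m, so the m-th
    polynomial pays only the N-th power of a linear function of m against the decay
    \<theta>^m.\<close>
  have u: "ufl_le (\<lambda>x. poly (Q m) (f x)) (C' * (1 + real (D * (m + 1))) ^ N * (C * \<theta> ^ m))" for m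
    by (rule poly_ufl_le[OF Q(5)]) (use Qbd in \<open>auto simp: S_def\<close>)
  have sm: "summable (\<lambda>m. C' * (1 + real (D * (m + 1))) ^ N * (C * \<theta> ^ m))"
    using summable_mult[OF summable_power_mult_geometric[OF Q(3,4) of_nat_0_le_iff, of D N], of "C' * C"]
    by (simp only: of_nat_mult mult_ac)
  have sums: "(\<lambda>m. poly (Q m) (f x)) sums F (f x)" for x
  proof -
    obtain y where "y \<in> {a..b}" "f x = of_real y" using S(2)[of x] by (auto simp: S_def)
    then show ?thesis using Qsums[of y "f x"] Q(1) by simp
  qed
  obtain c g A where g: "fl_le g A" "(\<lambda>x. F (f x)) = (\<lambda>x. c + g x)"
    using ufl_le_sums[OF u sm sums] unfolding ufl_le_def by (elim exE conjE)
  have "c = 0"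
  proof -
    have "isCont F 0"
      using holomorphic_on_imp_continuous_on[OF holF] assms(6) by (simp add: continuous_on_eq_continuous_at[OF assms(5)])
    then have "((\<lambda>x. F (f x)) \<longlongrightarrow> F 0) at_infinity"
      using fl_le_vanishes_at_infinity[OF f] by (rule isCont_tendsto_compose)
    then have "((\<lambda>x. c + g x) \<longlongrightarrow> 0) at_infinity" using assms(8) g(2) by simp
    moreover have "((\<lambda>x. c + g x) \<longlongrightarrow> c + 0) at_infinity"
      by (intro tendsto_add tendsto_const fl_le_vanishes_at_infinity[OF g(1)])
    ultimately have "0 = c + 0" by (rule tendsto_unique[OF trivial_limit_at_infinity])
    then show ?thesis by simp
  qed
  obtain k where k: "wlq_le k (A / \<kappa>)" "g = inv_fourier k" using g(1) by (auto simp: fl_le_def)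
  note [measurable] = wlq_le_measurable[OF k(1)]
  have "integrable lborel (\<lambda>\<xi>. (w \<xi> * norm (k \<xi>)) powr q)"
    using wlq_le_le[OF k(1)] by (intro integrableI_bounded) (auto intro: le_less_trans)
  then have "g \<in> FL q s"
    unfolding FL_def using k wlq_le_L1(1)[OF k(1)] by (auto simp: w_def intro!: exI[of _ k])
  moreover have "g x = F (f x)" for x using fun_cong[OF g(2), of x] \<open>c = 0\<close> by simp
  ultimately show ?thesis by blast
qed

end
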